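(* Assume the process $\{F_j\}_{j\in\mathbb Z_+}$ of probability distributions is stationary, ergodic, and has a state space of finitely many distributions $H_1,\dots,H_L$, each of which satisfies $$\int_0^\infty(1-H_\ell(x))^{1/2}\,dx+\int_{-\infty}^0H_\ell(x)^{1/2}\,dx<\infty .$$ Let $\mu^*=\max_\ell\mu(H_\ell)$ be the maximal mean of the $H_\ell$'s. Then there exist constants $0<c_1<c_2<\infty$ such that, as $\alpha\downarrow0$, $$\mu^*+c_1\sqrt\alpha+o(\sqrt\alpha)\ \le\ \Psi(1,\alpha)\ \le\ \mu^*+c_2\sqrt\alpha+o(\sqrt\alpha).$$
   Context: $\mathbb P$ is the distribution of the sequence $\{F_j\}_{j\in\mathbb Z_+}$ of random Borel probability distributions on $\mathbb R$ (the environment), where $\mathbb Z_+=\{0,1,2,\dots\}$; distributions are identified with their distribution functions. Given $\{F_j\}$, the weights $\{X(i,j):(i,j)\in\mathbb Z_+^2\}$ are independent with $X(i,j)\sim F_j$. $T(k,\ell)$ is the maximum of $\sum_{z\in\pi}X(z)$ over all nearest-neighbor lattice paths $\pi$ from $(0,0)$ to $(k,\ell)$ with steps $(1,0)$ or $(0,1)$, the endpoint $(k,\ell)$ excluded. $\Psi(x,y)=\lim_{n\to\infty}\frac1nT(\lfloor nx\rfloor,\lfloor ny\rfloor)$, $(x,y)\in(0,\infty)^2$, is the deterministic limit, almost sure and in $L^1$ over environment and weights. $\mu(H)$ is the mean of the distribution $H$.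
   Formalization: It is additionally assumed that some H_ℓ of maximal mean μ* is not a point mass (otherwise, e.g. all F_j = δ_c, Ψ(1,α) = c(1+α) and no c_1 > 0 exists); the state space is read as each H_ℓ occurring with positive probability. *)

theory Defs
  imports "HOL-Probability.Probability"
begin

text \<open>An environment is a sequence of Borel probability distributions on the real line; the
  $\sigma$-algebra is the product of the usual one on the space of probability distributions.\<close>

definition env_space :: "(nat \<Rightarrow> real measure) measure" where
  "env_space = (\<Pi>\<^sub>M j\<in>UNIV. prob_algebra borel)"

definition env_shift :: "(nat \<Rightarrow> real measure) \<Rightarrow> nat \<Rightarrow> real measure" where
  "env_shift G = (\<lambda>j. G (Suc j))"

definition env_map :: "(nat \<Rightarrow> 'w \<Rightarrow> real measure) \<Rightarrow> 'w \<Rightarrow> nat \<Rightarrow> real measure" where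
  "env_map F = (\<lambda>\<omega> j. F j \<omega>)"

definition env_law :: "'w measure \<Rightarrow> (nat \<Rightarrow> 'w \<Rightarrow> real measure) \<Rightarrow> (nat \<Rightarrow> real measure) measure" where
  "env_law M F = distr M env_space (env_map F)"

definition env_sigma :: "'w measure \<Rightarrow> (nat \<Rightarrow> 'w \<Rightarrow> real measure) \<Rightarrow> 'w measure" where
  "env_sigma M F = vimage_algebra (space M) (env_map F) env_space"

definition stationary_env :: "(nat \<Rightarrow> real measure) measure \<Rightarrow> bool" where
  "stationary_env P \<longleftrightarrow> distr P env_space env_shift = P"

definition ergodic_env :: "(nat \<Rightarrow> real measure) measure \<Rightarrow> bool" where
  "ergodic_env P \<longleftrightarrow>
     (\<forall>A\<in>sets env_space. env_shift -` A \<inter> space env_space = A \<longrightarrow>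
        measure P A = 0 \<or> measure P A = 1)"

text \<open>The state space is exactly the set of the \<open>H l\<close>: the process stays in it almost surely, and
  every \<open>H l\<close> is charged (by stationarity, looking at time \<open>0\<close> suffices).\<close>

definition has_state_space ::
  "'w measure \<Rightarrow> (nat \<Rightarrow> 'w \<Rightarrow> real measure) \<Rightarrow> nat \<Rightarrow> (nat \<Rightarrow> real measure) \<Rightarrow> bool" where
  "has_state_space M F L H \<longleftrightarrow>
     (AE \<omega> in M. \<forall>j. F j \<omega> \<in> H ` {1..L}) \<and>
     (\<forall>l\<in>{1..L}. measure M {\<omega> \<in> space M. F 0 \<omega> = H l} > 0)"

text \<open>Given the whole environment, the weights are independent and the weight at \<open>(i, j)\<close> has
  distribution \<open>F j\<close>; expressed through the conditional finite-dimensional distributions.\<close>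

definition weights_given_env ::
  "'w measure \<Rightarrow> (nat \<Rightarrow> 'w \<Rightarrow> real measure) \<Rightarrow> (nat \<times> nat \<Rightarrow> 'w \<Rightarrow> real) \<Rightarrow> bool" where
  "weights_given_env M F X \<longleftrightarrow>
     (\<forall>z. X z \<in> borel_measurable M) \<and>
     (\<forall>I B. finite I \<longrightarrow> (\<forall>z\<in>I. B z \<in> sets borel) \<longrightarrow>
        (AE \<omega> in M.
           real_cond_exp M (env_sigma M F) (indicator {\<omega> \<in> space M. \<forall>z\<in>I. X z \<omega> \<in> B z}) \<omega>
             = (\<Prod>z\<in>I. measure (F (snd z) \<omega>) (B z))))"

definition lattice_step :: "nat \<times> nat \<Rightarrow> nat \<times> nat \<Rightarrow> bool" where
  "lattice_step z w \<longleftrightarrow> w = (fst z + 1, snd z) \<or> w = (fst z, snd z + 1)"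

definition lattice_paths :: "nat \<Rightarrow> nat \<Rightarrow> (nat \<times> nat) list set" where
  "lattice_paths k l =
     {p. p \<noteq> [] \<and> hd p = (0, 0) \<and> last p = (k, l) \<and> successively lattice_step p}"

text \<open>\<open>butlast\<close> leaves out the weight at the endpoint \<open>(k, l)\<close>.\<close>

definition last_passage :: "(nat \<times> nat \<Rightarrow> real) \<Rightarrow> nat \<Rightarrow> nat \<Rightarrow> real" where
  "last_passage x k l = Max ((\<lambda>p. \<Sum>z\<leftarrow>butlast p. x z) ` lattice_paths k l)"

definition scaled_passage :: "(nat \<times> nat \<Rightarrow> 'w \<Rightarrow> real) \<Rightarrow> real \<Rightarrow> real \<Rightarrow> nat \<Rightarrow> 'w \<Rightarrow> real" where
  "scaled_passage X x y n \<omega> =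
     last_passage (\<lambda>z. X z \<omega>) (nat \<lfloor>real n * x\<rfloor>) (nat \<lfloor>real n * y\<rfloor>) / real n"

text \<open>\<open>\<Psi>\<close> is the deterministic limit on the open quadrant, almost surely and in $L^1$. The values of
  \<open>\<Psi>\<close> outside the open quadrant are unconstrained.\<close>

definition is_limit_shape ::
  "'w measure \<Rightarrow> (nat \<times> nat \<Rightarrow> 'w \<Rightarrow> real) \<Rightarrow> (real \<Rightarrow> real \<Rightarrow> real) \<Rightarrow> bool" where
  "is_limit_shape M X \<Psi> \<longleftrightarrow>
     (\<forall>x>0. \<forall>y>0.
        (AE \<omega> in M. (\<lambda>n. scaled_passage X x y n \<omega>) \<longlonglongrightarrow> \<Psi> x y) \<and>
        (\<lambda>n. \<integral>\<^sup>+\<omega>. ennreal \<bar>scaled_passage X x y n \<omega> - \<Psi> x y\<bar> \<partial>M) \<longlonglongrightarrow> 0)"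

definition mean :: "real measure \<Rightarrow> real" where
  "mean H = (\<integral>x. x \<partial>H)"

definition sqrt_tails_finite :: "real measure \<Rightarrow> bool" where
  "sqrt_tails_finite H \<longleftrightarrow>
     (\<integral>\<^sup>+x\<in>{0..}. ennreal (sqrt (1 - cdf H x)) \<partial>lborel)
     + (\<integral>\<^sup>+x\<in>{..0}. ennreal (sqrt (cdf H x)) \<partial>lborel) < \<infinity>"

text \<open>Some nondegeneracy is needed for a lower bound of order \<open>sqrt \<alpha>\<close> with positive constant: if every
  \<open>F j\<close> is the point mass at \<open>c\<close>, then \<open>\<Psi> 1 \<alpha> = c * (1 + \<alpha>)\<close>.\<close>

definition degenerate :: "real measure \<Rightarrow> bool" where
  "degenerate H \<longleftrightarrow> (\<exists>c. H = return borel c)"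

end

theory Submission imports Defs begin

text \<open>The limit \<open>\<Psi>\<close> is deterministic, so it can be estimated on any event of positive probability. Given
  the finitely many rows met by the paths, the weights are independent, so \<open>\<Psi> 1 \<alpha>\<close> is approximated by
  expectations of last passage times in boxes of width \<open>n\<close> and height \<open>m\<close>, with \<open>m\<close> close to \<open>\<alpha> n\<close>,
  for a product measure with fixed row distributions. Stationarity yields such row patterns in which a
  positive fraction of the rows has a given nondegenerate distribution of maximal mean.

  Lower bound: cut the \<open>n\<close> columns into blocks of width \<open>B\<close> of order \<open>1 / \<alpha>\<close>, reserve for each block two of
  these rows, and cross the block in the better one. This gains order \<open>sqrt B\<close> per block, hence
  \<open>n / sqrt B\<close> in total, while vertical moves only cost order \<open>m\<close>.

  Upper bound: \<open>X - mean\<close> is the integral over \<open>x\<close> of the centered indicators \<open>cdf x - 1{X \<le> x}\<close>, so it is enough to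
  bound the last passage time of each of these bounded fields by \<open>sqrt (p n m)\<close>, \<open>p\<close> the tail at \<open>x\<close>;
  the hypothesis on square roots of tails makes the bounds integrable. To avoid the logarithm lost by a
  union bound over all paths, group the box into cells such that only exponentially many (in the
  number of visited cells) coarse paths remain, and such that the maximal contribution of a cell has
  a bounded exponential moment on its natural scale: cells of width \<open>n / m\<close> in a single row if
  \<open>p n \<ge> m\<close>, and cells of area \<open>1 / p\<close> otherwise.\<close>

section \<open>Lattice paths and coarse graining\<close>

text \<open>The two cell shapes give the same total. In the dense case a path meets about
  \<open>2 m\<close> cells, each of scale \<open>sqrt (p n / m)\<close>; in the sparse case about
  \<open>2 sqrt (p n m)\<close> cells, each of scale 1. The threshold comes from the exponential
  moments: the quadratic bound on \<open>exp\<close> needs an argument of size at most 1, hence a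
  cell whose standard deviation is at least of order 1. If a row interval of length
  \<open>n / m\<close> does not reach this, cells must spread over several rows, and there plain
  counts without cancellation suffice.

  In the lower bound, \<open>B\<close> of order \<open>1 / \<alpha>\<close> is forced by the supply
  of rows: \<open>n / B\<close> blocks use up \<open>2 n / B\<close> good rows, of which about
  \<open>p0 \<alpha> n / 2\<close> are at hand, \<open>p0\<close> being the chance of a good row.
  The terms of order \<open>\<alpha>\<close> (vertical moves below, the extra
  \<open>\<alpha> \<mu>\<close> above) go into the \<open>o\<close> terms.

  A single row pattern may have a probability that shrinks with \<open>n\<close>, so an L1 error
  cannot be divided by it. Only the total mass of the rich patterns stays bounded below; one works
  with the best of them, which may change with \<open>n\<close>.\<close>

lemma lattice_paths_snoc:
  assumes "q \<in> lattice_paths a b" "lattice_step (a, b) (k, l)"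
  shows "q @ [(k, l)] \<in> lattice_paths k l"
  using assms by (auto simp: lattice_paths_def successively_append_iff)

lemma lattice_paths_origin: "[(0, 0)] \<in> lattice_paths 0 0"
  by (simp add: lattice_paths_def)

lemma lattice_paths_cases:
  assumes "p \<in> lattice_paths k l"
  obtains "k = 0" "l = 0" "p = [(0, 0)]"
    | a b q where "q \<in> lattice_paths a b" "lattice_step (a, b) (k, l)" "p = q @ [(k, l)]"
proof (cases "butlast p = []")
  case True
  then obtain z where "p = [z]"
    using assms by (cases p rule: rev_cases) (auto simp: lattice_paths_def)
  then show ?thesis using assms that(1) by (auto simp: lattice_paths_def)
next
  case False
  define q where "q = butlast p"
  have p: "p = q @ [(k, l)]"
    using assms append_butlast_last_id[of p] by (auto simp: lattice_paths_def q_def)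
  obtain a b where ab: "last q = (a, b)" by (cases "last q")
  have "q \<noteq> []" using False q_def by simp
  have "q \<in> lattice_paths a b" "lattice_step (a, b) (k, l)"
    using assms \<open>q \<noteq> []\<close> ab unfolding p
    by (auto simp: lattice_paths_def successively_append_iff)
  then show ?thesis using that(2) p by blast
qed

lemma lattice_path_induct [consumes 1, case_names origin step]:
  assumes "p \<in> lattice_paths k l"
    and "P [(0, 0)] 0 0"
    and "\<And>q a b k l. q \<in> lattice_paths a b \<Longrightarrow> P q a b \<Longrightarrow> lattice_step (a, b) (k, l) \<Longrightarrow>
           P (q @ [(k, l)]) k l"
  shows "P p k l"
  using assms(1)
proof (induction p arbitrary: k l rule: length_induct)
  case (1 p)
  from 1(2) show ?case
  proof (cases rule: lattice_paths_cases)
    case 1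
    then show ?thesis using assms(2) by simp
  next
    case (2 a b q)
    then show ?thesis using 1(1) assms(3) by simp
  qed
qed

lemma lattice_paths_nonempty: "lattice_paths k l \<noteq> {}"
proof -
  have "\<exists>p. p \<in> lattice_paths k 0"
  proof (induction k)
    case (Suc k)
    then show ?case using lattice_paths_snoc[of _ k 0 "Suc k" 0] by (force simp: lattice_step_def)
  qed (use lattice_paths_origin in auto)
  then have "\<exists>p. p \<in> lattice_paths k l"
  proof (induction l)
    case (Suc l)
    then show ?case using lattice_paths_snoc[of _ k l k "Suc l"] by (force simp: lattice_step_def)
  qed auto
  then show ?thesis by auto
qed

lemma lattice_paths_length:
  assumes "p \<in> lattice_paths k l"
  shows "length p = Suc (k + l)"
  using assms by (induction rule: lattice_path_induct) (auto simp: lattice_step_def)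

lemma lattice_paths_subset_box:
  assumes "p \<in> lattice_paths k l"
  shows "set p \<subseteq> {..k} \<times> {..l}"
  using assms by (induction rule: lattice_path_induct) (auto simp: lattice_step_def)

lemma lattice_paths_distinct:
  assumes "p \<in> lattice_paths k l"
  shows "distinct p"
  using assms
proof (induction rule: lattice_path_induct)
  case (step q a b k l)
  then show ?case using lattice_paths_subset_box[of q a b] by (auto simp: lattice_step_def)
qed simp

lemma lattice_paths_origin_eq: "lattice_paths 0 0 = {[(0, 0)]}"
proof -
  have "p = [(0, 0)]" if "p \<in> lattice_paths 0 0" for p
    using that by (cases rule: lattice_paths_cases) (auto simp: lattice_step_def)
  then show ?thesis using lattice_paths_origin by blast
qed

lemma lattice_paths_subset_Un:
  assumes "k + l \<noteq> 0"
  shows "lattice_paths k l \<subseteq>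
     (if k = 0 then {} else (\<lambda>q. q @ [(k, l)]) ` lattice_paths (k - 1) l) \<union>
     (if l = 0 then {} else (\<lambda>q. q @ [(k, l)]) ` lattice_paths k (l - 1))"
    (is "_ \<subseteq> ?R")
proof
  fix p assume "p \<in> lattice_paths k l"
  then show "p \<in> ?R"
    using assms by (cases rule: lattice_paths_cases) (auto simp: lattice_step_def)
qed

lemma finite_lattice_paths [simp]: "finite (lattice_paths k l)"
proof (induction "k + l" arbitrary: k l rule: less_induct)
  case less
  show ?case
  proof (cases "k + l = 0")
    case False
    show ?thesis by (rule finite_subset[OF lattice_paths_subset_Un[OF False]]) (use less in auto)
  qed (simp add: lattice_paths_origin_eq)
qed

text \<open>Cruder than the binomial coefficient, but only an exponential rate matters: applied to
  paths of cells it costs a constant per visited cell.\<close>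

lemma card_lattice_paths_le: "card (lattice_paths k l) \<le> 2 ^ (k + l)"
proof (induction "k + l" arbitrary: k l rule: less_induct)
  case less
  show ?case
  proof (cases "k + l = 0")
    case False
    let ?A = "if k = 0 then {} else (\<lambda>q. q @ [(k, l)]) ` lattice_paths (k - 1) l"
    let ?B = "if l = 0 then {} else (\<lambda>q. q @ [(k, l)]) ` lattice_paths k (l - 1)"
    have "card ?A \<le> 2 ^ (k + l - 1)"
      using less[of "k - 1" l] by (auto intro: order_trans[OF card_image_le])
    moreover have "card ?B \<le> 2 ^ (k + l - 1)"
      using less[of k "l - 1"] by (auto intro: order_trans[OF card_image_le])
    moreover have "card (lattice_paths k l) \<le> card (?A \<union> ?B)"
      by (intro card_mono lattice_paths_subset_Un[OF False]) auto
    moreover have "card (?A \<union> ?B) \<le> card ?A + card ?B"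
      by (rule card_Un_le)
    moreover have "(2::nat) ^ (k + l) = 2 ^ (k + l - 1) + 2 ^ (k + l - 1)"
      using False by (cases "k + l") auto
    ultimately show ?thesis by linarith
  qed (simp add: lattice_paths_origin_eq)
qed

lemma sum_lattice_path_split_last:
  fixes x :: "nat \<times> nat \<Rightarrow> real"
  assumes "p \<in> lattice_paths k l"
  shows "(\<Sum>z\<leftarrow>p. x z) = (\<Sum>z\<leftarrow>butlast p. x z) + x (k, l)"
proof -
  have "p = butlast p @ [(k, l)]"
    using assms append_butlast_last_id[of p] by (auto simp: lattice_paths_def)
  then have "(\<Sum>z\<leftarrow>p. x z) = (\<Sum>z\<leftarrow>butlast p @ [(k, l)]. x z)" by (rule arg_cong)
  then show ?thesis by simp
qed

section \<open>Superadditivity of last passage times along rows and columns\<close>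

lemma last_passage_ge:
  assumes "p \<in> lattice_paths k l"
  shows "(\<Sum>z\<leftarrow>butlast p. x z) \<le> last_passage x k l"
  unfolding last_passage_def using assms by (intro Max_ge) auto

lemma last_passage_attained:
  obtains p where "p \<in> lattice_paths k l" "last_passage x k l = (\<Sum>z\<leftarrow>butlast p. x z)"
proof -
  have "last_passage x k l \<in> (\<lambda>p. \<Sum>z\<leftarrow>butlast p. x z) ` lattice_paths k l"
    unfolding last_passage_def using lattice_paths_nonempty by (intro Max_in) auto
  then show ?thesis using that by auto
qed

lemma last_passage_origin [simp]: "last_passage x 0 0 = 0"
  by (simp add: last_passage_def lattice_paths_origin_eq)

lemma last_passage_step:
  assumes "lattice_step (a, b) (k, l)"
  shows "last_passage x a b + x (a, b) \<le> last_passage x k l"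
proof -
  obtain p where p: "p \<in> lattice_paths a b" "last_passage x a b = (\<Sum>z\<leftarrow>butlast p. x z)"
    by (rule last_passage_attained)
  have "(\<Sum>z\<leftarrow>p. x z) = last_passage x a b + x (a, b)"
    using sum_lattice_path_split_last[OF p(1)] p(2) by simp
  then show ?thesis
    using last_passage_ge[OF lattice_paths_snoc[OF p(1) assms], of x] by simp
qed

lemma last_passage_cong:
  assumes "\<And>i j. i \<le> k \<Longrightarrow> j \<le> l \<Longrightarrow> x (i, j) = y (i, j)"
  shows "last_passage x k l = last_passage y k l"
proof -
  have "(\<Sum>z\<leftarrow>butlast p. x z) = (\<Sum>z\<leftarrow>butlast p. y z)" if "p \<in> lattice_paths k l" for p
  proof -
    have "z \<in> set (butlast p) \<Longrightarrow> x z = y z" for z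
      using lattice_paths_subset_box[OF that] assms by (cases z) (auto dest!: in_set_butlastD)
    then show ?thesis by (intro arg_cong[where f = sum_list] map_cong refl)
  qed
  then show ?thesis unfolding last_passage_def by (metis (no_types, lifting) image_cong)
qed

lemma last_passage_horizontal:
  assumes "a \<le> b"
  shows "last_passage x a j + (\<Sum>i=a..<b. x (i, j)) \<le> last_passage x b j"
  using assms
proof (induction b rule: dec_induct)
  case (step n)
  have "last_passage x n j + x (n, j) \<le> last_passage x (Suc n) j"
    by (rule last_passage_step) (simp add: lattice_step_def)
  then show ?case using step by simp
qed simp

lemma last_passage_vertical:
  assumes "a \<le> b"
  shows "last_passage x i a + (\<Sum>j=a..<b. x (i, j)) \<le> last_passage x i b"
  using assms
proof (induction b rule: dec_induct)
  case (step n)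
  have "last_passage x i n + x (i, n) \<le> last_passage x i (Suc n)"
    by (rule last_passage_step) (simp add: lattice_step_def)
  then show ?case using step by simp
qed simp

text \<open>Coarse graining: \<open>\<phi>\<close> and \<open>\<psi>\<close> group columns and rows into intervals, so that a lattice path
  induces a lattice path of cells. The function \<open>g\<close> bounds what a path can have collected since it
  entered the current cell, and \<open>W\<close> bounds \<open>g\<close> on each cell.\<close>

lemma path_sum_le_coarse:
  fixes \<zeta> g W :: "nat \<times> nat \<Rightarrow> real"
  assumes "p \<in> lattice_paths k l" "k \<le> n" "l \<le> m"
    and "\<phi> 0 = 0" "\<And>i. i < n \<Longrightarrow> \<phi> (Suc i) = \<phi> i \<or> \<phi> (Suc i) = Suc (\<phi> i)"
    and "\<psi> 0 = 0" "\<And>j. j < m \<Longrightarrow> \<psi> (Suc j) = \<psi> j \<or> \<psi> (Suc j) = Suc (\<psi> j)"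
    and g: "\<And>i j. i \<le> n \<Longrightarrow> j \<le> m \<Longrightarrow> \<zeta> (i, j) \<le> g (i, j)"
    and gh: "\<And>i j. i < n \<Longrightarrow> j \<le> m \<Longrightarrow> \<phi> (Suc i) = \<phi> i \<Longrightarrow> g (i, j) + \<zeta> (Suc i, j) \<le> g (Suc i, j)"
    and gv: "\<And>i j. i \<le> n \<Longrightarrow> j < m \<Longrightarrow> \<psi> (Suc j) = \<psi> j \<Longrightarrow> g (i, j) + \<zeta> (i, Suc j) \<le> g (i, Suc j)"
    and W: "\<And>i j. i \<le> n \<Longrightarrow> j \<le> m \<Longrightarrow> g (i, j) \<le> W (\<phi> i, \<psi> j)"
  shows "\<exists>q\<in>lattice_paths (\<phi> k) (\<psi> l). (\<Sum>z\<leftarrow>p. \<zeta> z) \<le> (\<Sum>c\<leftarrow>butlast q. W c) + g (k, l)"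
  using assms(1-3)
proof (induction rule: lattice_path_induct)
  case origin
  then show ?case using assms(4,6) g[of 0 0] by (simp add: lattice_paths_origin_eq)
next
  case (step p a b k l)
  have ab: "a \<le> n" "b \<le> m" using step by (auto simp: lattice_step_def)
  obtain q where q: "q \<in> lattice_paths (\<phi> a) (\<psi> b)"
    and le: "(\<Sum>z\<leftarrow>p. \<zeta> z) \<le> (\<Sum>c\<leftarrow>butlast q. W c) + g (a, b)"
    using step.IH ab by auto
  \<comment> \<open>Within a cell the coarse path stays the same and \<open>g\<close> takes up the
    new weight. On entering a new cell (\<open>new\<close>), \<open>W\<close> settles the cell just
    left and \<open>g\<close> starts afresh through \<open>\<zeta> \<le> g\<close>.\<close>
  have same: ?case if "\<phi> k = \<phi> a" "\<psi> l = \<psi> b" "g (a, b) + \<zeta> (k, l) \<le> g (k, l)"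
    using that q le by (intro bexI[of _ q]) auto
  have new: ?case if st: "lattice_step (\<phi> a, \<psi> b) (\<phi> k, \<psi> l)"
  proof
    show "q @ [(\<phi> k, \<psi> l)] \<in> lattice_paths (\<phi> k) (\<psi> l)"
      by (rule lattice_paths_snoc[OF q st])
    have "(\<Sum>c\<leftarrow>q. W c) = (\<Sum>c\<leftarrow>butlast q. W c) + W (\<phi> a, \<psi> b)"
      by (rule sum_lattice_path_split_last[OF q])
    then show "(\<Sum>z\<leftarrow>p @ [(k, l)]. \<zeta> z) \<le> (\<Sum>c\<leftarrow>butlast (q @ [(\<phi> k, \<psi> l)]). W c) + g (k, l)"
      using le W[OF ab] g[of k l] step.prems by simp
  qed
  consider "k = Suc a" "l = b" | "k = a" "l = Suc b"
    using step.hyps by (auto simp: lattice_step_def)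
  then show ?case
  proof cases
    case 1
    then have "\<phi> k = \<phi> a \<or> \<phi> k = Suc (\<phi> a)" using assms(5)[of a] step.prems by simp
    then show ?thesis using same new gh[of a b] 1 step.prems by (auto simp: lattice_step_def)
  next
    case 2
    then have "\<psi> l = \<psi> b \<or> \<psi> l = Suc (\<psi> b)" using assms(7)[of b] step.prems by simp
    then show ?thesis using same new gv[of a b] 2 step.prems by (auto simp: lattice_step_def)
  qed
qed

text \<open>Unlike \<open>last_passage\<close> this counts the endpoint: the cell containing the end
  of a path has been traversed in part, so it contributes.\<close>

definition full_passage :: "(nat \<times> nat \<Rightarrow> real) \<Rightarrow> nat \<Rightarrow> nat \<Rightarrow> real" where
  "full_passage W k l = Max ((\<lambda>p. \<Sum>z\<leftarrow>p. W z) ` lattice_paths k l)"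

lemma full_passage_ge:
  assumes "p \<in> lattice_paths k l"
  shows "(\<Sum>z\<leftarrow>p. x z) \<le> full_passage x k l"
  unfolding full_passage_def using assms by (intro Max_ge) auto

lemma full_passage_attained:
  obtains p where "p \<in> lattice_paths k l" "full_passage x k l = (\<Sum>z\<leftarrow>p. x z)"
proof -
  have "full_passage x k l \<in> (\<lambda>p. \<Sum>z\<leftarrow>p. x z) ` lattice_paths k l"
    unfolding full_passage_def using lattice_paths_nonempty by (intro Max_in) auto
  then show ?thesis using that by auto
qed

lemma full_passage_nonneg:
  assumes "\<And>c. 0 \<le> W c"
  shows "0 \<le> full_passage W k l"
proof -
  obtain p where "full_passage W k l = (\<Sum>z\<leftarrow>p. W z)"
    by (rule full_passage_attained)
  also have "\<dots> \<ge> 0" using assms by (intro sum_list_nonneg) auto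
  finally show ?thesis .
qed

lemma full_passage_extend:
  assumes "\<And>c. 0 \<le> W c" "lattice_step (a, b) (k, l)"
  shows "full_passage W a b \<le> full_passage W k l"
proof -
  obtain p where "p \<in> lattice_paths a b" "full_passage W a b = (\<Sum>z\<leftarrow>p. W z)"
    by (rule full_passage_attained)
  then show ?thesis
    using full_passage_ge[OF lattice_paths_snoc[OF _ assms(2)], of p W] assms(1)[of "(k, l)"] by simp
qed

lemma last_passage_le_coarse:
  fixes \<zeta> g W :: "nat \<times> nat \<Rightarrow> real"
  assumes \<phi>: "\<phi> 0 = 0" "\<And>i. i < n \<Longrightarrow> \<phi> (Suc i) = \<phi> i \<or> \<phi> (Suc i) = Suc (\<phi> i)"
    and \<psi>: "\<psi> 0 = 0" "\<And>j. j < m \<Longrightarrow> \<psi> (Suc j) = \<psi> j \<or> \<psi> (Suc j) = Suc (\<psi> j)"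
    and g: "\<And>i j. i \<le> n \<Longrightarrow> j \<le> m \<Longrightarrow> \<zeta> (i, j) \<le> g (i, j)"
    and gh: "\<And>i j. i < n \<Longrightarrow> j \<le> m \<Longrightarrow> \<phi> (Suc i) = \<phi> i \<Longrightarrow> g (i, j) + \<zeta> (Suc i, j) \<le> g (Suc i, j)"
    and gv: "\<And>i j. i \<le> n \<Longrightarrow> j < m \<Longrightarrow> \<psi> (Suc j) = \<psi> j \<Longrightarrow> g (i, j) + \<zeta> (i, Suc j) \<le> g (i, Suc j)"
    and W: "\<And>i j. i \<le> n \<Longrightarrow> j \<le> m \<Longrightarrow> g (i, j) \<le> W (\<phi> i, \<psi> j)" "\<And>c. 0 \<le> W c"
  shows "last_passage \<zeta> n m \<le> full_passage W (\<phi> n) (\<psi> m)"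
proof -
  obtain p where p: "p \<in> lattice_paths n m" "last_passage \<zeta> n m = (\<Sum>z\<leftarrow>butlast p. \<zeta> z)"
    by (rule last_passage_attained)
  from p(1) show ?thesis
  proof (cases rule: lattice_paths_cases)
    case 1
    have "last_passage \<zeta> n m = 0" using p(2) 1 by simp
    then show ?thesis using full_passage_nonneg[of W "\<phi> n" "\<psi> m", OF W(2)] by linarith
  next
    case (2 a b q)
    have ab: "a \<le> n" "b \<le> m" using 2(2) by (auto simp: lattice_step_def)
    have "\<exists>r\<in>lattice_paths (\<phi> a) (\<psi> b). (\<Sum>z\<leftarrow>q. \<zeta> z) \<le> (\<Sum>c\<leftarrow>butlast r. W c) + g (a, b)"
      by (rule path_sum_le_coarse[where n = n and m = m and g = g and \<zeta> = \<zeta> and W = W and \<phi> = \<phi> and \<psi> = \<psi>])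
        (rule 2(1) ab assms | assumption)+
    then obtain r where r: "r \<in> lattice_paths (\<phi> a) (\<psi> b)"
      and le: "(\<Sum>z\<leftarrow>q. \<zeta> z) \<le> (\<Sum>c\<leftarrow>butlast r. W c) + g (a, b)" ..
    have "(\<Sum>c\<leftarrow>r. W c) = (\<Sum>c\<leftarrow>butlast r. W c) + W (\<phi> a, \<psi> b)"
      by (rule sum_lattice_path_split_last[OF r])
    then have "last_passage \<zeta> n m \<le> full_passage W (\<phi> a) (\<psi> b)"
      using p(2) 2(3) le W(1)[OF ab] full_passage_ge[OF r, of W] by simp
    \<comment> \<open>The path without its endpoint stops at a neighbour of \<open>(n, m)\<close>,
      whose cell is that of \<open>(n, m)\<close> or the one before it. In the latter case the
      coarse path is extended by one cell, which costs nothing since \<open>W\<close> is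
      nonnegative.\<close>
    also have "full_passage W (\<phi> a) (\<psi> b) \<le> full_passage W (\<phi> n) (\<psi> m)"
    proof -
      consider "n = Suc a" "m = b" | "n = a" "m = Suc b"
        using 2(2) by (auto simp: lattice_step_def)
      then show ?thesis
      proof cases
        case 1
        then have "\<phi> n = \<phi> a \<or> lattice_step (\<phi> a, \<psi> b) (\<phi> n, \<psi> m)"
          using \<phi>(2)[of a] by (auto simp: lattice_step_def)
        then show ?thesis
          using full_passage_extend[OF W(2), of "\<phi> a" "\<psi> b" "\<phi> n" "\<psi> m"] 1(2) by auto
      next
        case 2
        then have "\<psi> m = \<psi> b \<or> lattice_step (\<phi> a, \<psi> b) (\<phi> n, \<psi> m)"
          using \<psi>(2)[of b] by (auto simp: lattice_step_def)
        then show ?thesis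
          using full_passage_extend[OF W(2), of "\<phi> a" "\<psi> b" "\<phi> n" "\<psi> m"] 2(1) by auto
      qed
    qed
    finally show ?thesis .
  qed
qed

section \<open>Exponential moment bounds\<close>

text \<open>A union bound inside the exponential: with \<open>T\<close> the maximum,
  \<open>\<theta> * T - r \<le> exp (\<theta> * T - r)\<close>, and the exponential of a maximum is
  at most the sum over paths, each of which factorizes by independence. The result is linear in the
  number of cells a path visits.\<close>

lemma (in prob_space) nn_integral_full_passage_le:
  fixes W :: "nat \<times> nat \<Rightarrow> 'a \<Rightarrow> real"
  assumes indep: "indep_vars (\<lambda>_. borel) W ({..I} \<times> {..J})"
    and exp: "\<And>c. c \<in> {..I} \<times> {..J} \<Longrightarrow> (\<integral>\<^sup>+\<omega>. ennreal (exp (\<theta> * W c \<omega>)) \<partial>M) \<le> ennreal (exp \<kappa>)"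
    and \<theta>: "0 < \<theta>" and \<kappa>: "0 \<le> \<kappa>"
  shows "(\<integral>\<^sup>+\<omega>. ennreal (full_passage (\<lambda>c. W c \<omega>) I J) \<partial>M)
    \<le> ennreal ((real (Suc (I + J)) * (\<kappa> + 1) + 1) / \<theta>)"
proof -
  \<comment> \<open>Each of the \<open>Suc (I + J)\<close> visited cells pays \<kappa> for its
    exponential moment and 1 for the choice of the path, as there are at most
    \<open>2 ^ (I + J) \<le> exp (Suc (I + J))\<close> paths. So \<open>exp (- r)\<close> cancels
    the whole sum and the excess over \<open>r / \<theta>\<close> is at most
    \<open>1 / \<theta>\<close>.\<close>
  define r where "r = real (Suc (I + J)) * (\<kappa> + 1)"
  have r: "0 \<le> r" using \<kappa> by (simp add: r_def)
  have [measurable]: "W c \<in> borel_measurable M" if "c \<in> {..I} \<times> {..J}" for c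
    using indep that by (auto simp: indep_vars_def)
  have path_exp: "exp (\<theta> * (\<Sum>c\<leftarrow>p. W c \<omega>)) = (\<Prod>c\<in>set p. exp (\<theta> * W c \<omega>))"
    if "p \<in> lattice_paths I J" for p \<omega>
    using lattice_paths_distinct[OF that]
    by (simp add: sum_list_distinct_conv_sum_set sum_distrib_left exp_sum)
  have path_int: "(\<integral>\<^sup>+\<omega>. (\<Prod>c\<in>set p. ennreal (exp (\<theta> * W c \<omega>))) \<partial>M) \<le> ennreal (exp (real (Suc (I + J)) * \<kappa>))"
    if p: "p \<in> lattice_paths I J" for p
  proof -
    note sub = lattice_paths_subset_box[OF p]
    have "indep_vars (\<lambda>_. borel) (\<lambda>c \<omega>. ennreal (exp (\<theta> * W c \<omega>))) (set p)"
      by (rule indep_vars_compose2[OF indep_vars_subset[OF indep sub]]) measurable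
    then have "(\<integral>\<^sup>+\<omega>. (\<Prod>c\<in>set p. ennreal (exp (\<theta> * W c \<omega>))) \<partial>M)
        = (\<Prod>c\<in>set p. \<integral>\<^sup>+\<omega>. ennreal (exp (\<theta> * W c \<omega>)) \<partial>M)"
      by (intro indep_vars_nn_integral) auto
    also have "\<dots> \<le> (\<Prod>c\<in>set p. ennreal (exp \<kappa>))"
      using sub exp by (intro prod_mono_ennreal) auto
    also have "\<dots> = ennreal (exp (real (Suc (I + J)) * \<kappa>))"
      using lattice_paths_length[OF p] distinct_card[OF lattice_paths_distinct[OF p]]
      by (simp add: ennreal_power del: power_Suc of_nat_Suc flip: exp_of_nat_mult)
    finally show ?thesis .
  qed
  have bound: "ennreal (full_passage (\<lambda>c. W c \<omega>) I J)
     \<le> ennreal (r / \<theta>) + ennreal (exp (- r) / \<theta>) *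
         (\<Sum>p\<in>lattice_paths I J. \<Prod>c\<in>set p. ennreal (exp (\<theta> * W c \<omega>)))" for \<omega>
  proof -
    obtain p where p: "p \<in> lattice_paths I J" "full_passage (\<lambda>c. W c \<omega>) I J = (\<Sum>c\<leftarrow>p. W c \<omega>)"
      by (rule full_passage_attained)
    define T where "T = full_passage (\<lambda>c. W c \<omega>) I J"
    have "\<theta> * T - r \<le> exp (\<theta> * T - r)" using exp_ge_add_one_self[of "\<theta> * T - r"] by linarith
    also have "\<dots> = exp (- r) * exp (\<theta> * T)" by (simp flip: exp_add)
    also have "exp (\<theta> * T) = (\<Prod>c\<in>set p. exp (\<theta> * W c \<omega>))"
      using path_exp[OF p(1)] p(2) by (simp add: T_def)
    also have "exp (- r) * \<dots> \<le> exp (- r) * (\<Sum>p\<in>lattice_paths I J. \<Prod>c\<in>set p. exp (\<theta> * W c \<omega>))"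
      using p(1) by (intro mult_left_mono member_le_sum) (auto intro!: prod_nonneg)
    finally have "T \<le> r / \<theta> + exp (- r) / \<theta> *
       (\<Sum>p\<in>lattice_paths I J. \<Prod>c\<in>set p. exp (\<theta> * W c \<omega>))"
      using \<theta> by (simp add: field_simps)
    then have "ennreal T \<le> ennreal (r / \<theta> + exp (- r) / \<theta> *
       (\<Sum>p\<in>lattice_paths I J. \<Prod>c\<in>set p. exp (\<theta> * W c \<omega>)))"
      by (rule ennreal_leI)
    also have "\<dots> = ennreal (r / \<theta>) + ennreal (exp (- r) / \<theta>) *
         ennreal (\<Sum>p\<in>lattice_paths I J. \<Prod>c\<in>set p. exp (\<theta> * W c \<omega>))"
      using \<theta> r by (subst ennreal_plus)
        (auto intro!: mult_nonneg_nonneg sum_nonneg prod_nonneg ennreal_mult simp del: times_divide_eq_left)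
    also have "ennreal (\<Sum>p\<in>lattice_paths I J. \<Prod>c\<in>set p. exp (\<theta> * W c \<omega>))
        = (\<Sum>p\<in>lattice_paths I J. \<Prod>c\<in>set p. ennreal (exp (\<theta> * W c \<omega>)))"
      by (simp add: sum_ennreal prod_nonneg prod_ennreal)
    finally show ?thesis by (simp add: T_def)
  qed
  have [measurable]: "(\<lambda>\<omega>. \<Prod>c\<in>set p. ennreal (exp (\<theta> * W c \<omega>))) \<in> borel_measurable M"
    if "p \<in> lattice_paths I J" for p
    using lattice_paths_subset_box[OF that] by (intro borel_measurable_prod_ennreal) auto
  have "(\<integral>\<^sup>+\<omega>. ennreal (full_passage (\<lambda>c. W c \<omega>) I J) \<partial>M)
    \<le> (\<integral>\<^sup>+\<omega>. ennreal (r / \<theta>) + ennreal (exp (- r) / \<theta>) *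
         (\<Sum>p\<in>lattice_paths I J. \<Prod>c\<in>set p. ennreal (exp (\<theta> * W c \<omega>))) \<partial>M)"
    by (intro nn_integral_mono bound)
  also have "\<dots> = ennreal (r / \<theta>) + ennreal (exp (- r) / \<theta>) *
         (\<Sum>p\<in>lattice_paths I J. \<integral>\<^sup>+\<omega>. (\<Prod>c\<in>set p. ennreal (exp (\<theta> * W c \<omega>))) \<partial>M)"
    by (subst nn_integral_add) (auto simp: nn_integral_cmult nn_integral_sum emeasure_space_1)
  also have "\<dots> \<le> ennreal (r / \<theta>) + ennreal (exp (- r) / \<theta>) *
         (\<Sum>p\<in>lattice_paths I J. ennreal (exp (real (Suc (I + J)) * \<kappa>)))"
    using path_int by (intro add_left_mono mult_left_mono sum_mono) auto
  also have "\<dots> = ennreal (r / \<theta> + exp (- r) / \<theta> * (card (lattice_paths I J) * exp (real (Suc (I + J)) * \<kappa>)))"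
  proof -
    have "ennreal (exp (- r) / \<theta>) * (\<Sum>p\<in>lattice_paths I J. ennreal (exp (real (Suc (I + J)) * \<kappa>)))
      = ennreal (exp (- r) / \<theta> * (card (lattice_paths I J) * exp (real (Suc (I + J)) * \<kappa>)))"
      using \<theta> by (simp add: ennreal_mult ennreal_of_nat_eq_real_of_nat
        del: times_divide_eq_left of_nat_Suc)
    then show ?thesis
      using \<theta> r by (simp add: ennreal_plus del: times_divide_eq_left of_nat_Suc)
  qed
  also have "\<dots> \<le> ennreal (r / \<theta> + 1 / \<theta>)"
  proof (intro ennreal_leI add_left_mono)
    have "real (card (lattice_paths I J)) \<le> 2 ^ (I + J)"
      using card_lattice_paths_le[of I J] by (metis of_nat_le_iff of_nat_numeral of_nat_power)
    also have "\<dots> \<le> 2 ^ Suc (I + J)" by simp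
    also have "\<dots> \<le> exp 1 ^ Suc (I + J)" using exp_ge_add_one_self[of 1] by (intro power_mono) auto
    also have "\<dots> = exp (real (Suc (I + J)))" by (simp add: exp_of_nat_mult[of "Suc (I + J)" 1, symmetric] del: power_Suc)
    finally have "card (lattice_paths I J) * exp (real (Suc (I + J)) * \<kappa>)
       \<le> exp (real (Suc (I + J))) * exp (real (Suc (I + J)) * \<kappa>)"
      by (intro mult_right_mono) auto
    also have "\<dots> = exp r" by (simp add: r_def algebra_simps flip: exp_add)
    finally have "exp (- r) * (card (lattice_paths I J) * exp (real (Suc (I + J)) * \<kappa>)) \<le> exp (- r) * exp r"
      by (intro mult_left_mono) auto
    also have "\<dots> = 1" by (simp flip: exp_add)
    finally show "exp (- r) / \<theta> * (card (lattice_paths I J) * exp (real (Suc (I + J)) * \<kappa>)) \<le> 1 / \<theta>"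
      using \<theta> by (simp add: divide_right_mono)
  qed
  finally show ?thesis by (simp add: r_def add_divide_distrib)
qed

lemma exp_le_quadratic:
  fixes u :: real
  assumes "\<bar>u\<bar> \<le> 1"
  shows "exp u \<le> 1 + u + u\<^sup>2"
proof (cases "0 \<le> u")
  case True
  then show ?thesis using exp_bound[of u] assms by simp
next
  case False
  define v where "v = - u"
  have v: "0 \<le> v" "v \<le> 1" using False assms by (auto simp: v_def)
  \<comment> \<open>For negative arguments the lower Taylor bound of \<open>exp v\<close> is
    inverted: its product with \<open>1 - v + v^2\<close> is at least 1.\<close>
  have "1 + v + v\<^sup>2 / 2 \<le> exp v" by (rule exp_lower_Taylor_quadratic[OF v(1)])
  moreover have "1 \<le> (1 + v + v\<^sup>2 / 2) * (1 - v + v\<^sup>2)"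
  proof -
    have "(1 + v + v\<^sup>2 / 2) * (1 - v + v\<^sup>2) - 1 = v\<^sup>2 / 2 + v^3 / 2 + v^4 / 2"
      by (simp add: power2_eq_square power3_eq_cube power4_eq_xxxx field_simps)
    also have "\<dots> \<ge> 0" using v by simp
    finally show ?thesis by simp
  qed
  moreover have "0 \<le> 1 - v + v\<^sup>2"
    using v by simp
  ultimately have "1 \<le> exp v * (1 - v + v\<^sup>2)"
    by (meson mult_right_mono order_trans)
  then have "exp (- v) \<le> 1 - v + v\<^sup>2" by (simp add: exp_minus field_simps)
  then show ?thesis by (simp add: v_def)
qed

text \<open>The exponent carries the variance and not the range. This is how a small tail
  probability enters the bound in the dense regime.\<close>

lemma (in prob_space) expectation_exp_bounded_le:
  fixes Y :: "'a \<Rightarrow> real"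
  assumes [measurable]: "Y \<in> borel_measurable M" and bd: "\<And>\<omega>. \<bar>Y \<omega>\<bar> \<le> 1"
    and mean: "expectation Y = 0" and var: "expectation (\<lambda>\<omega>. (Y \<omega>)\<^sup>2) \<le> v" and \<theta>: "\<bar>\<theta>\<bar> \<le> 1"
  shows "expectation (\<lambda>\<omega>. exp (\<theta> * Y \<omega>)) \<le> exp (\<theta>\<^sup>2 * v)"
proof -
  have bd2: "\<bar>\<theta> * Y \<omega>\<bar> \<le> 1" for \<omega>
    using mult_mono[OF \<theta> bd[of \<omega>]] by (simp add: abs_mult)
  have [simp]: "integrable M Y" "integrable M (\<lambda>\<omega>. (Y \<omega>)\<^sup>2)" "integrable M (\<lambda>\<omega>. exp (\<theta> * Y \<omega>))"
  proof -
    show "integrable M Y" using bd by (intro integrable_const_bound[where B = 1]) auto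
    show "integrable M (\<lambda>\<omega>. (Y \<omega>)\<^sup>2)"
      using bd by (intro integrable_const_bound[where B = 1]) (auto simp: abs_square_le_1)
    show "integrable M (\<lambda>\<omega>. exp (\<theta> * Y \<omega>))"
      using abs_le_D1[OF bd2] by (intro integrable_const_bound[where B = "exp 1"]) auto
  qed
  have "expectation (\<lambda>\<omega>. exp (\<theta> * Y \<omega>)) \<le> expectation (\<lambda>\<omega>. 1 + \<theta> * Y \<omega> + \<theta>\<^sup>2 * (Y \<omega>)\<^sup>2)"
    using exp_le_quadratic[OF bd2] by (intro integral_mono) (auto simp: power_mult_distrib)
  also have "\<dots> = 1 + \<theta>\<^sup>2 * expectation (\<lambda>\<omega>. (Y \<omega>)\<^sup>2)"
    by (simp add: mean prob_space)
  also have "\<dots> \<le> 1 + \<theta>\<^sup>2 * v" using var by (intro add_left_mono mult_left_mono) auto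
  also have "\<dots> \<le> exp (\<theta>\<^sup>2 * v)" by (rule exp_ge_add_one_self)
  finally show ?thesis .
qed

lemma (in prob_space) nn_integral_exp_sum_le:
  fixes Y :: "'i \<Rightarrow> 'a \<Rightarrow> real"
  assumes "finite A" and indep: "indep_vars (\<lambda>_. borel) Y A"
    and exp: "\<And>i. i \<in> A \<Longrightarrow> (\<integral>\<^sup>+\<omega>. ennreal (exp (\<theta> * Y i \<omega>)) \<partial>M) \<le> ennreal (exp (v i))"
  shows "(\<integral>\<^sup>+\<omega>. ennreal (exp (\<theta> * (\<Sum>i\<in>A. Y i \<omega>))) \<partial>M) \<le> ennreal (exp (\<Sum>i\<in>A. v i))"
proof -
  have ind: "indep_vars (\<lambda>_. borel) (\<lambda>i \<omega>. ennreal (exp (\<theta> * Y i \<omega>))) A"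
    by (rule indep_vars_compose2[OF indep]) measurable
  have "(\<integral>\<^sup>+\<omega>. ennreal (exp (\<theta> * (\<Sum>i\<in>A. Y i \<omega>))) \<partial>M) = (\<integral>\<^sup>+\<omega>. (\<Prod>i\<in>A. ennreal (exp (\<theta> * Y i \<omega>))) \<partial>M)"
    using \<open>finite A\<close> by (simp add: sum_distrib_left exp_sum prod_ennreal)
  also have "\<dots> = (\<Prod>i\<in>A. \<integral>\<^sup>+\<omega>. ennreal (exp (\<theta> * Y i \<omega>)) \<partial>M)"
    using \<open>finite A\<close> ind by (intro indep_vars_nn_integral) auto
  also have "\<dots> \<le> (\<Prod>i\<in>A. ennreal (exp (v i)))"
    using exp by (intro prod_mono_ennreal) auto
  also have "\<dots> = ennreal (exp (\<Sum>i\<in>A. v i))"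
    using \<open>finite A\<close> by (simp add: prod_ennreal exp_sum)
  finally show ?thesis .
qed

text \<open>Doob's \<open>L\<^sup>2\<close> inequality for the submartingale \<open>X t = exp (\<theta> * S t)\<close>: with running maximum \<open>Z\<close>,
  the quantity \<open>Z\<^sup>2 - 2 X Z\<close> is a supermartingale, because replacing \<open>Z\<close> by \<open>X > Z\<close> decreases it.\<close>

lemma (in prob_space) expectation_max_exp_partial_sums_le:
  fixes Y :: "nat \<Rightarrow> 'a \<Rightarrow> real"
  assumes indep: "indep_vars (\<lambda>_. borel) Y {..<N}"
    and bd: "\<And>i \<omega>. i < N \<Longrightarrow> \<bar>Y i \<omega>\<bar> \<le> 1"
    and mean: "\<And>i. i < N \<Longrightarrow> expectation (Y i) = 0"
  shows "expectation (\<lambda>\<omega>. (Max ((\<lambda>t. exp (\<theta> * (\<Sum>i<t. Y i \<omega>))) ` {..N}))\<^sup>2)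
    \<le> 4 * expectation (\<lambda>\<omega>. exp (2 * \<theta> * (\<Sum>i<N. Y i \<omega>)))"
proof -
  define X where "X t \<omega> = exp (\<theta> * (\<Sum>i<t. Y i \<omega>))" for t \<omega>
  define Z where "Z t \<omega> = Max ((\<lambda>s. X s \<omega>) ` {..t})" for t \<omega>
  define C where "C = exp (\<bar>\<theta>\<bar> * real N)"
  have Y_m: "Y i \<in> borel_measurable M" if "i < N" for i
    using indep that by (auto simp: indep_vars_def)
  have X_m [measurable]: "X t \<in> borel_measurable M" if "t \<le> N" for t
    unfolding X_def[abs_def] using that Y_m
    by (intro measurable_compose[OF _ borel_measurable_exp] borel_measurable_times
      borel_measurable_const borel_measurable_sum) auto
  have Z_m [measurable]: "Z t \<in> borel_measurable M" if "t \<le> N" for t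
    unfolding Z_def[abs_def] using that by (intro borel_measurable_Max) auto
  have X_bd: "0 \<le> X t \<omega>" "X t \<omega> \<le> C" if "t \<le> N" for t \<omega>
  proof -
    have "\<bar>\<Sum>i<t. Y i \<omega>\<bar> \<le> (\<Sum>i<t. 1)"
      using bd that by (intro order_trans[OF sum_abs] sum_mono) auto
    then have "\<bar>\<theta> * (\<Sum>i<t. Y i \<omega>)\<bar> \<le> \<bar>\<theta>\<bar> * real N"
      using that by (auto simp: abs_mult intro!: mult_left_mono)
    then show "X t \<omega> \<le> C" by (simp add: X_def C_def)
  qed (simp add: X_def)
  have Z_bd: "0 \<le> Z t \<omega>" "Z t \<omega> \<le> C" if "t \<le> N" for t \<omega>
  proof -
    have "Z t \<omega> \<in> (\<lambda>s. X s \<omega>) ` {..t}" unfolding Z_def by (intro Max_in) auto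
    then show "0 \<le> Z t \<omega>" "Z t \<omega> \<le> C" using X_bd that by auto
  qed
  have Z_Suc: "Z (Suc t) \<omega> = max (Z t \<omega>) (X (Suc t) \<omega>)" for t \<omega>
    unfolding Z_def by (simp add: atMost_Suc max.commute)
  have int: "integrable M (\<lambda>\<omega>. (Z s \<omega>)\<^sup>2)" "integrable M (\<lambda>\<omega>. (X t \<omega>)\<^sup>2)"
      "integrable M (\<lambda>\<omega>. X t \<omega> * Z s \<omega>)" if "t \<le> N" "s \<le> N" for t s
  proof -
    show "integrable M (\<lambda>\<omega>. (Z s \<omega>)\<^sup>2)"
      using Z_bd that by (intro integrable_const_bound[where B = "C\<^sup>2"]) (auto intro!: power_mono)
    show "integrable M (\<lambda>\<omega>. (X t \<omega>)\<^sup>2)"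
      using X_bd that by (intro integrable_const_bound[where B = "C\<^sup>2"]) (auto intro!: power_mono)
    show "integrable M (\<lambda>\<omega>. X t \<omega> * Z s \<omega>)"
      using X_bd Z_bd that by (intro integrable_const_bound[where B = "C * C"])
        (auto simp: abs_mult intro!: mult_mono order_trans[OF X_bd])
  qed
  have sub: "expectation (\<lambda>\<omega>. X t \<omega> * Z t \<omega>) \<le> expectation (\<lambda>\<omega>. X (Suc t) \<omega> * Z t \<omega>)" if t: "t < N" for t
  proof -
    \<comment> \<open>\<open>X t * Z t\<close> as a measurable function of the first
      \<open>t\<close> increments, which makes it independent of increment number
      \<open>t\<close>.\<close>
    define f where "f = (\<lambda>y. exp (\<theta> * (\<Sum>i<t. y i)) * Max ((\<lambda>s. exp (\<theta> * (\<Sum>i<s. y i :: real))) ` {..t}))"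
    have "(\<lambda>y. y i) \<in> borel_measurable (PiM {..<t} (\<lambda>_. borel))" if "i < t" for i
      using that by (intro measurable_component_singleton) auto
    then have f_m: "f \<in> borel_measurable (PiM {..<t} (\<lambda>_. borel :: real measure))"
      unfolding f_def
      by (intro borel_measurable_times borel_measurable_exp borel_measurable_Max
        measurable_compose[OF _ borel_measurable_exp] borel_measurable_sum borel_measurable_const) auto
    have f_X: "f (restrict (\<lambda>i. Y i \<omega>) {..<t}) = X t \<omega> * Z t \<omega>" for \<omega>
    proof -
      have "(\<Sum>i<s. restrict (\<lambda>i. Y i \<omega>) {..<t} i) = (\<Sum>i<s. Y i \<omega>)" if "s \<le> t" for s
        using that by (intro sum.cong) auto
      then show ?thesis
        unfolding f_def X_def Z_def
        by (intro arg_cong2[where f = "(*)"] arg_cong[where f = Max] image_cong) auto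
    qed
    have g_m: "(\<lambda>y. exp (\<theta> * y t)) \<in> borel_measurable (PiM {t} (\<lambda>_. borel :: real measure))"
      by measurable
    have "indep_var borel (f \<circ> (\<lambda>\<omega>. restrict (\<lambda>i. Y i \<omega>) {..<t}))
        borel ((\<lambda>y. exp (\<theta> * y t)) \<circ> (\<lambda>\<omega>. restrict (\<lambda>i. Y i \<omega>) {t}))"
      using t by (intro indep_var_compose[OF indep_var_restrict[OF indep] f_m g_m]) auto
    then have ind: "indep_var borel (\<lambda>\<omega>. X t \<omega> * Z t \<omega>) borel (\<lambda>\<omega>. exp (\<theta> * Y t \<omega>))"
      by (simp add: comp_def f_X)
    have [simp]: "integrable M (\<lambda>\<omega>. exp (\<theta> * Y t \<omega>))" "integrable M (Y t)"
    proof -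
      show "integrable M (Y t)"
        using t bd Y_m by (intro integrable_const_bound[where B = 1]) auto
      have "\<bar>\<theta> * Y t \<omega>\<bar> \<le> \<bar>\<theta>\<bar>" for \<omega>
        using mult_left_mono[OF bd[OF t, of \<omega>], of "\<bar>\<theta>\<bar>"] by (simp add: abs_mult)
      then have "\<theta> * Y t \<omega> \<le> \<bar>\<theta>\<bar>" for \<omega> by (meson abs_le_D1)
      then show "integrable M (\<lambda>\<omega>. exp (\<theta> * Y t \<omega>))"
        using t Y_m by (intro integrable_const_bound[where B = "exp \<bar>\<theta>\<bar>"]) auto
    qed
    \<comment> \<open>The submartingale property: a centered increment has an exponential moment of
      at least 1, whatever the sign of \<theta>.\<close>
    have "1 = expectation (\<lambda>\<omega>. 1 + \<theta> * Y t \<omega>)" using mean[OF t] by (simp add: prob_space)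
    also have "\<dots> \<le> expectation (\<lambda>\<omega>. exp (\<theta> * Y t \<omega>))"
      by (intro integral_mono) (auto intro: exp_ge_add_one_self)
    finally have ge1: "1 \<le> expectation (\<lambda>\<omega>. exp (\<theta> * Y t \<omega>))" .
    have "expectation (\<lambda>\<omega>. X (Suc t) \<omega> * Z t \<omega>) = expectation (\<lambda>\<omega>. (X t \<omega> * Z t \<omega>) * exp (\<theta> * Y t \<omega>))"
      by (intro Bochner_Integration.integral_cong) (auto simp: X_def exp_add algebra_simps)
    also have "\<dots> = expectation (\<lambda>\<omega>. X t \<omega> * Z t \<omega>) * expectation (\<lambda>\<omega>. exp (\<theta> * Y t \<omega>))"
      using t by (intro indep_var_lebesgue_integral ind int) auto
    also have "\<dots> \<ge> expectation (\<lambda>\<omega>. X t \<omega> * Z t \<omega>) * 1"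
      using X_bd Z_bd t ge1 by (intro mult_left_mono Bochner_Integration.integral_nonneg) auto
    finally show ?thesis by simp
  qed
  have key: "expectation (\<lambda>\<omega>. (Z t \<omega>)\<^sup>2) \<le> 2 * expectation (\<lambda>\<omega>. X t \<omega> * Z t \<omega>)" if "t \<le> N" for t
    using that
  proof (induction t)
    case 0
    have "Z 0 = X 0" "X 0 = (\<lambda>_. 1)" by (auto simp: Z_def X_def fun_eq_iff)
    then show ?case by (simp add: prob_space)
  next
    case (Suc t)
    have "(Z (Suc t) \<omega>)\<^sup>2 - 2 * (X (Suc t) \<omega> * Z (Suc t) \<omega>) \<le> (Z t \<omega>)\<^sup>2 - 2 * (X (Suc t) \<omega> * Z t \<omega>)" for \<omega>
      unfolding Z_Suc using zero_le_power2[of "Z t \<omega> - X (Suc t) \<omega>"]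
      by (auto simp: max_def power2_eq_square algebra_simps)
    then have "expectation (\<lambda>\<omega>. (Z (Suc t) \<omega>)\<^sup>2 - 2 * (X (Suc t) \<omega> * Z (Suc t) \<omega>))
        \<le> expectation (\<lambda>\<omega>. (Z t \<omega>)\<^sup>2 - 2 * (X (Suc t) \<omega> * Z t \<omega>))"
      using Suc int by (intro integral_mono) auto
    then show ?case using Suc sub[of t] int by simp
  qed
  \<comment> \<open>Young's inequality, weighted so that half of the second moment of
    \<open>Z N\<close> can be absorbed on the left of \<open>key\<close>; that moment is finite
    because everything is bounded by \<open>C\<close>. This produces the factor 4.\<close>
  have "2 * (X N \<omega> * Z N \<omega>) \<le> (Z N \<omega>)\<^sup>2 / 2 + 2 * (X N \<omega>)\<^sup>2" for \<omega>
    using zero_le_power2[of "Z N \<omega> - 2 * X N \<omega>"] by (simp add: power2_eq_square algebra_simps)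
  then have "expectation (\<lambda>\<omega>. 2 * (X N \<omega> * Z N \<omega>)) \<le> expectation (\<lambda>\<omega>. (Z N \<omega>)\<^sup>2 / 2 + 2 * (X N \<omega>)\<^sup>2)"
    using int[OF order_refl order_refl] by (intro integral_mono) auto
  then have "expectation (\<lambda>\<omega>. (Z N \<omega>)\<^sup>2) \<le> 4 * expectation (\<lambda>\<omega>. (X N \<omega>)\<^sup>2)"
    using key[of N] int[OF order_refl order_refl] by simp
  then show ?thesis by (simp add: Z_def X_def power2_eq_square algebra_simps flip: exp_add)
qed

section \<open>Last passage times of bounded weights\<close>

text \<open>Cuts \<open>{0..n}\<close> into \<open>N\<close> intervals of nearly equal length
  without any divisibility assumption; for \<open>N \<le> Suc n\<close> consecutive indices never
  skip an interval.\<close>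

definition group_index :: "nat \<Rightarrow> nat \<Rightarrow> nat \<Rightarrow> nat" where
  "group_index n N i = i * N div Suc n"

lemma group_index_0 [simp]: "group_index n N 0 = 0"
  by (simp add: group_index_def)

lemma group_index_Suc:
  assumes "N \<le> Suc n"
  shows "group_index n N (Suc i) = group_index n N i \<or> group_index n N (Suc i) = Suc (group_index n N i)"
proof -
  have "i * N div Suc n \<le> Suc i * N div Suc n" by (intro div_le_mono) simp
  moreover have "Suc i * N div Suc n \<le> (i * N + Suc n) div Suc n"
    using assms by (intro div_le_mono) simp
  moreover have "(i * N + Suc n) div Suc n = Suc (i * N div Suc n)"
    by (subst div_add_self2) simp_all
  ultimately show ?thesis unfolding group_index_def by linarith
qed

lemma group_index_less:
  assumes "i \<le> n" "0 < N"
  shows "group_index n N i < N"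
proof -
  have "i * N < Suc n * N" using assms by (intro mult_strict_right_mono) auto
  then show ?thesis unfolding group_index_def by (intro less_mult_imp_div_less) (simp add: mult.commute)
qed

text \<open>Two indices \<open>a \<le> i\<close> of one group satisfy
  \<open>(i - a) * N \<le> Suc n\<close>, so the group fits into \<open>Suc n div N + 1\<close>
  points. Since \<open>N \<le> Suc n\<close>, the additional 1 at most doubles the average
  size.\<close>

lemma card_group_le:
  assumes "0 < N" "N \<le> Suc n"
  shows "real (card {i. i \<le> n \<and> group_index n N i = I}) \<le> 2 * real (Suc n) / real N"
proof -
  let ?S = "{i. i \<le> n \<and> group_index n N i = I}"
  have "card ?S \<le> Suc n div N + 1"
  proof (cases "?S = {}")
    case False
    define a where "a = Min ?S"
    have fin: "finite ?S" by simp
    have a: "a \<in> ?S" unfolding a_def using False fin by (intro Min_in) auto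
    have "i \<in> {a..a + Suc n div N}" if i: "i \<in> ?S" for i
    proof -
      have le: "a \<le> i" unfolding a_def using fin i by (intro Min_le) auto
      have "I * Suc n \<le> a * N" using a div_times_less_eq_dividend[of "a * N" "Suc n"]
        by (simp add: group_index_def del: mult_Suc_right)
      moreover have "i * N < (I + 1) * Suc n"
      proof -
        have "i * N div Suc n < I + 1" using i by (auto simp: group_index_def)
        then show ?thesis by (subst (asm) div_less_iff_less_mult) auto
      qed
      ultimately have "(i - a) * N \<le> Suc n" by (simp add: diff_mult_distrib)
      then have "i - a \<le> Suc n div N" using assms by (simp add: less_eq_div_iff_mult_less_eq)
      then show ?thesis using le by auto
    qed
    then have "card ?S \<le> card {a..a + Suc n div N}" by (intro card_mono) auto
    then show ?thesis by simp
  next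
    case True
    show ?thesis unfolding True by simp
  qed
  then have "real (card ?S) \<le> real (Suc n div N) + 1" by linarith
  also have "\<dots> \<le> real (Suc n) / real N + real (Suc n) / real N"
    using assms by (intro add_mono of_nat_div_le_of_nat) (simp_all add: field_simps)
  finally show ?thesis by simp
qed

text \<open>The label \<open>cl\<close> partitions the index set, so functions of the field on
  different cells depend on disjoint families of variables.\<close>

lemma (in prob_space) indep_vars_cells:
  assumes "indep_vars (\<lambda>_. borel) \<zeta> B"
    and "\<And>c. c \<in> S \<Longrightarrow> f c \<in> borel_measurable (PiM {z \<in> B. cl z = c} (\<lambda>_. borel))"
    and "\<And>c \<omega>. c \<in> S \<Longrightarrow> W c \<omega> = f c (restrict (\<lambda>z. \<zeta> z \<omega>) {z \<in> B. cl z = c})"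
  shows "indep_vars (\<lambda>_. borel) W S"
proof -
  have "indep_vars (\<lambda>c. PiM {z \<in> B. cl z = c} (\<lambda>_. borel))
     (\<lambda>c \<omega>. restrict (\<lambda>z. \<zeta> z \<omega>) {z \<in> B. cl z = c}) S"
    by (intro indep_vars_restrict[OF assms(1)]) (auto simp: disjoint_family_on_def)
  then have "indep_vars (\<lambda>_. borel) (\<lambda>c \<omega>. f c (restrict (\<lambda>z. \<zeta> z \<omega>) {z \<in> B. cl z = c})) S"
    by (rule indep_vars_compose2) (rule assms(2))
  moreover have "W c = (\<lambda>\<omega>. f c (restrict (\<lambda>z. \<zeta> z \<omega>) {z \<in> B. cl z = c}))" if "c \<in> S" for c
    using assms(3)[OF that] by auto
  ultimately show ?thesis by (subst indep_vars_cong[OF refl _ refl]) auto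
qed

text \<open>On the unit interval \<open>exp u \<le> 1 + u + u^2 \<le> 1 + 2 * u\<close>, so the
  first moment suffices. The factor \<open>1 *\<close> is the \<theta> of the general lemmas and
  lets the statement match their premises.\<close>

lemma (in prob_space) nn_integral_exp_unit_interval_le:
  fixes \<xi> :: "'a \<Rightarrow> real"
  assumes [measurable]: "\<xi> \<in> borel_measurable M" and bd: "\<And>\<omega>. 0 \<le> \<xi> \<omega>" "\<And>\<omega>. \<xi> \<omega> \<le> 1"
    and mean: "expectation \<xi> \<le> p"
  shows "(\<integral>\<^sup>+\<omega>. ennreal (exp (1 * \<xi> \<omega>)) \<partial>M) \<le> ennreal (exp (2 * p))"
proof -
  have [simp]: "integrable M \<xi>"
    using bd by (intro integrable_const_bound[where B = 1]) auto
  have "exp (\<xi> \<omega>) \<le> 1 + 2 * \<xi> \<omega>" for \<omega>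
  proof -
    have "exp (\<xi> \<omega>) \<le> 1 + \<xi> \<omega> + (\<xi> \<omega>)\<^sup>2" using bd[of \<omega>] by (intro exp_le_quadratic) auto
    moreover have "(\<xi> \<omega>)\<^sup>2 \<le> \<xi> \<omega>"
      using bd[of \<omega>] mult_left_mono[of "\<xi> \<omega>" 1 "\<xi> \<omega>"] by (simp add: power2_eq_square)
    ultimately show ?thesis by simp
  qed
  then have "(\<integral>\<^sup>+\<omega>. ennreal (exp (1 * \<xi> \<omega>)) \<partial>M) \<le> (\<integral>\<^sup>+\<omega>. ennreal (1 + 2 * \<xi> \<omega>) \<partial>M)"
    by (intro nn_integral_mono ennreal_leI) auto
  also have "\<dots> = ennreal (expectation (\<lambda>\<omega>. 1 + 2 * \<xi> \<omega>))"
    using bd by (intro nn_integral_eq_integral) auto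
  also have "expectation (\<lambda>\<omega>. 1 + 2 * \<xi> \<omega>) = 1 + 2 * expectation \<xi>" by (simp add: prob_space)
  also have "ennreal \<dots> \<le> ennreal (exp (2 * p))"
    using mean exp_ge_add_one_self[of "2 * p"] by (intro ennreal_leI) linarith
  finally show ?thesis .
qed

lemma last_passage_le_sum_box:
  assumes "\<And>z. 0 \<le> x z"
  shows "last_passage x n m \<le> (\<Sum>z\<in>{..n} \<times> {..m}. x z)"
proof -
  obtain p where p: "p \<in> lattice_paths n m" "last_passage x n m = (\<Sum>z\<leftarrow>butlast p. x z)"
    by (rule last_passage_attained)
  have "(\<Sum>z\<leftarrow>butlast p. x z) = (\<Sum>z\<in>set (butlast p). x z)"
    using lattice_paths_distinct[OF p(1)] by (simp add: sum_list_distinct_conv_sum_set distinct_butlast)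
  also have "\<dots> \<le> (\<Sum>z\<in>{..n} \<times> {..m}. x z)"
    using lattice_paths_subset_box[OF p(1)] assms by (intro sum_mono2) (auto dest: in_set_butlastD)
  finally show ?thesis using p(2) by simp
qed

text \<open>With \<open>s\<close> the bound on the expected total weight of the box,
  \<open>N\<close> of order \<open>sqrt s\<close> groups in each direction give cells of bounded
  expected weight. A path meets fewer than \<open>2 * N\<close> of them, and in each the entire cell
  sum is affordable.\<close>

lemma (in prob_space) nn_integral_last_passage_sparse_le:
  fixes \<xi> :: "nat \<times> nat \<Rightarrow> 'a \<Rightarrow> real"
  assumes indep: "indep_vars (\<lambda>_. borel) \<xi> ({..n} \<times> {..m})"
    and bd: "\<And>z \<omega>. 0 \<le> \<xi> z \<omega>" "\<And>z \<omega>. \<xi> z \<omega> \<le> 1"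
    and mean: "\<And>z. z \<in> {..n} \<times> {..m} \<Longrightarrow> expectation (\<xi> z) \<le> p"
    and p: "0 \<le> p" "p * real (Suc n) \<le> real (Suc m)" and mn: "m \<le> n"
  shows "(\<integral>\<^sup>+\<omega>. ennreal (last_passage (\<lambda>z. \<xi> z \<omega>) n m) \<partial>M) \<le> ennreal (36 * sqrt (p * real (Suc n) * real (Suc m)))"
proof -
  define s where "s = p * real (Suc n) * real (Suc m)"
  have s0: "0 \<le> s" using p by (simp add: s_def)
  have meas: "\<xi> z \<in> borel_measurable M" if "z \<in> {..n} \<times> {..m}" for z
    using indep that by (auto simp: indep_vars_def)
  have "(\<integral>\<^sup>+\<omega>. ennreal (last_passage (\<lambda>z. \<xi> z \<omega>) n m) \<partial>M) \<le> ennreal (36 * sqrt s)"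
  proof (cases "s \<le> 1")
    case True
    have "(\<integral>\<^sup>+\<omega>. ennreal (last_passage (\<lambda>z. \<xi> z \<omega>) n m) \<partial>M)
      \<le> (\<integral>\<^sup>+\<omega>. ennreal (\<Sum>z\<in>{..n} \<times> {..m}. \<xi> z \<omega>) \<partial>M)"
      using bd by (intro nn_integral_mono ennreal_leI last_passage_le_sum_box) auto
    also have "\<dots> = ennreal (expectation (\<lambda>\<omega>. \<Sum>z\<in>{..n} \<times> {..m}. \<xi> z \<omega>))"
      using bd meas by (intro nn_integral_eq_integral Bochner_Integration.integrable_sum
        integrable_const_bound[where B = 1] always_eventually allI sum_nonneg) auto
    also have "expectation (\<lambda>\<omega>. \<Sum>z\<in>{..n} \<times> {..m}. \<xi> z \<omega>) = (\<Sum>z\<in>{..n} \<times> {..m}. expectation (\<xi> z))"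
      using bd meas by (intro Bochner_Integration.integral_sum integrable_const_bound[where B = 1]) auto
    also have "\<dots> \<le> (\<Sum>z\<in>{..n} \<times> {..m}. p)"
      using mean by (intro sum_mono) auto
    also have "\<dots> = s" by (simp add: s_def algebra_simps)
    also have "s \<le> 36 * sqrt s"
    proof -
      have "s * s \<le> s * 1" using True s0 by (intro mult_left_mono) auto
      then have "s \<le> sqrt s" by (intro real_le_rsqrt) (simp add: power2_eq_square)
      then show ?thesis using s0 by (smt (verit) real_sqrt_ge_zero)
    qed
    finally show ?thesis by (simp add: ennreal_leI)
  next
    case False
    define N where "N = nat \<lceil>sqrt s\<rceil>"
    have s1: "1 < s" "1 < sqrt s" using False by auto
    have N: "sqrt s \<le> real N" "real N \<le> 2 * sqrt s" "0 < N"
    proof -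
      have "0 \<le> \<lceil>sqrt s\<rceil>" using s1 by linarith
      then have "real N = of_int \<lceil>sqrt s\<rceil>" by (simp add: N_def)
      then show "sqrt s \<le> real N" "real N \<le> 2 * sqrt s" using s1 by linarith+
      then show "0 < N" using s1 by linarith
    qed
    \<comment> \<open>Sparsity is what allows \<open>N\<close> groups of rows: it gives
      \<open>sqrt s \<le> Suc m\<close>.\<close>
    have "s \<le> (real (Suc m))\<^sup>2"
      using mult_right_mono[OF p(2), of "real (Suc m)"] by (simp add: s_def power2_eq_square)
    then have "sqrt s \<le> real (Suc m)" by (intro real_le_lsqrt) auto
    then have Nm: "N \<le> Suc m" by (simp add: N_def nat_le_iff ceiling_le_iff)
    then have Nn: "N \<le> Suc n" using mn by simp
    let ?B = "{..n} \<times> {..m}"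
    define \<phi> where "\<phi> = group_index n N"
    define \<psi> where "\<psi> = group_index m N"
    define cl where "cl z = (\<phi> (fst z), \<psi> (snd z))" for z
    define W where "W c \<omega> = (\<Sum>z | z \<in> ?B \<and> cl z = c. \<xi> z \<omega>)" for c \<omega>
    \<comment> \<open>Everything of the cell to the lower left of \<open>z\<close>, hence at least
      what any path has collected there, as the weights are nonnegative.\<close>
    define g where "g z \<omega> = (\<Sum>w | w \<in> ?B \<and> cl w = cl z \<and> fst w \<le> fst z \<and> snd w \<le> snd z. \<xi> w \<omega>)" for z \<omega>
    have W0: "0 \<le> W c \<omega>" for c \<omega> unfolding W_def using bd by (intro sum_nonneg) auto
    have fin: "finite {z. z \<in> ?B \<and> P z}" for P by (rule finite_subset[of _ ?B]) auto
    have le: "last_passage (\<lambda>z. \<xi> z \<omega>) n m \<le> full_passage (\<lambda>c. W c \<omega>) (\<phi> n) (\<psi> m)" for \<omega>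
    proof (rule last_passage_le_coarse[where g = "\<lambda>z. g z \<omega>"])
      show "\<xi> (i, j) \<omega> \<le> g (i, j) \<omega>" if "i \<le> n" "j \<le> m" for i j
        unfolding g_def using that bd fin by (intro member_le_sum) auto
      show "g (i, j) \<omega> + \<xi> (Suc i, j) \<omega> \<le> g (Suc i, j) \<omega>" if "i < n" "j \<le> m" "\<phi> (Suc i) = \<phi> i" for i j
      proof -
        let ?A = "{w \<in> ?B. cl w = cl (i, j) \<and> fst w \<le> fst (i, j) \<and> snd w \<le> snd (i, j)}"
        have "g (i, j) \<omega> + \<xi> (Suc i, j) \<omega> = (\<Sum>w\<in>insert (Suc i, j) ?A. \<xi> w \<omega>)"
          unfolding g_def by (subst sum.insert) (use fin in auto)
        also have "\<dots> \<le> g (Suc i, j) \<omega>"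
          unfolding g_def using bd that fin by (intro sum_mono2) (auto simp: cl_def)
        finally show ?thesis .
      qed
      show "g (i, j) \<omega> + \<xi> (i, Suc j) \<omega> \<le> g (i, Suc j) \<omega>" if "i \<le> n" "j < m" "\<psi> (Suc j) = \<psi> j" for i j
      proof -
        let ?A = "{w \<in> ?B. cl w = cl (i, j) \<and> fst w \<le> fst (i, j) \<and> snd w \<le> snd (i, j)}"
        have "g (i, j) \<omega> + \<xi> (i, Suc j) \<omega> = (\<Sum>w\<in>insert (i, Suc j) ?A. \<xi> w \<omega>)"
          unfolding g_def by (subst sum.insert) (use fin in auto)
        also have "\<dots> \<le> g (i, Suc j) \<omega>"
          unfolding g_def using bd that fin by (intro sum_mono2) (auto simp: cl_def)
        finally show ?thesis .
      qed
      show "g (i, j) \<omega> \<le> W (\<phi> i, \<psi> j) \<omega>" if "i \<le> n" "j \<le> m" for i j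
        unfolding g_def W_def using bd that fin by (intro sum_mono2) (auto simp: cl_def)
    qed (use W0 group_index_Suc[OF Nn] group_index_Suc[OF Nm] in \<open>auto simp: \<phi>_def \<psi>_def\<close>)
    have indW: "indep_vars (\<lambda>_. borel) W ({..\<phi> n} \<times> {..\<psi> m})"
    proof (rule indep_vars_cells[OF indep, where cl = cl and f = "\<lambda>c y. \<Sum>z | z \<in> ?B \<and> cl z = c. y z"])
      show "(\<lambda>y. \<Sum>z | z \<in> ?B \<and> cl z = c. y z) \<in> borel_measurable (Pi\<^sub>M {z \<in> ?B. cl z = c} (\<lambda>_. borel :: real measure))" for c
        by (rule borel_measurable_sum) (rule measurable_component_singleton)
      show "W c \<omega> = (\<Sum>z | z \<in> ?B \<and> cl z = c. (\<lambda>z\<in>{z \<in> ?B. cl z = c}. \<xi> z \<omega>) z)" for c \<omega>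
        unfolding W_def by (intro sum.cong) auto
    qed
    have expW: "(\<integral>\<^sup>+\<omega>. ennreal (exp (1 * W c \<omega>)) \<partial>M) \<le> ennreal (exp 8)" for c
    proof -
      let ?C = "{z. z \<in> ?B \<and> cl z = c}"
      have "(\<integral>\<^sup>+\<omega>. ennreal (exp (1 * W c \<omega>)) \<partial>M) \<le> ennreal (exp (\<Sum>z\<in>?C. 2 * p))"
        unfolding W_def
      proof (rule nn_integral_exp_sum_le[OF fin])
        show "indep_vars (\<lambda>_. borel) \<xi> ?C" by (rule indep_vars_subset[OF indep]) auto
        show "(\<integral>\<^sup>+\<omega>. ennreal (exp (1 * \<xi> z \<omega>)) \<partial>M) \<le> ennreal (exp (2 * p))" if "z \<in> ?C" for z
          using that bd mean meas by (intro nn_integral_exp_unit_interval_le) auto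
      qed
      also have "(\<Sum>z\<in>?C. 2 * p) = real (card ?C) * (2 * p)" by simp
      also have "\<dots> \<le> 8"
      proof -
        have "?C = {i. i \<le> n \<and> \<phi> i = fst c} \<times> {j. j \<le> m \<and> \<psi> j = snd c}"
          by (auto simp: cl_def)
        then have "real (card ?C) = real (card {i. i \<le> n \<and> \<phi> i = fst c}) * real (card {j. j \<le> m \<and> \<psi> j = snd c})"
          by simp
        \<comment> \<open>The 8 is made of a factor 2 from the group size in each direction and the
          2 in \<open>exp (2 * p)\<close>.\<close>
        also have "\<dots> \<le> (2 * real (Suc n) / real N) * (2 * real (Suc m) / real N)"
          unfolding \<phi>_def \<psi>_def using N Nm Nn by (intro mult_mono card_group_le) auto
        finally have "real (card ?C) * (2 * p) \<le> (2 * real (Suc n) / real N) * (2 * real (Suc m) / real N) * (2 * p)"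
          using p by (intro mult_right_mono) auto
        also have "\<dots> = 8 * s / (real N)\<^sup>2" by (simp add: s_def power2_eq_square algebra_simps)
        also have "s \<le> (real N)\<^sup>2" using N(1) s0 by (simp add: sqrt_le_D)
        then have "8 * s / (real N)\<^sup>2 \<le> 8" using N(3) by (simp add: field_simps)
        finally show ?thesis .
      qed
      finally show ?thesis by (simp add: ennreal_leI)
    qed
    have "(\<integral>\<^sup>+\<omega>. ennreal (last_passage (\<lambda>z. \<xi> z \<omega>) n m) \<partial>M)
      \<le> (\<integral>\<^sup>+\<omega>. ennreal (full_passage (\<lambda>c. W c \<omega>) (\<phi> n) (\<psi> m)) \<partial>M)"
      by (intro nn_integral_mono ennreal_leI le)
    also have "\<dots> \<le> ennreal ((real (Suc (\<phi> n + \<psi> m)) * (8 + 1) + 1) / 1)"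
      by (rule nn_integral_full_passage_le[OF indW expW]) auto
    also have "\<dots> \<le> ennreal (36 * sqrt s)"
    proof (rule ennreal_leI)
      have "\<phi> n < N" "\<psi> m < N" unfolding \<phi>_def \<psi>_def using N by (auto intro: group_index_less)
      then have "real (Suc (\<phi> n + \<psi> m)) \<le> 2 * real N - 1" by linarith
      \<comment> \<open>At most \<open>9 * (2 * N - 1) + 1 \<le> 18 * N\<close>, and
        \<open>N \<le> 2 * sqrt s\<close>.\<close>
      then show "(real (Suc (\<phi> n + \<psi> m)) * (8 + 1) + 1) / 1 \<le> 36 * sqrt s" using N(2) by argo
    qed
    finally show ?thesis .
  qed
  then show ?thesis by (simp add: s_def)
qed

text \<open>A cell is an interval in one row, and a visit to it collects a difference of two partial
  sums, at most the maximum \<open>U\<close> of the partial sums plus the maximum \<open>V\<close>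
  of their negatives. Doob's inequality shows that both live on the scale \<open>sqrt q\<close>,
  with \<open>q\<close> of the order of the variance of the cell.\<close>

lemma (in prob_space) nn_integral_last_passage_dense_le:
  fixes \<zeta> :: "nat \<times> nat \<Rightarrow> 'a \<Rightarrow> real"
  assumes indep: "indep_vars (\<lambda>_. borel) \<zeta> ({..n} \<times> {..m})"
    and bd: "\<And>z \<omega>. \<bar>\<zeta> z \<omega>\<bar> \<le> 1"
    and mean: "\<And>z. z \<in> {..n} \<times> {..m} \<Longrightarrow> expectation (\<zeta> z) = 0"
    and var: "\<And>z. z \<in> {..n} \<times> {..m} \<Longrightarrow> expectation (\<lambda>\<omega>. (\<zeta> z \<omega>)\<^sup>2) \<le> p"
    and p: "real (Suc m) \<le> p * real (Suc n)" and mn: "m \<le> n"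
  shows "(\<integral>\<^sup>+\<omega>. ennreal (last_passage (\<lambda>z. \<zeta> z \<omega>) n m) \<partial>M) \<le> ennreal (20 * sqrt (p * real (Suc n) * real (Suc m)))"
proof -
  let ?B = "{..n} \<times> {..m}"
  define N where "N = Suc m"
  have N: "0 < N" "N \<le> Suc n" using mn by (auto simp: N_def)
  have p0: "0 < p"
  proof (rule ccontr)
    assume "\<not> 0 < p"
    then have "p * real (Suc n) \<le> 0" by (intro mult_nonpos_nonneg) auto
    then show False using p by simp
  qed
  define q where "q = p * real (Suc n) / real N"
  have q: "1 \<le> q" using p N by (simp add: q_def N_def field_simps)
  \<comment> \<open>The inverse of the natural scale. The 2 leaves room for doubling \<theta> in
    Doob's inequality: the hypothesis on \<open>p\<close> gives \<open>q \<ge> 1\<close>, hence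
    \<open>2 * \<theta> \<le> 1\<close>, as the quadratic bound on \<open>exp\<close>
    demands.\<close>
  define \<theta> where "\<theta> = 1 / (2 * sqrt q)"
  have \<theta>: "0 < \<theta>" "\<bar>2 * \<theta>\<bar> \<le> 1" "(2 * \<theta>)\<^sup>2 = 1 / q"
    using q by (auto simp: \<theta>_def power_divide)
  define \<phi> where "\<phi> = group_index n N"
  define cl where "cl z = (\<phi> (fst z), snd z)" for z :: "nat \<times> nat"
  \<comment> \<open>The row is extended by 0 outside the cell, so that all cells share the index
    range \<open>{..n}\<close> and their partial sums need no offset.\<close>
  define Y where "Y c i \<omega> = (if \<phi> i = fst c then \<zeta> (i, snd c) \<omega> else 0)" for c i \<omega>
  define P where "P c t \<omega> = (\<Sum>i<t. Y c i \<omega>)" for c t \<omega>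
  define U where "U c \<omega> = Max ((\<lambda>t. P c t \<omega>) ` {..Suc n})" for c \<omega>
  define V where "V c \<omega> = Max ((\<lambda>t. - P c t \<omega>) ` {..Suc n})" for c \<omega>
  define W where "W c \<omega> = U c \<omega> + V c \<omega>" for c \<omega>
  \<comment> \<open>The sum from an unknown entry column to the current one is the current partial
    sum minus the one at entry; \<open>V\<close> bounds the latter for every possible entry.\<close>
  define g where "g z \<omega> = P (cl z) (Suc (fst z)) \<omega> + V (cl z) \<omega>" for z \<omega>
  have U_ge: "P c t \<omega> \<le> U c \<omega>" and V_ge: "- P c t \<omega> \<le> V c \<omega>" if "t \<le> Suc n" for c t \<omega>
    unfolding U_def V_def using that by (auto intro!: Max_ge)
  have W0: "0 \<le> W c \<omega>" for c \<omega>
    using U_ge[of 0 c \<omega>] V_ge[of 0 c \<omega>] by (simp add: W_def P_def)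
  \<comment> \<open>Rows are grouped by \<open>id\<close>: each vertical step enters a new cell, and
    the condition on vertical steps inside a cell is vacuous.\<close>
  have le: "last_passage (\<lambda>z. \<zeta> z \<omega>) n m \<le> full_passage (\<lambda>c. W c \<omega>) (\<phi> n) (id m)" for \<omega>
  proof (rule last_passage_le_coarse[where g = "\<lambda>z. g z \<omega>"])
    show "\<zeta> (i, j) \<omega> \<le> g (i, j) \<omega>" if "i \<le> n" "j \<le> m" for i j
      using V_ge[of i "cl (i, j)" \<omega>] that by (simp add: g_def P_def Y_def cl_def)
    show "g (i, j) \<omega> + \<zeta> (Suc i, j) \<omega> \<le> g (Suc i, j) \<omega>" if "i < n" "j \<le> m" "\<phi> (Suc i) = \<phi> i" for i j
      using that by (simp add: g_def P_def Y_def cl_def)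
    show "g (i, j) \<omega> \<le> W (\<phi> i, id j) \<omega>" if "i \<le> n" "j \<le> m" for i j
      using U_ge[of "Suc i" "cl (i, j)" \<omega>] that by (simp add: g_def W_def cl_def)
  qed (use W0 group_index_Suc[OF N(2)] in \<open>auto simp: \<phi>_def\<close>)
  have indW: "indep_vars (\<lambda>_. borel) W ({..\<phi> n} \<times> {..id m})"
  proof -
    define Pf where "Pf c t y = (\<Sum>i<t. if \<phi> i = fst c then y (i, snd c) else 0)"
      for c :: "nat \<times> nat" and t and y :: "nat \<times> nat \<Rightarrow> real"
    have Pf_m: "Pf c t \<in> borel_measurable (Pi\<^sub>M {z \<in> ?B. cl z = c} (\<lambda>_. borel))"
      if "c \<in> {..\<phi> n} \<times> {..id m}" "t \<le> Suc n" for c t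
      unfolding Pf_def
    proof (intro borel_measurable_sum)
      fix i assume "i \<in> {..<t}"
      then show "(\<lambda>y. if \<phi> i = fst c then y (i, snd c) else 0)
          \<in> borel_measurable (Pi\<^sub>M {z \<in> ?B. cl z = c} (\<lambda>_. borel))"
        using that by (cases "\<phi> i = fst c") (auto simp: cl_def intro!: measurable_component_singleton)
    qed
    have Pf: "Pf c t (\<lambda>z\<in>{z \<in> ?B. cl z = c}. \<zeta> z \<omega>) = P c t \<omega>"
      if "c \<in> {..\<phi> n} \<times> {..id m}" "t \<le> Suc n" for c t \<omega>
      unfolding Pf_def P_def Y_def using that by (intro sum.cong) (auto simp: cl_def)
    show ?thesis
    proof (rule indep_vars_cells[OF indep, where cl = cl and
        f = "\<lambda>c y. Max ((\<lambda>t. Pf c t y) ` {..Suc n}) + Max ((\<lambda>t. - Pf c t y) ` {..Suc n})"])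
      fix c assume c: "c \<in> {..\<phi> n} \<times> {..id m}"
      show "(\<lambda>y. Max ((\<lambda>t. Pf c t y) ` {..Suc n}) + Max ((\<lambda>t. - Pf c t y) ` {..Suc n}))
          \<in> borel_measurable (Pi\<^sub>M {z \<in> ?B. cl z = c} (\<lambda>_. borel))"
        using Pf_m[OF c] by (intro borel_measurable_add borel_measurable_Max borel_measurable_uminus) auto
      show "W c \<omega> = Max ((\<lambda>t. Pf c t (\<lambda>z\<in>{z \<in> ?B. cl z = c}. \<zeta> z \<omega>)) ` {..Suc n})
          + Max ((\<lambda>t. - Pf c t (\<lambda>z\<in>{z \<in> ?B. cl z = c}. \<zeta> z \<omega>)) ` {..Suc n})" for \<omega>
        unfolding W_def U_def V_def using Pf[OF c]
        by (intro arg_cong2[where f = "(+)"] arg_cong[where f = Max] image_cong) auto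
    qed
  qed
  have expW: "(\<integral>\<^sup>+\<omega>. ennreal (exp (\<theta> * W c \<omega>)) \<partial>M) \<le> ennreal (exp 4)"
    if c: "c \<in> {..\<phi> n} \<times> {..id m}" for c
  proof -
    have indY: "indep_vars (\<lambda>_. borel) (Y c) {..<Suc n}"
    proof -
      have "indep_vars (\<lambda>i. Pi\<^sub>M {(i, snd c)} (\<lambda>_. borel))
          (\<lambda>i \<omega>. restrict (\<lambda>z. \<zeta> z \<omega>) {(i, snd c)}) {..<Suc n}"
        using c by (intro indep_vars_restrict[OF indep]) (auto simp: disjoint_family_on_def)
      then have "indep_vars (\<lambda>_. borel)
          (\<lambda>i \<omega>. (\<lambda>y. if \<phi> i = fst c then y (i, snd c) else 0) (restrict (\<lambda>z. \<zeta> z \<omega>) {(i, snd c)})) {..<Suc n}"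
        by (rule indep_vars_compose2) measurable
      moreover have "(\<lambda>i \<omega>. (\<lambda>y. if \<phi> i = fst c then y (i, snd c) else 0) (restrict (\<lambda>z. \<zeta> z \<omega>) {(i, snd c)})) = Y c"
        by (auto simp: Y_def fun_eq_iff)
      ultimately show ?thesis by simp
    qed
    have bdY: "\<bar>Y c i \<omega>\<bar> \<le> 1" for i \<omega> using bd by (simp add: Y_def)
    have Y_m: "Y c i \<in> borel_measurable M" if "i < Suc n" for i
      using indY that by (auto simp: indep_vars_def)
    have meanY: "expectation (Y c i) = 0" if "i < Suc n" for i
      using mean[of "(i, snd c)"] that c unfolding Y_def[abs_def] by (cases "\<phi> i = fst c") auto
    have varY: "expectation (\<lambda>\<omega>. (Y c i \<omega>)\<^sup>2) \<le> (if \<phi> i = fst c then p else 0)" if "i < Suc n" for i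
      using var[of "(i, snd c)"] that c unfolding Y_def by (cases "\<phi> i = fst c") auto
    define w where "w = (\<Sum>i<Suc n. if \<phi> i = fst c then p else 0)"
    have "w = real (card {i. i \<le> n \<and> \<phi> i = fst c}) * p"
      unfolding w_def by (simp add: sum.If_cases Int_def less_Suc_eq_le del: sum.lessThan_Suc)
    also have "\<dots> \<le> (2 * real (Suc n) / real N) * p"
      unfolding \<phi>_def using N p0 by (intro mult_right_mono card_group_le) auto
    also have "\<dots> = 2 * q" by (simp add: q_def)
    finally have w: "w \<le> 2 * q" .
    have exp_end: "expectation (\<lambda>\<omega>. exp (2 * \<eta> * (\<Sum>i<Suc n. Y c i \<omega>))) \<le> exp 2" if \<eta>: "\<bar>\<eta>\<bar> = \<theta>" for \<eta>
    proof -
      have \<eta>2: "\<bar>2 * \<eta>\<bar> \<le> 1" "(2 * \<eta>)\<^sup>2 = 1 / q"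
        using \<eta> \<theta> by (auto simp: abs_mult power2_eq_square)
      have "(\<integral>\<^sup>+\<omega>. ennreal (exp ((2 * \<eta>) * (\<Sum>i<Suc n. Y c i \<omega>))) \<partial>M)
         \<le> ennreal (exp (\<Sum>i<Suc n. (2 * \<eta>)\<^sup>2 * (if \<phi> i = fst c then p else 0)))"
      proof (rule nn_integral_exp_sum_le[OF _ indY])
        fix i assume i: "i \<in> {..<Suc n}"
        have "(\<integral>\<^sup>+\<omega>. ennreal (exp ((2 * \<eta>) * Y c i \<omega>)) \<partial>M) = ennreal (expectation (\<lambda>\<omega>. exp ((2 * \<eta>) * Y c i \<omega>)))"
        proof (intro nn_integral_eq_integral integrable_const_bound[where B = "exp 1"])
          have "\<bar>2 * \<eta> * Y c i \<omega>\<bar> \<le> 1" for \<omega>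
            using mult_mono[OF \<eta>2(1) bdY[of i \<omega>]] by (simp add: abs_mult)
          then show "AE \<omega> in M. norm (exp (2 * \<eta> * Y c i \<omega>)) \<le> exp 1"
            by (auto dest: abs_le_D1)
        qed (use Y_m i in auto)
        also have "\<dots> \<le> ennreal (exp ((2 * \<eta>)\<^sup>2 * (if \<phi> i = fst c then p else 0)))"
          using i bdY meanY varY Y_m \<eta>2 by (intro ennreal_leI expectation_exp_bounded_le) auto
        finally show "(\<integral>\<^sup>+\<omega>. ennreal (exp ((2 * \<eta>) * Y c i \<omega>)) \<partial>M)
          \<le> ennreal (exp ((2 * \<eta>)\<^sup>2 * (if \<phi> i = fst c then p else 0)))" .
      qed simp
      also have "(\<Sum>i<Suc n. (2 * \<eta>)\<^sup>2 * (if \<phi> i = fst c then p else 0)) = w / q"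
        unfolding w_def sum_distrib_left[symmetric] \<eta>2(2) by simp
      also have "w / q \<le> 2" using w q by (simp add: field_simps)
      finally have le2: "(\<integral>\<^sup>+\<omega>. ennreal (exp ((2 * \<eta>) * (\<Sum>i<Suc n. Y c i \<omega>))) \<partial>M) \<le> ennreal (exp 2)"
        by (simp add: ennreal_leI del: sum.lessThan_Suc)
      have "expectation (\<lambda>\<omega>. exp (2 * \<eta> * (\<Sum>i<Suc n. Y c i \<omega>)))
         = enn2real (\<integral>\<^sup>+\<omega>. ennreal (exp (2 * \<eta> * (\<Sum>i<Suc n. Y c i \<omega>))) \<partial>M)"
        using Y_m by (intro integral_eq_nn_integral measurable_compose[OF _ borel_measurable_exp]
          borel_measurable_times borel_measurable_const borel_measurable_sum) auto
      also have "\<dots> \<le> exp 2"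
        using le2 by (intro enn2real_leI) auto
      finally show ?thesis .
    qed
    define Z where "Z \<eta> \<omega> = Max ((\<lambda>t. exp (\<eta> * (\<Sum>i<t. Y c i \<omega>))) ` {..Suc n})" for \<eta> \<omega>
    have Z_le: "expectation (\<lambda>\<omega>. (Z \<eta> \<omega>)\<^sup>2) \<le> 4 * exp 2" if \<eta>: "\<bar>\<eta>\<bar> = \<theta>" for \<eta>
    proof -
      have "expectation (\<lambda>\<omega>. (Z \<eta> \<omega>)\<^sup>2) \<le> 4 * expectation (\<lambda>\<omega>. exp (2 * \<eta> * (\<Sum>i<Suc n. Y c i \<omega>)))"
        unfolding Z_def using indY bdY meanY by (rule expectation_max_exp_partial_sums_le)
      then show ?thesis using exp_end[OF \<eta>] by simp
    qed
    have ZU: "exp (\<theta> * U c \<omega>) \<le> Z \<theta> \<omega>" and ZV: "exp (\<theta> * V c \<omega>) \<le> Z (- \<theta>) \<omega>" for \<omega>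
    proof -
      have "U c \<omega> \<in> (\<lambda>t. P c t \<omega>) ` {..Suc n}" "V c \<omega> \<in> (\<lambda>t. - P c t \<omega>) ` {..Suc n}"
        unfolding U_def V_def by (intro Max_in; auto)+
      then obtain s t where st: "s \<le> Suc n" "U c \<omega> = P c s \<omega>" "t \<le> Suc n" "V c \<omega> = - P c t \<omega>" by auto
      show "exp (\<theta> * U c \<omega>) \<le> Z \<theta> \<omega>"
        unfolding st Z_def P_def using st(1) by (intro Max_ge) auto
      have "exp (- \<theta> * P c t \<omega>) \<le> Z (- \<theta>) \<omega>"
        unfolding Z_def P_def using st(3) by (intro Max_ge) auto
      then show "exp (\<theta> * V c \<omega>) \<le> Z (- \<theta>) \<omega>" by (simp add: st)
    qed
    have Z_bd: "0 \<le> Z \<eta> \<omega>" "Z \<eta> \<omega> \<le> exp (\<bar>\<eta>\<bar> * Suc n)" for \<eta> \<omega>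
    proof -
      have "Z \<eta> \<omega> \<in> (\<lambda>t. exp (\<eta> * (\<Sum>i<t. Y c i \<omega>))) ` {..Suc n}"
        unfolding Z_def by (intro Max_in) auto
      then obtain t where t: "t \<le> Suc n" "Z \<eta> \<omega> = exp (\<eta> * (\<Sum>i<t. Y c i \<omega>))" by auto
      then show "0 \<le> Z \<eta> \<omega>" by simp
      have "\<bar>\<Sum>i<t. Y c i \<omega>\<bar> \<le> (\<Sum>i<t. 1)"
        using bdY by (intro order_trans[OF sum_abs] sum_mono) auto
      then have "\<bar>\<eta> * (\<Sum>i<t. Y c i \<omega>)\<bar> \<le> \<bar>\<eta>\<bar> * Suc n"
        using t(1) by (simp add: abs_mult mult_left_mono)
      then show "Z \<eta> \<omega> \<le> exp (\<bar>\<eta>\<bar> * Suc n)" unfolding t(2) exp_le_cancel_iff by linarith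
    qed
    have Z_m [measurable]: "Z \<eta> \<in> borel_measurable M" for \<eta>
      unfolding Z_def using Y_m
      by (intro borel_measurable_Max measurable_compose[OF _ borel_measurable_exp]
        borel_measurable_times borel_measurable_const borel_measurable_sum) auto
    have Z_int: "integrable M (\<lambda>\<omega>. (Z \<eta> \<omega>)\<^sup>2)" for \<eta>
      using Z_bd by (intro integrable_const_bound[where B = "(exp (\<bar>\<eta>\<bar> * Suc n))\<^sup>2"])
        (auto intro!: power_mono)
    \<comment> \<open>\<open>U\<close> and \<open>V\<close> are dependent; the arithmetic-geometric
      mean inequality separates them at the price of second moments, which is why Doob's inequality
      is used in its quadratic form.\<close>
    have "exp (\<theta> * W c \<omega>) \<le> ((Z \<theta> \<omega>)\<^sup>2 + (Z (- \<theta>) \<omega>)\<^sup>2) / 2" for \<omega>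
    proof -
      have "exp (\<theta> * W c \<omega>) = exp (\<theta> * U c \<omega>) * exp (\<theta> * V c \<omega>)"
        by (simp add: W_def algebra_simps exp_add)
      also have "\<dots> \<le> Z \<theta> \<omega> * Z (- \<theta>) \<omega>" using Z_bd ZU ZV by (intro mult_mono) auto
      also have "\<dots> \<le> ((Z \<theta> \<omega>)\<^sup>2 + (Z (- \<theta>) \<omega>)\<^sup>2) / 2"
        using zero_le_power2[of "Z \<theta> \<omega> - Z (- \<theta>) \<omega>"] by (simp add: power2_eq_square algebra_simps)
      finally show ?thesis .
    qed
    then have "(\<integral>\<^sup>+\<omega>. ennreal (exp (\<theta> * W c \<omega>)) \<partial>M)
        \<le> (\<integral>\<^sup>+\<omega>. ennreal (((Z \<theta> \<omega>)\<^sup>2 + (Z (- \<theta>) \<omega>)\<^sup>2) / 2) \<partial>M)"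
      by (intro nn_integral_mono ennreal_leI) auto
    also have "\<dots> = ennreal (expectation (\<lambda>\<omega>. ((Z \<theta> \<omega>)\<^sup>2 + (Z (- \<theta>) \<omega>)\<^sup>2) / 2))"
      using Z_int by (intro nn_integral_eq_integral) auto
    also have "expectation (\<lambda>\<omega>. ((Z \<theta> \<omega>)\<^sup>2 + (Z (- \<theta>) \<omega>)\<^sup>2) / 2)
        = (expectation (\<lambda>\<omega>. (Z \<theta> \<omega>)\<^sup>2) + expectation (\<lambda>\<omega>. (Z (- \<theta>) \<omega>)\<^sup>2)) / 2"
      using Z_int by simp
    also have "\<dots> \<le> 4 * exp 2" using Z_le[of \<theta>] Z_le[of "- \<theta>"] \<theta>(1) by simp
    also have "4 * exp 2 \<le> (exp 4 :: real)"
    proof -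
      have "4 = (2::real) * 2" by simp
      also have "\<dots> \<le> exp 1 * exp 1"
        using exp_ge_add_one_self[of 1] by (intro mult_mono) auto
      finally have "4 \<le> (exp 2 :: real)" by (simp flip: exp_add)
      then have "4 * exp 2 \<le> exp 2 * (exp 2 :: real)" by (intro mult_right_mono) auto
      then show ?thesis by (simp flip: exp_add)
    qed
    finally show ?thesis by (simp add: ennreal_leI)
  qed
  have "(\<integral>\<^sup>+\<omega>. ennreal (last_passage (\<lambda>z. \<zeta> z \<omega>) n m) \<partial>M)
    \<le> (\<integral>\<^sup>+\<omega>. ennreal (full_passage (\<lambda>c. W c \<omega>) (\<phi> n) (id m)) \<partial>M)"
    by (intro nn_integral_mono ennreal_leI le)
  also have "\<dots> \<le> ennreal ((real (Suc (\<phi> n + id m)) * (4 + 1) + 1) / \<theta>)"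
    by (rule nn_integral_full_passage_le[OF indW expW]) (use \<theta> in auto)
  also have "\<dots> \<le> ennreal (20 * sqrt (p * real (Suc n) * real (Suc m)))"
  proof (rule ennreal_leI)
    have "\<phi> n < N" unfolding \<phi>_def using N by (auto intro: group_index_less)
    then have "real (\<phi> n) \<le> real m" by (simp add: N_def)
    then have "real (Suc (\<phi> n + id m)) \<le> 2 * real N - 1" by (simp add: N_def)
    \<comment> \<open>At most \<open>5 * (2 * N - 1) + 1 \<le> 10 * N\<close>; dividing by \<theta>
      contributes the remaining \<open>2 * sqrt q\<close>.\<close>
    then have "(real (Suc (\<phi> n + id m)) * (4 + 1) + 1) / \<theta> \<le> (10 * real N) / \<theta>"
      using \<theta>(1) by (intro divide_right_mono) argo+
    also have "\<dots> = 20 * (real N * sqrt q)" by (simp add: \<theta>_def)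
    also have "real N * sqrt q = sqrt ((real N)\<^sup>2 * q)" by (simp add: real_sqrt_mult)
    also have "(real N)\<^sup>2 * q = p * real (Suc n) * real (Suc m)"
      by (simp add: q_def N_def power2_eq_square)
    finally show "(real (Suc (\<phi> n + id m)) * (4 + 1) + 1) / \<theta> \<le> 20 * sqrt (p * real (Suc n) * real (Suc m))" .
  qed
  finally show ?thesis .
qed

section \<open>Integration over levels\<close>

text \<open>Plays two roles: it dominates the variance \<open>F * (1 - F)\<close> of the indicator
  at level \<open>x\<close>, and it is the mean of the absolute value of
  \<open>layer y x\<close>.\<close>

definition tail :: "real measure \<Rightarrow> real \<Rightarrow> real" where
  "tail H x = (if 0 \<le> x then 1 - cdf H x else cdf H x)"

lemma (in real_distribution) cdf_measurable [measurable]: "cdf M \<in> borel_measurable borel"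
  by (intro borel_measurable_mono monoI cdf_nondecreasing)

lemma (in real_distribution) tail_measurable [measurable]: "tail M \<in> borel_measurable borel"
  unfolding tail_def by measurable

lemma (in real_distribution) tail_bounds: "0 \<le> tail M x" "tail M x \<le> 1"
  using cdf_nonneg[of x] cdf_bounded_prob[of x] by (auto simp: tail_def)

lemma (in real_distribution) nn_integral_sqrt_tail_finite:
  assumes "sqrt_tails_finite M"
  shows "(\<integral>\<^sup>+x. ennreal (sqrt (tail M x)) \<partial>lborel) < \<infinity>"
proof -
  have "(\<integral>\<^sup>+x. ennreal (sqrt (tail M x)) \<partial>lborel)
    \<le> (\<integral>\<^sup>+x. ennreal (sqrt (1 - cdf M x)) * indicator {0..} x + ennreal (sqrt (cdf M x)) * indicator {..0} x \<partial>lborel)"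
    by (intro nn_integral_mono) (auto simp: tail_def indicator_def)
  also have "\<dots> = (\<integral>\<^sup>+x\<in>{0..}. ennreal (sqrt (1 - cdf M x)) \<partial>lborel) + (\<integral>\<^sup>+x\<in>{..0}. ennreal (sqrt (cdf M x)) \<partial>lborel)"
    by (intro nn_integral_add) auto
  also have "\<dots> < \<infinity>" using assms by (simp add: sqrt_tails_finite_def)
  finally show ?thesis .
qed

lemma (in real_distribution) nn_integral_tail_finite:
  assumes "sqrt_tails_finite M"
  shows "(\<integral>\<^sup>+x. ennreal (tail M x) \<partial>lborel) < \<infinity>"
proof -
  have "tail M x \<le> sqrt (tail M x)" for x
    using tail_bounds[of x] by (intro real_le_rsqrt) (simp add: power2_eq_square mult_left_le)
  then have "(\<integral>\<^sup>+x. ennreal (tail M x) \<partial>lborel) \<le> (\<integral>\<^sup>+x. ennreal (sqrt (tail M x)) \<partial>lborel)"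
    by (intro nn_integral_mono ennreal_leI) auto
  also have "\<dots> < \<infinity>" by (rule nn_integral_sqrt_tail_finite[OF assms])
  finally show ?thesis .
qed

text \<open>The layer-cake function for signed \<open>y\<close>: the indicator of
  \<open>{0..<y}\<close> minus that of \<open>{y..<0}\<close>, so that it integrates to
  \<open>y\<close>.\<close>

definition layer :: "real \<Rightarrow> real \<Rightarrow> real" where
  "layer y x = (if 0 \<le> x then 1 else 0) - (if y \<le> x then 1 else 0)"

lemma layer_measurable [measurable]: "(\<lambda>(y, x). layer y x) \<in> borel_measurable (borel \<Otimes>\<^sub>M borel)"
  unfolding layer_def by measurable

lemma layer_eq_indicator: "layer y = (\<lambda>x. indicator {0..<y} x - indicator {y..<0} x)"
  by (auto simp: layer_def indicator_def fun_eq_iff)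

lemma integrable_layer: "integrable lborel (layer y)"
  unfolding layer_eq_indicator
  by (cases "0 \<le> y"; intro Bochner_Integration.integrable_diff integrable_real_indicator) auto

lemma integral_layer: "(\<integral>x. layer y x \<partial>lborel) = y"
  unfolding layer_eq_indicator
  by (cases "0 \<le> y"; subst Bochner_Integration.integral_diff)
    (auto intro!: integrable_real_indicator simp: measure_def)

lemma nn_integral_abs_layer: "(\<integral>\<^sup>+x. ennreal \<bar>layer y x\<bar> \<partial>lborel) = ennreal \<bar>y\<bar>"
proof -
  have "(\<integral>\<^sup>+x. ennreal \<bar>layer y x\<bar> \<partial>lborel) = (\<integral>\<^sup>+x. indicator ({0..<y} \<union> {y..<0}) x \<partial>lborel)"
    by (intro nn_integral_cong) (auto simp: layer_eq_indicator indicator_def)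
  also have "\<dots> = emeasure lborel ({0..<y} \<union> {y..<0})" by simp
  also have "\<dots> = ennreal \<bar>y\<bar>" by (cases "0 \<le> y") auto
  finally show ?thesis .
qed

text \<open>Fubini for \<open>layer\<close> on the product with Lebesgue measure: its absolute value
  has mean \<open>tail M x\<close> at level \<open>x\<close>, which is integrable. The centered
  indicator is \<open>layer y\<close> minus its mean in \<open>y\<close>, and these two parts
  integrate to \<open>y\<close> and to the mean.\<close>

lemma (in real_distribution)
  assumes "sqrt_tails_finite M"
  shows integrable_identity: "integrable M (\<lambda>y. y)"
    and integrable_centered_layer: "integrable lborel (\<lambda>x. cdf M x - (if y \<le> x then 1 else 0))"
    and integral_centered_layer: "(\<integral>x. cdf M x - (if y \<le> x then 1 else 0) \<partial>lborel) = y - mean M"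
proof -
  interpret pair: pair_sigma_finite M lborel ..
  have meas: "(\<lambda>(y, x). layer y x) \<in> borel_measurable (M \<Otimes>\<^sub>M lborel)"
    using layer_measurable by (simp add: measurable_def space_pair_measure sets_pair_measure)
  have int_le: "integrable M (\<lambda>y. if y \<le> x then 1 else 0 :: real)" for x
    by (intro integrable_const_bound[where B = 1]) auto
  have E_le: "(\<integral>y. (if y \<le> x then 1 else 0 :: real) \<partial>M) = cdf M x" for x
  proof -
    have "(\<integral>y. (if y \<le> x then 1 else 0 :: real) \<partial>M) = (\<integral>y. indicator {..x} y \<partial>M)"
      by (intro Bochner_Integration.integral_cong) (auto simp: indicator_def)
    then show ?thesis by (simp add: cdf_def)
  qed
  have E_layer: "(\<integral>y. layer y x \<partial>M) = (if 0 \<le> x then 1 else 0) - cdf M x" for x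
    unfolding layer_def using int_le[of x] E_le[of x] prob_space by (simp del: integral_indicator)
  have E_abs: "(\<integral>\<^sup>+y. ennreal \<bar>layer y x\<bar> \<partial>M) = ennreal (tail M x)" for x
  proof -
    have abs: "\<bar>layer y x\<bar> = (if 0 \<le> x then layer y x else - layer y x)" for y
      by (auto simp: layer_def)
    have int: "integrable M (\<lambda>y. layer y x)"
      unfolding layer_def using int_le by simp
    have "(\<integral>\<^sup>+y. ennreal \<bar>layer y x\<bar> \<partial>M) = ennreal (\<integral>y. \<bar>layer y x\<bar> \<partial>M)"
      using int by (intro nn_integral_eq_integral integrable_abs) auto
    also have "(\<integral>y. \<bar>layer y x\<bar> \<partial>M) = (if 0 \<le> x then (\<integral>y. layer y x \<partial>M) else - (\<integral>y. layer y x \<partial>M))"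
      unfolding abs by simp
    also have "\<dots> = tail M x" by (simp add: E_layer tail_def)
    finally show ?thesis .
  qed
  have "(\<integral>\<^sup>+y. ennreal \<bar>y\<bar> \<partial>M) = (\<integral>\<^sup>+y. \<integral>\<^sup>+x. ennreal \<bar>layer y x\<bar> \<partial>lborel \<partial>M)"
    by (simp add: nn_integral_abs_layer)
  also have "\<dots> = (\<integral>\<^sup>+x. \<integral>\<^sup>+y. ennreal \<bar>layer y x\<bar> \<partial>M \<partial>lborel)"
    by (rule pair.Fubini'[symmetric]) (use meas in measurable)
  also have "\<dots> = (\<integral>\<^sup>+x. ennreal (tail M x) \<partial>lborel)" by (simp add: E_abs)
  also have "\<dots> < \<infinity>" by (rule nn_integral_tail_finite[OF assms])
  finally show int: "integrable M (\<lambda>y. y)" by (simp add: integrable_iff_bounded)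
  have abs_int: "(\<integral>x. norm (layer y x) \<partial>lborel) = \<bar>y\<bar>" for y
    using nn_integral_abs_layer[of y] integrable_layer[of y] by (simp add: integral_eq_nn_integral)
  have int2: "integrable (M \<Otimes>\<^sub>M lborel) (\<lambda>(y, x). layer y x)"
  proof (rule pair.Fubini_integrable[OF meas])
    show "integrable M (\<lambda>y. \<integral>x. norm (case (y, x) of (y, x) \<Rightarrow> layer y x) \<partial>lborel)"
      using int by (simp add: abs_int del: real_norm_def)
    show "AE y in M. integrable lborel (\<lambda>x. case (y, x) of (y, x) \<Rightarrow> layer y x)"
      by (simp add: integrable_layer)
  qed
  have mean_int: "integrable lborel (\<lambda>x. (if 0 \<le> x then 1 else 0) - cdf M x)"
    using pair.integrable_snd[OF int2] by (simp add: E_layer)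
  have mean: "(\<integral>x. (if 0 \<le> x then 1 else 0) - cdf M x \<partial>lborel) = mean M"
    using pair.Fubini_integral[OF int2] by (simp add: E_layer integral_layer mean_def)
  have eq: "cdf M x - (if y \<le> x then 1 else 0) = layer y x - ((if 0 \<le> x then 1 else 0) - cdf M x)" for x
    by (simp add: layer_def)
  show "integrable lborel (\<lambda>x. cdf M x - (if y \<le> x then 1 else 0))"
    unfolding eq using integrable_layer mean_int by (rule Bochner_Integration.integrable_diff)
  show "(\<integral>x. cdf M x - (if y \<le> x then 1 else 0) \<partial>lborel) = y - mean M"
    unfolding eq by (subst Bochner_Integration.integral_diff[OF integrable_layer mean_int])
      (simp add: integral_layer mean)
qed


section \<open>Passage times of independent weights with deterministic row distributions\<close>

lemma last_passage_mono:
  assumes "\<And>i j. i \<le> n \<Longrightarrow> j \<le> m \<Longrightarrow> x (i, j) \<le> y (i, j)"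
  shows "last_passage x n m \<le> last_passage y n m"
proof -
  obtain p where p: "p \<in> lattice_paths n m" "last_passage x n m = (\<Sum>z\<leftarrow>butlast p. x z)"
    by (rule last_passage_attained)
  have "(\<Sum>z\<leftarrow>butlast p. x z) \<le> (\<Sum>z\<leftarrow>butlast p. y z)"
    using lattice_paths_subset_box[OF p(1)] assms by (intro sum_list_mono) (auto dest!: in_set_butlastD)
  also have "\<dots> \<le> last_passage y n m" by (rule last_passage_ge[OF p(1)])
  finally show ?thesis using p(2) by simp
qed

lemma last_passage_const: "last_passage (\<lambda>_. c) n m = real (n + m) * c"
proof -
  obtain p where p: "p \<in> lattice_paths n m" "last_passage (\<lambda>_. c) n m = (\<Sum>z\<leftarrow>butlast p. c)"
    by (rule last_passage_attained)
  then show ?thesis using lattice_paths_length[OF p(1)] by (simp add: sum_list_triv)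
qed

lemma last_passage_measurable:
  assumes "\<And>z. z \<in> {..n} \<times> {..m} \<Longrightarrow> (\<lambda>\<omega>. f \<omega> z) \<in> borel_measurable N"
  shows "(\<lambda>\<omega>. last_passage (f \<omega>) n m) \<in> borel_measurable N"
proof -
  have eq: "last_passage (f \<omega>) n m = Max ((\<lambda>p. \<Sum>z\<in>set (butlast p). f \<omega> z) ` lattice_paths n m)" for \<omega>
    unfolding last_passage_def
    by (intro arg_cong[where f = Max] image_cong refl sum_list_distinct_conv_sum_set distinct_butlast
      lattice_paths_distinct)
  show ?thesis
    unfolding eq
  proof (intro borel_measurable_Max borel_measurable_sum assms)
    show "z \<in> {..n} \<times> {..m}" if "p \<in> lattice_paths n m" "z \<in> set (butlast p)" for p z
      using lattice_paths_subset_box[OF that(1)] that(2) by (auto dest!: in_set_butlastD)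
  qed simp
qed

locale row_product =
  fixes w :: "nat \<Rightarrow> real measure" and n m :: nat
  assumes row_distribution: "\<And>j. real_distribution (w j)"
begin

definition box :: "(nat \<times> nat) set" where "box = {..n} \<times> {..m}"

definition Q :: "(nat \<times> nat \<Rightarrow> real) measure" where
  "Q = Pi\<^sub>M box (\<lambda>z. w (snd z))"

lemma prob_space_row: "prob_space (w j)"
  using row_distribution[of j] by (simp add: real_distribution_def)

lemma sets_row [simp, measurable_cong]: "sets (w j) = sets borel"
  using row_distribution[of j] by (simp add: real_distribution_def real_distribution_axioms_def)

sublocale prob_space Q
  unfolding Q_def by (intro prob_space_PiM prob_space_row)

lemma coord_measurable: "z \<in> box \<Longrightarrow> (\<lambda>\<omega>. \<omega> z) \<in> borel_measurable Q"
  using measurable_component_singleton[of z box "\<lambda>z. w (snd z)"]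
  by (simp add: Q_def cong: measurable_cong_sets)

lemma distr_coord: "z \<in> box \<Longrightarrow> distr Q borel (\<lambda>\<omega>. \<omega> z) = w (snd z)"
  using distr_PiM_component[of box "\<lambda>z. w (snd z)" z] prob_space_row
  by (simp add: Q_def cong: distr_cong)

lemma indep_coords: "indep_vars (\<lambda>_. borel) (\<lambda>z \<omega>. \<omega> z) box"
proof -
  have ne: "box \<noteq> {}" by (auto simp: box_def)
  have "distr Q (Pi\<^sub>M box (\<lambda>_. borel)) (\<lambda>x. \<lambda>z\<in>box. x z) = distr Q Q (\<lambda>x. x)"
  proof (rule distr_cong)
    show "sets (Pi\<^sub>M box (\<lambda>_. borel)) = sets Q"
      unfolding Q_def by (intro sets_PiM_cong) auto
    show "(\<lambda>z\<in>box. x z) = x" if "x \<in> space Q" for x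
      using that by (auto simp: Q_def space_PiM PiE_def extensional_restrict)
  qed simp
  also have "\<dots> = Pi\<^sub>M box (\<lambda>z. distr Q borel (\<lambda>\<omega>. \<omega> z))"
    unfolding distr_id Q_def[symmetric] by (subst Q_def, intro PiM_cong) (auto simp: distr_coord)
  finally show ?thesis
    using ne coord_measurable by (subst indep_vars_iff_distr_eq_PiM') auto
qed

lemma finite_box [simp]: "finite box" by (simp add: box_def)

lemma integral_coord:
  assumes "z \<in> box" "f \<in> borel_measurable borel"
  shows "expectation (\<lambda>\<omega>. f (\<omega> z) :: real) = (\<integral>y. f y \<partial>w (snd z))"
  using assms coord_measurable by (subst distr_coord[symmetric]) (auto simp: integral_distr)

lemma integrable_coord:
  fixes f :: "real \<Rightarrow> real"
  assumes "z \<in> box" "f \<in> borel_measurable borel" "integrable (w (snd z)) f"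
  shows "integrable Q (\<lambda>\<omega>. f (\<omega> z))"
  using assms integrable_distr[OF coord_measurable[OF assms(1)], of f] by (simp add: distr_coord)

text \<open>The sign makes the integral over \<open>x\<close> equal to \<open>\<omega> z\<close>
  minus the mean of its row, so large weights count positively.\<close>

definition clayer :: "real \<Rightarrow> (nat \<times> nat \<Rightarrow> real) \<Rightarrow> nat \<times> nat \<Rightarrow> real" where
  "clayer x \<omega> z = cdf (w (snd z)) x - (if \<omega> z \<le> x then 1 else 0)"

lemma cdf_row_bounds: "0 \<le> cdf (w j) x" "cdf (w j) x \<le> 1"
proof -
  interpret row: real_distribution "w j" by (rule row_distribution)
  show "0 \<le> cdf (w j) x" "cdf (w j) x \<le> 1" using row.cdf_nonneg row.cdf_bounded_prob by auto
qed

lemma expectation_le_indicator: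
  assumes "z \<in> box"
  shows "expectation (\<lambda>\<omega>. if \<omega> z \<le> x then 1 else 0 :: real) = cdf (w (snd z)) x"
proof -
  have "expectation (\<lambda>\<omega>. if \<omega> z \<le> x then 1 else 0 :: real) = (\<integral>y. indicator {..x} y \<partial>w (snd z))"
    by (subst integral_coord[OF assms, symmetric])
      (auto intro!: Bochner_Integration.integral_cong simp: indicator_def)
  then show ?thesis by (simp add: cdf_def)
qed

text \<open>The dense case is applied to the centered field itself. In the sparse case cancellation
  is not exploited: positive levels are compared with a nonnegative indicator field, negative levels
  with a constant.\<close>

lemma nn_integral_layer_passage_le:
  assumes p: "\<And>j. tail (w j) x \<le> p" and mn: "m \<le> n"
  shows "(\<integral>\<^sup>+\<omega>. ennreal (last_passage (clayer x \<omega>) n m) \<partial>Q)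
    \<le> ennreal (36 * sqrt (p * real (Suc n) * real (Suc m)))"
proof -
  have p0: "0 \<le> p"
    using p[of 0] cdf_row_bounds[of 0 x] by (auto simp: tail_def split: if_splits)
  have int: "integrable Q (\<lambda>\<omega>. if \<omega> z \<le> x then 1 else 0 :: real)" if "z \<in> box" for z
    using coord_measurable[OF that] by (intro integrable_const_bound[where B = 1]) auto
  show ?thesis
  proof (cases "p * real (Suc n) \<le> real (Suc m)")
    case False
    define \<zeta> where "\<zeta> z \<omega> = clayer x \<omega> z" for z \<omega>
    have "(\<integral>\<^sup>+\<omega>. ennreal (last_passage (\<lambda>z. \<zeta> z \<omega>) n m) \<partial>Q)
      \<le> ennreal (20 * sqrt (p * real (Suc n) * real (Suc m)))"
    proof (rule nn_integral_last_passage_dense_le)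
      show "indep_vars (\<lambda>_. borel) \<zeta> ({..n} \<times> {..m})"
        unfolding \<zeta>_def clayer_def box_def[symmetric] by (rule indep_vars_compose2[OF indep_coords]) measurable
      show "\<bar>\<zeta> z \<omega>\<bar> \<le> 1" for z \<omega>
        unfolding \<zeta>_def clayer_def using cdf_row_bounds[of "snd z" x] by auto
      fix z assume "z \<in> {..n} \<times> {..m}"
      then have z: "z \<in> box" by (simp add: box_def)
      show "expectation (\<zeta> z) = 0"
        unfolding \<zeta>_def clayer_def using int[OF z] expectation_le_indicator[OF z, of x] prob_space by simp
      let ?F = "cdf (w (snd z)) x"
      have "(\<zeta> z \<omega>)\<^sup>2 = ?F\<^sup>2 + (1 - 2 * ?F) * (if \<omega> z \<le> x then 1 else 0)" for \<omega>
        by (simp add: \<zeta>_def clayer_def power2_eq_square algebra_simps)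
      then have "expectation (\<lambda>\<omega>. (\<zeta> z \<omega>)\<^sup>2) = ?F\<^sup>2 + (1 - 2 * ?F) * ?F"
        using int[OF z] expectation_le_indicator[OF z, of x] prob_space by simp
      also have "\<dots> = ?F * (1 - ?F)" by (simp add: power2_eq_square algebra_simps)
      also have "\<dots> \<le> tail (w (snd z)) x"
        using cdf_row_bounds[of "snd z" x] by (auto simp: tail_def mult_left_le mult_left_le_one_le)
      also have "\<dots> \<le> p" by (rule p)
      finally show "expectation (\<lambda>\<omega>. (\<zeta> z \<omega>)\<^sup>2) \<le> p" .
    qed (use False mn in auto)
    also have "\<dots> \<le> ennreal (36 * sqrt (p * real (Suc n) * real (Suc m)))"
      using p0 by (intro ennreal_leI mult_right_mono) auto
    finally show ?thesis by (simp add: \<zeta>_def)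
  next
    case sparse: True
    show ?thesis
    proof (cases "0 \<le> x")
      case True
      \<comment> \<open>Dropping the centering only raises the passage time and leaves the indicator
        of \<open>x < \<omega> z\<close>, whose mean is the tail.\<close>
      define \<xi> where "\<xi> z \<omega> = 1 - (if \<omega> z \<le> x then 1 else 0 :: real)" for z and \<omega> :: "nat \<times> nat \<Rightarrow> real"
      have "(\<integral>\<^sup>+\<omega>. ennreal (last_passage (clayer x \<omega>) n m) \<partial>Q)
         \<le> (\<integral>\<^sup>+\<omega>. ennreal (last_passage (\<lambda>z. \<xi> z \<omega>) n m) \<partial>Q)"
        using cdf_row_bounds
        by (intro nn_integral_mono ennreal_leI last_passage_mono) (auto simp: \<xi>_def clayer_def)
      also have "\<dots> \<le> ennreal (36 * sqrt (p * real (Suc n) * real (Suc m)))"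
      proof (rule nn_integral_last_passage_sparse_le)
        show "indep_vars (\<lambda>_. borel) \<xi> ({..n} \<times> {..m})"
          unfolding \<xi>_def box_def[symmetric] by (rule indep_vars_compose2[OF indep_coords]) measurable
        show "expectation (\<xi> z) \<le> p" if "z \<in> {..n} \<times> {..m}" for z
        proof -
          have z: "z \<in> box" using that by (simp add: box_def)
          have "expectation (\<xi> z) = 1 - cdf (w (snd z)) x"
            unfolding \<xi>_def using int[OF z] expectation_le_indicator[OF z, of x] prob_space by simp
          then show ?thesis using p[of "snd z"] True by (simp add: tail_def)
        qed
      qed (use sparse mn p0 in \<open>auto simp: \<xi>_def\<close>)
      finally show ?thesis .
    next
      case False
      \<comment> \<open>At negative levels each weight is at most the cdf, hence at most
        \<open>p\<close>, so a path collects at most \<open>(n + m) * p\<close>. Sparsity turns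
        \<open>p * Suc n\<close> into the required square root.\<close>
      have "last_passage (clayer x \<omega>) n m \<le> 36 * sqrt (p * real (Suc n) * real (Suc m))" for \<omega>
      proof -
        have "clayer x \<omega> z \<le> p" for z
          using False p[of "snd z"] p0 by (auto simp: clayer_def tail_def)
        then have "last_passage (clayer x \<omega>) n m \<le> last_passage (\<lambda>_. p) n m"
          by (intro last_passage_mono) auto
        also have "\<dots> = real (n + m) * p" by (rule last_passage_const)
        also have "\<dots> \<le> 2 * (p * real (Suc n))"
          using mn p0 mult_right_mono[of "real (n + m)" "2 * real (Suc n)" p] by (simp add: algebra_simps)
        also have "p * real (Suc n) \<le> sqrt (p * real (Suc n) * real (Suc m))"
          using sparse p0 by (intro real_le_rsqrt) (auto simp: power2_eq_square intro!: mult_left_mono)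
        finally show ?thesis using p0 by (smt (verit) real_sqrt_ge_zero mult_nonneg_nonneg of_nat_0_le_iff)
      qed
      then have "(\<integral>\<^sup>+\<omega>. ennreal (last_passage (clayer x \<omega>) n m) \<partial>Q)
         \<le> (\<integral>\<^sup>+\<omega>. ennreal (36 * sqrt (p * real (Suc n) * real (Suc m))) \<partial>Q)"
        by (intro nn_integral_mono ennreal_leI) auto
      then show ?thesis by (simp add: emeasure_space_1)
    qed
  qed
qed

text \<open>A maximizing path is the same for all levels; bounding its sum at each level by the
  passage time of that level alone decouples the levels, and Fubini reduces the claim to the bound
  for a single level. The levels are weighted by \<open>sqrt (p x)\<close>, whence the hypothesis on
  square roots of tails.\<close>

lemma nn_integral_passage_excess_le:
  assumes tails: "\<And>j. sqrt_tails_finite (w j)" and mean: "\<And>j. mean (w j) \<le> \<mu>" and mn: "m \<le> n"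
    and p: "\<And>j x. tail (w j) x \<le> p x" and [measurable]: "p \<in> borel_measurable borel"
  shows "(\<integral>\<^sup>+\<omega>. ennreal (last_passage \<omega> n m - real (n + m) * \<mu>) \<partial>Q)
    \<le> (\<integral>\<^sup>+x. ennreal (sqrt (p x)) \<partial>lborel) * ennreal (36 * sqrt (real (Suc n) * real (Suc m)))"
proof -
  have le: "ennreal (last_passage \<omega> n m - real (n + m) * \<mu>)
     \<le> (\<integral>\<^sup>+x. ennreal (last_passage (clayer x \<omega>) n m) \<partial>lborel)" for \<omega>
  proof -
    obtain q where q: "q \<in> lattice_paths n m" "last_passage \<omega> n m = (\<Sum>z\<leftarrow>butlast q. \<omega> z)"
      by (rule last_passage_attained)
    have dist: "distinct (butlast q)" by (intro distinct_butlast lattice_paths_distinct[OF q(1)])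
    let ?S = "set (butlast q)"
    have int: "integrable lborel (\<lambda>x. clayer x \<omega> z)" for z
      unfolding clayer_def using real_distribution.integrable_centered_layer[OF row_distribution tails] .
    have "real (n + m) * \<mu> = (\<Sum>z\<in>?S. \<mu>)"
      using lattice_paths_length[OF q(1)] distinct_card[OF dist] by simp
    also have "\<dots> \<ge> (\<Sum>z\<in>?S. mean (w (snd z)))" using mean by (intro sum_mono) auto
    finally have "last_passage \<omega> n m - real (n + m) * \<mu> \<le> (\<Sum>z\<in>?S. \<omega> z - mean (w (snd z)))"
      using q(2) dist by (simp add: sum_list_distinct_conv_sum_set sum_subtractf)
    also have "\<dots> = (\<Sum>z\<in>?S. \<integral>x. clayer x \<omega> z \<partial>lborel)"
      unfolding clayer_def
      using real_distribution.integral_centered_layer[OF row_distribution tails] by simp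
    also have "\<dots> = (\<integral>x. (\<Sum>z\<in>?S. clayer x \<omega> z) \<partial>lborel)"
      using int by (simp add: Bochner_Integration.integral_sum)
    finally have "ennreal (last_passage \<omega> n m - real (n + m) * \<mu>)
        \<le> ennreal (\<integral>x. (\<Sum>z\<in>?S. clayer x \<omega> z) \<partial>lborel)"
      by (rule ennreal_leI)
    also have "\<dots> \<le> ennreal (\<integral>x. max 0 (\<Sum>z\<in>?S. clayer x \<omega> z) \<partial>lborel)"
      using int by (intro ennreal_leI integral_mono integrable_max Bochner_Integration.integrable_sum) auto
    also have "\<dots> = (\<integral>\<^sup>+x. ennreal (max 0 (\<Sum>z\<in>?S. clayer x \<omega> z)) \<partial>lborel)"
      using int by (intro nn_integral_eq_integral[symmetric] integrable_max Bochner_Integration.integrable_sum) auto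
    also have "\<dots> \<le> (\<integral>\<^sup>+x. ennreal (last_passage (clayer x \<omega>) n m) \<partial>lborel)"
    proof (intro nn_integral_mono)
      fix x
      have "(\<Sum>z\<in>?S. clayer x \<omega> z) \<le> last_passage (clayer x \<omega>) n m"
        using last_passage_ge[OF q(1), of "clayer x \<omega>"] dist by (simp add: sum_list_distinct_conv_sum_set)
      then show "ennreal (max 0 (\<Sum>z\<in>?S. clayer x \<omega> z)) \<le> ennreal (last_passage (clayer x \<omega>) n m)"
        by (cases "0 \<le> (\<Sum>z\<in>?S. clayer x \<omega> z)") (auto intro: ennreal_leI simp: max_def)
    qed
    finally show ?thesis .
  qed
  interpret pair: pair_sigma_finite lborel Q ..
  have cdf_m [measurable]: "cdf (w j) \<in> borel_measurable borel" for j
    using real_distribution.cdf_measurable[OF row_distribution] .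
  have meas: "(\<lambda>(x, \<omega>). ennreal (last_passage (clayer x \<omega>) n m)) \<in> borel_measurable (lborel \<Otimes>\<^sub>M Q)"
    unfolding split_beta
  proof (intro measurable_compose[OF _ measurable_ennreal] last_passage_measurable)
    fix z assume "z \<in> {..n} \<times> {..m}"
    then have [measurable]: "(\<lambda>\<omega>. \<omega> z) \<in> borel_measurable Q" by (intro coord_measurable) (simp add: box_def)
    show "(\<lambda>y. clayer (fst y) (snd y) z) \<in> borel_measurable (lborel \<Otimes>\<^sub>M Q)"
      unfolding clayer_def by measurable
  qed
  have "(\<integral>\<^sup>+\<omega>. ennreal (last_passage \<omega> n m - real (n + m) * \<mu>) \<partial>Q)
    \<le> (\<integral>\<^sup>+\<omega>. \<integral>\<^sup>+x. ennreal (last_passage (clayer x \<omega>) n m) \<partial>lborel \<partial>Q)"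
    by (intro nn_integral_mono le)
  also have "\<dots> = (\<integral>\<^sup>+x. \<integral>\<^sup>+\<omega>. ennreal (last_passage (clayer x \<omega>) n m) \<partial>Q \<partial>lborel)"
    by (rule pair.Fubini'[OF meas])
  also have "\<dots> \<le> (\<integral>\<^sup>+x. ennreal (36 * sqrt (p x * real (Suc n) * real (Suc m))) \<partial>lborel)"
    by (intro nn_integral_mono nn_integral_layer_passage_le p mn)
  also have "\<dots> = (\<integral>\<^sup>+x. ennreal (sqrt (p x)) * ennreal (36 * sqrt (real (Suc n) * real (Suc m))) \<partial>lborel)"
  proof (intro nn_integral_cong)
    fix x
    have "0 \<le> p x" using p[of 0 x] cdf_row_bounds[of 0 x] by (auto simp: tail_def split: if_splits)
    then show "ennreal (36 * sqrt (p x * real (Suc n) * real (Suc m)))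
       = ennreal (sqrt (p x)) * ennreal (36 * sqrt (real (Suc n) * real (Suc m)))"
      by (simp add: real_sqrt_mult mult_ac flip: ennreal_mult)
  qed
  also have "\<dots> = (\<integral>\<^sup>+x. ennreal (sqrt (p x)) \<partial>lborel) * ennreal (36 * sqrt (real (Suc n) * real (Suc m)))"
    by (intro nn_integral_multc) auto
  finally show ?thesis .
qed

end

section \<open>The gain from choosing between two rows\<close>

text \<open>The bound \<open>cos \<ge> 1 / 2\<close> on the unit interval, integrated twice.\<close>

lemma one_minus_cos_ge:
  fixes u :: real
  assumes "\<bar>u\<bar> \<le> 1"
  shows "u\<^sup>2 / 4 \<le> 1 - cos u"
proof -
  have cos_ge: "1 / 2 \<le> cos v" if "0 \<le> v" "v \<le> 1" for v :: real
  proof -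
    have "cos (pi / 3) \<le> cos v" using that pi_gt3 by (intro cos_monotone_0_pi_le) auto
    then show ?thesis by (simp add: cos_60)
  qed
  have sin_ge: "v / 2 \<le> sin v" if v: "0 \<le> v" "v \<le> 1" for v :: real
  proof -
    have "sin 0 - 0 / 2 \<le> sin v - v / 2"
    proof (rule DERIV_nonneg_imp_nondecreasing[OF v(1), where f = "\<lambda>v. sin v - v / 2"])
      fix x assume "0 \<le> x" "x \<le> v"
      then show "\<exists>y. DERIV (\<lambda>v. sin v - v / 2) x :> y \<and> 0 \<le> y"
        using v cos_ge[of x] by (intro exI[of _ "cos x - 1 / 2"]) (auto intro!: derivative_eq_intros)
    qed
    then show ?thesis by simp
  qed
  have pos: "v\<^sup>2 / 4 \<le> 1 - cos v" if v: "0 \<le> v" "v \<le> 1" for v :: real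
  proof -
    have "1 - cos 0 - 0\<^sup>2 / 4 \<le> 1 - cos v - v\<^sup>2 / 4"
    proof (rule DERIV_nonneg_imp_nondecreasing[OF v(1), where f = "\<lambda>v. 1 - cos v - v\<^sup>2 / 4"])
      fix x assume "0 \<le> x" "x \<le> v"
      then show "\<exists>y. DERIV (\<lambda>v. 1 - cos v - v\<^sup>2 / 4) x :> y \<and> 0 \<le> y"
        using v sin_ge[of x] by (intro exI[of _ "sin x - x / 2"]) (auto intro!: derivative_eq_intros)
    qed
    then show ?thesis by simp
  qed
  show ?thesis using pos[of "\<bar>u\<bar>"] assms by (cases "0 \<le> u") auto
qed

text \<open>Without such a pair, a positive value of the cdf at \<open>a\<close> forces the value 1
  at every point to the right of \<open>a\<close>. The cdf then jumps from 0 to 1 at the infimum of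
  its positivity set, which is a point mass.\<close>

lemma (in real_distribution) nondegenerate_split:
  assumes "\<not> degenerate M"
  obtains a b where "a < b" "0 < measure M {..a}" "0 < measure M {b..}"
proof -
  have "\<exists>a b. a < b \<and> 0 < measure M {..a} \<and> 0 < measure M {b..}"
  proof (rule ccontr)
    assume "\<not> ?thesis"
    then have H: "measure M {b..} = 0" if "a < b" "0 < measure M {..a}" for a b
      using that zero_less_measure_iff[of M "{b..}"] by auto
    define S where "S = {x. 0 < cdf M x}"
    have "eventually (\<lambda>x. 0 < cdf M x) at_top"
      using order_tendstoD(1)[OF cdf_lim_at_top_prob, of 0] by simp
    then obtain a0 where a0: "a0 \<in> S" by (auto simp: S_def eventually_at_top_linorder)
    have cdf1: "cdf M x = 1" if "a \<in> S" "a < x" for a x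
    proof -
      have "measure M {x<..} \<le> measure M {x..}" by (intro finite_measure_mono) auto
      then have "measure M {x<..} = 0" using H[of a x] that by (simp add: S_def cdf_def measure_le_0_iff)
      moreover have "{x<..} = UNIV - {..x}" by auto
      ultimately show ?thesis using prob_compl[of "{..x}"] by (simp add: cdf_def)
    qed
    have bdd: "bdd_below S"
    proof (rule ccontr)
      assume nb: "\<not> bdd_below S"
      have "cdf M x = 1" for x
      proof -
        obtain a where "a \<in> S" "a < x" using nb by (auto simp: bdd_below_def not_le)
        then show ?thesis by (rule cdf1)
      qed
      then have "cdf M = (\<lambda>_. 1)" by auto
      then have "((\<lambda>x. 1 :: real) \<longlongrightarrow> 0) (at_bot :: real filter)"
        using cdf_lim_at_bot by simp
      then show False by (simp add: tendsto_const_iff)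
    qed
    define q where "q = Inf S"
    have above: "cdf M x = 1" if "q < x" for x
    proof -
      have "S \<noteq> {}" using a0 by auto
      then have "\<exists>a\<in>S. a < x"
        using cInf_less_iff[OF _ bdd, of x] that by (simp add: q_def)
      then obtain a where "a \<in> S" "a < x" by blast
      then show ?thesis by (rule cdf1)
    qed
    have below: "cdf M x = 0" if "x < q" for x
    proof -
      have "x \<notin> S" using that bdd cInf_lower[of x S] by (auto simp: q_def)
      then show ?thesis using cdf_nonneg[of x] by (simp add: S_def)
    qed
    have at_q: "cdf M q = 1"
    proof -
      have "(cdf M \<longlongrightarrow> cdf M q) (at_right q)"
        using cdf_is_right_cont[of q] by (simp add: continuous_within)
      moreover have "(cdf M \<longlongrightarrow> 1) (at_right q)"
        by (rule tendsto_eventually) (auto simp: eventually_at_right_field above intro!: exI[of _ "q + 1"])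
      ultimately show ?thesis by (intro tendsto_unique[of "at_right q"]) auto
    qed
    have "real_distribution (return borel q)"
      unfolding real_distribution_def real_distribution_axioms_def by (simp add: prob_space_return)
    moreover have "cdf M = cdf (return borel q)"
    proof
      fix x
      show "cdf M x = cdf (return borel q) x"
        using above[of x] below[of x] at_q
        by (cases x q rule: linorder_cases) (auto simp: cdf_def measure_return)
    qed
    ultimately have "M = return borel q"
      by (intro cdf_unique real_distribution_axioms)
    then show False using assms by (auto simp: degenerate_def)
  qed
  then show ?thesis using that by blast
qed

text \<open>The squared modulus is the expectation of \<open>cos (t * (Y - X))\<close> for
  independent copies. With positive probability the copies fall into \<open>A\<close> and
  \<open>B\<close>, at distance at least \<open>b - a\<close>; truncation at \<open>K\<close> keeps
  the angle within the range of the quadratic bound.\<close>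

lemma (in real_distribution) norm_char_square_le:
  assumes "\<not> degenerate M"
  obtains c t0 where "0 < c" "0 < t0" "\<And>t. 0 < t \<Longrightarrow> t \<le> t0 \<Longrightarrow> (norm (char M t))\<^sup>2 \<le> 1 - c * t\<^sup>2"
proof -
  obtain a b where ab: "a < b" "0 < measure M {..a}" "0 < measure M {b..}"
    by (rule nondegenerate_split[OF assms])
  have limA: "(\<lambda>k. measure M {- real k..a}) \<longlonglongrightarrow> measure M (\<Union>k. {- real k..a})"
    by (rule finite_Lim_measure_incseq) (auto simp: incseq_def)
  have "(\<Union>k. {- real k..a}) = {..a}"
    using real_arch_simple by (auto simp: minus_le_iff)
  then have "eventually (\<lambda>k. 0 < measure M {- real k..a}) sequentially"
    using order_tendstoD(1)[OF limA, of 0] ab by simp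
  moreover have limB: "(\<lambda>k. measure M {b..real k}) \<longlonglongrightarrow> measure M (\<Union>k. {b..real k})"
    by (rule finite_Lim_measure_incseq) (auto simp: incseq_def)
  have "(\<Union>k. {b..real k}) = {b..}"
    using real_arch_simple by auto
  then have "eventually (\<lambda>k. 0 < measure M {b..real k}) sequentially"
    using order_tendstoD(1)[OF limB, of 0] ab by simp
  ultimately have "eventually (\<lambda>k. 0 < measure M {- real k..a} \<and> 0 < measure M {b..real k}) sequentially"
    by (rule eventually_conj)
  then obtain k0 where k0: "\<And>k. k0 \<le> k \<Longrightarrow> 0 < measure M {- real k..a} \<and> 0 < measure M {b..real k}"
    by (auto simp: eventually_sequentially)
  define K where "K = real (Suc k0)"
  define A where "A = {- K..a}"
  define B where "B = {b..K}"
  have AB: "0 < measure M A" "0 < measure M B" "0 < K" using k0[of "Suc k0"] by (auto simp: K_def A_def B_def)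
  define c where "c = measure M A * measure M B * (b - a)\<^sup>2 / 4"
  \<comment> \<open>Points of \<open>A\<close> and \<open>B\<close> are at distance at most
    \<open>2 * K\<close>, so this keeps the angle at most 1.\<close>
  define t0 where "t0 = 1 / (2 * K)"
  show ?thesis
  proof (rule that)
    show "0 < c" using AB ab by (simp add: c_def)
    show "0 < t0" using AB by (simp add: t0_def)
    fix t assume t: "0 < t" "t \<le> t0"
    let ?C = "\<integral>x. cos (t * x) \<partial>M" and ?S = "\<integral>x. sin (t * x) \<partial>M"
    have [simp]: "integrable M (\<lambda>x. cos (t * x))" "integrable M (\<lambda>x. sin (t * x))"
      by (auto intro!: integrable_const_bound[where B = 1])
    have Re: "Re (char M t) = ?C" and Im: "Im (char M t) = ?S"
    proof -
      have int: "complex_integrable M (\<lambda>x. iexp (t * x))"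
        by (intro integrable_const_bound[where B = 1]) auto
      show "Re (char M t) = ?C"
        unfolding char_def by (subst integral_Re[OF int, symmetric]) (simp add: Re_exp)
      show "Im (char M t) = ?S"
        unfolding char_def by (subst integral_Im[OF int, symmetric]) (simp add: Im_exp)
    qed
    \<comment> \<open>The second copy is integrated out first; integrating the result over
      \<open>x\<close> then gives 1 minus the squared modulus.\<close>
    have inner: "(\<integral>y. 1 - cos (t * (y - x)) \<partial>M) = 1 - (cos (t * x) * ?C + sin (t * x) * ?S)" for x
    proof -
      have "(\<integral>y. 1 - cos (t * (y - x)) \<partial>M) = (\<integral>y. 1 - (cos (t * x) * cos (t * y) + sin (t * x) * sin (t * y)) \<partial>M)"
        by (simp add: right_diff_distrib cos_diff mult.commute)
      also have "\<dots> = 1 - (cos (t * x) * ?C + sin (t * x) * ?S)"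
        using prob_space by simp
      finally show ?thesis .
    qed
    have lower: "measure M B * (t\<^sup>2 * (b - a)\<^sup>2 / 4) * indicator A x \<le> (\<integral>y. 1 - cos (t * (y - x)) \<partial>M)" for x
    proof (cases "x \<in> A")
      case True
      have "(t\<^sup>2 * (b - a)\<^sup>2 / 4) * indicator B y \<le> 1 - cos (t * (y - x))" for y
      proof (cases "y \<in> B")
        case y: True
        have "\<bar>t * (y - x)\<bar> \<le> t0 * (2 * K)"
          unfolding abs_mult using t True y ab by (intro mult_mono) (auto simp: A_def B_def)
        also have "\<dots> = 1" using AB by (simp add: t0_def)
        finally have "(t * (y - x))\<^sup>2 / 4 \<le> 1 - cos (t * (y - x))" by (rule one_minus_cos_ge)
        moreover have "(b - a)\<^sup>2 \<le> (y - x)\<^sup>2"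
          using True y ab by (intro power_mono) (auto simp: A_def B_def)
        then have "t\<^sup>2 * (b - a)\<^sup>2 \<le> t\<^sup>2 * (y - x)\<^sup>2" by (intro mult_left_mono) auto
        ultimately show ?thesis using y by (simp add: power_mult_distrib)
      qed simp
      then have "(\<integral>y. (t\<^sup>2 * (b - a)\<^sup>2 / 4) * indicator B y \<partial>M) \<le> (\<integral>y. 1 - cos (t * (y - x)) \<partial>M)"
        by (intro integral_mono Bochner_Integration.integrable_diff integrable_const
          integrable_const_bound[where B = 1 and f = "\<lambda>y. cos (t * (y - x))"]
          integrable_mult_right integrable_real_indicator) (auto simp: B_def less_top[symmetric])
      then show ?thesis using True by (simp add: B_def mult.commute)
    next
      case False
      have "0 \<le> (\<integral>y. 1 - cos (t * (y - x)) \<partial>M)"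
        by (intro Bochner_Integration.integral_nonneg) simp
      then show ?thesis using False by simp
    qed
    have "c * t\<^sup>2 = (\<integral>x. measure M B * (t\<^sup>2 * (b - a)\<^sup>2 / 4) * indicator A x \<partial>M)"
      by (simp add: c_def A_def)
    also have "\<dots> \<le> (\<integral>x. 1 - (cos (t * x) * ?C + sin (t * x) * ?S) \<partial>M)"
      using lower unfolding inner
      by (intro integral_mono integrable_mult_right integrable_real_indicator Bochner_Integration.integrable_diff
        Bochner_Integration.integrable_add integrable_mult_left integrable_const)
        (auto simp: A_def less_top[symmetric])
    also have "\<dots> = 1 - (?C * ?C + ?S * ?S)" using prob_space by simp
    also have "?C * ?C + ?S * ?S = (norm (char M t))\<^sup>2"
      unfolding cmod_power2 Re Im by (simp add: power2_eq_square)
    finally show "(norm (char M t))\<^sup>2 \<le> 1 - c * t\<^sup>2" by simp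
  qed
qed

lemma (in prob_space) norm_char_distr_uminus:
  fixes X :: "'a \<Rightarrow> real"
  assumes [measurable]: "X \<in> borel_measurable M"
  shows "norm (char (distr M borel (\<lambda>\<omega>. - X \<omega>)) t) = norm (char (distr M borel X) t)"
proof -
  have "char (distr M borel (\<lambda>\<omega>. - X \<omega>)) t = (\<integral>\<omega>. cnj (iexp (t * X \<omega>)) \<partial>M)"
    unfolding char_def by (simp add: integral_distr exp_cnj)
  also have "\<dots> = cnj (char (distr M borel X) t)"
    unfolding char_def by (simp add: integral_distr integral_cnj)
  finally show ?thesis by simp
qed

lemma (in prob_space) expectation_cos_le_norm_char:
  fixes Z :: "'a \<Rightarrow> real"
  assumes [measurable]: "Z \<in> borel_measurable M"
  shows "expectation (\<lambda>\<omega>. cos (t * Z \<omega>)) \<le> norm (char (distr M borel Z) t)"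
proof -
  have int: "complex_integrable M (\<lambda>\<omega>. iexp (t * Z \<omega>))"
    by (intro integrable_const_bound[where B = 1]) auto
  have "expectation (\<lambda>\<omega>. cos (t * Z \<omega>)) = Re (\<integral>\<omega>. iexp (t * Z \<omega>) \<partial>M)"
    by (subst integral_Re[OF int, symmetric]) (simp add: Re_exp)
  also have "(\<integral>\<omega>. iexp (t * Z \<omega>) \<partial>M) = char (distr M borel Z) t"
    unfolding char_def by (simp add: integral_distr)
  also have "Re \<dots> \<le> norm \<dots>" by (rule complex_Re_le_cmod)
  finally show ?thesis .
qed

lemma one_minus_cos_le_abs: "1 - cos u \<le> \<bar>u :: real\<bar>"
proof -
  have "1 - cos u = 2 * (sin (u / 2))\<^sup>2" using cos_double_sin[of "u / 2"] by simp
  also have "(sin (u / 2))\<^sup>2 = \<bar>sin (u / 2)\<bar> * \<bar>sin (u / 2)\<bar>" by (simp add: power2_eq_square)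
  also have "\<dots> \<le> \<bar>u / 2\<bar> * 1"
    by (intro mult_mono abs_sin_x_le_abs_x) auto
  finally show ?thesis by simp
qed

text \<open>The gain from choosing the larger of two independent copies is bounded below through
  \<open>\<bar>z\<bar> \<ge> (1 - cos (t z)) / t\<close>, whose expectation is governed by the characteristic function.\<close>

lemma (in prob_space) expectation_max_sums_ge:
  fixes X :: "'i \<Rightarrow> 'a \<Rightarrow> real"
  assumes indep: "indep_vars (\<lambda>_. borel) X (I \<union> J)" and fin: "finite I" "finite J" "I \<inter> J = {}"
    and card: "card I = B" "card J = B"
    and distr: "\<And>i. i \<in> I \<union> J \<Longrightarrow> distr M borel (X i) = H"
    and int: "\<And>i. i \<in> I \<union> J \<Longrightarrow> integrable M (X i)"
    and mean: "\<And>i. i \<in> I \<union> J \<Longrightarrow> expectation (X i) = \<mu>" and t: "0 < t"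
  shows "real B * \<mu> + (1 - ((norm (char H t))\<^sup>2) ^ B) / (2 * t)
    \<le> expectation (\<lambda>\<omega>. max (\<Sum>i\<in>I. X i \<omega>) (\<Sum>i\<in>J. X i \<omega>))"
proof -
  have meas: "X i \<in> borel_measurable M" if "i \<in> I \<union> J" for i
    using indep that by (auto simp: indep_vars_def)
  \<comment> \<open>Flipping the sign on \<open>J\<close> makes the difference of the two sums a sum
    of independent terms, and does not change the modulus of their characteristic functions.\<close>
  define Y where "Y i \<omega> = (if i \<in> I then X i \<omega> else - X i \<omega>)" for i \<omega>
  have indY: "indep_vars (\<lambda>_. borel) Y (I \<union> J)"
    unfolding Y_def
    using indep_vars_compose2[OF indep, of "\<lambda>i x. if i \<in> I then x else - x" "\<lambda>_. borel"] by simp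
  have Ym: "Y i \<in> borel_measurable M" if "i \<in> I \<union> J" for i
    using indY that by (auto simp: indep_vars_def)
  define S where "S A \<omega> = (\<Sum>i\<in>A. X i \<omega>)" for A \<omega>
  have SI: "integrable M (S I)" "integrable M (S J)"
    unfolding S_def[abs_def] using int by auto
  have ES: "expectation (S I) = B * \<mu>" "expectation (S J) = B * \<mu>"
    unfolding S_def[abs_def] using int mean card by (simp_all add: Bochner_Integration.integral_sum)
  have diff: "(\<Sum>i\<in>I \<union> J. Y i \<omega>) = S I \<omega> - S J \<omega>" for \<omega>
  proof -
    have "(\<Sum>i\<in>I. Y i \<omega>) = S I \<omega>" unfolding S_def Y_def by (intro sum.cong) auto
    moreover have "(\<Sum>i\<in>J. Y i \<omega>) = (\<Sum>i\<in>J. - X i \<omega>)" unfolding Y_def using fin by (intro sum.cong) auto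
    ultimately show ?thesis using fin by (simp add: sum.union_disjoint sum_negf S_def)
  qed
  have "norm (char (distr M borel (\<lambda>\<omega>. \<Sum>i\<in>I \<union> J. Y i \<omega>)) t) = (\<Prod>i\<in>I \<union> J. norm (char (distr M borel (Y i)) t))"
    by (subst char_distr_sum[OF indY]) (rule prod_norm[symmetric])
  also have "\<dots> = (\<Prod>i\<in>I \<union> J. norm (char H t))"
  proof (intro prod.cong refl)
    fix i assume i: "i \<in> I \<union> J"
    show "norm (char (distr M borel (Y i)) t) = norm (char H t)"
      using norm_char_distr_uminus[OF meas[OF i], of t] distr[OF i]
      by (cases "i \<in> I") (simp_all add: Y_def[abs_def])
  qed
  also have "\<dots> = ((norm (char H t))\<^sup>2) ^ B"
    using fin card by (simp add: card_Un_disjoint power_add power2_eq_square power_mult_distrib)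
  finally have "expectation (\<lambda>\<omega>. cos (t * (S I \<omega> - S J \<omega>))) \<le> ((norm (char H t))\<^sup>2) ^ B"
    using expectation_cos_le_norm_char[of "\<lambda>\<omega>. S I \<omega> - S J \<omega>" t] SI by (simp add: diff)
  moreover have [simp]: "integrable M (\<lambda>\<omega>. cos (t * (S I \<omega> - S J \<omega>)))"
    using SI by (intro integrable_const_bound[where B = 1]) auto
  ultimately have "(1 - ((norm (char H t))\<^sup>2) ^ B) / t
     \<le> expectation (\<lambda>\<omega>. (1 - cos (t * (S I \<omega> - S J \<omega>))) / t)"
    using t prob_space by (simp add: divide_right_mono)
  also have "\<dots> \<le> expectation (\<lambda>\<omega>. \<bar>S I \<omega> - S J \<omega>\<bar>)"
  proof (intro integral_mono)
    fix \<omega>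
    show "(1 - cos (t * (S I \<omega> - S J \<omega>))) / t \<le> \<bar>S I \<omega> - S J \<omega>\<bar>"
      using one_minus_cos_le_abs[of "t * (S I \<omega> - S J \<omega>)"] t
      unfolding pos_divide_le_eq[OF t] abs_mult by (simp add: mult.commute)
  qed (use SI in auto)
  finally have gain: "(1 - ((norm (char H t))\<^sup>2) ^ B) / t \<le> expectation (\<lambda>\<omega>. \<bar>S I \<omega> - S J \<omega>\<bar>)" .
  \<comment> \<open>The maximum is the average plus half the distance, which is the origin of the 2
    in \<open>2 * t\<close>.\<close>
  have max_eq: "max (S I \<omega>) (S J \<omega>) = (S I \<omega> + S J \<omega> + \<bar>S I \<omega> - S J \<omega>\<bar>) / 2" for \<omega>
    by (simp add: max_def abs_if)
  have "expectation (\<lambda>\<omega>. max (S I \<omega>) (S J \<omega>)) = (B * \<mu> + B * \<mu> + expectation (\<lambda>\<omega>. \<bar>S I \<omega> - S J \<omega>\<bar>)) / 2"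
    unfolding max_eq using SI ES by simp
  then show ?thesis using gain unfolding S_def by (simp add: field_simps)
qed

text \<open>Blocks of \<open>B\<close> columns: block \<open>b\<close> is crossed either in row \<open>u b\<close> or in row \<open>v b\<close>.\<close>

lemma last_passage_ge_blocks:
  fixes x :: "nat \<times> nat \<Rightarrow> real"
  assumes uv: "\<And>b. b < K \<Longrightarrow> u b \<le> v b \<and> v b \<le> u (Suc b)"
  shows "(\<Sum>b<K. max (\<Sum>i=b * B..<Suc b * B. x (i, u b)) (\<Sum>i=b * B..<Suc b * B. x (i, v b)))
    - (\<Sum>j<u 0. \<bar>x (0, j)\<bar>)
    - (\<Sum>b<K. \<Sum>j=u b..<u (Suc b). \<bar>x (b * B, j)\<bar> + \<bar>x (Suc b * B, j)\<bar>)
    \<le> last_passage x (K * B) (u K)"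
  using uv
proof (induction K)
  case 0
  have "- (\<Sum>j<u 0. \<bar>x (0, j)\<bar>) \<le> (\<Sum>j=0..<u 0. x (0, j))"
    unfolding lessThan_atLeast0 sum_negf[symmetric] by (intro sum_mono) auto
  also have "\<dots> \<le> last_passage x 0 (u 0)"
    using last_passage_vertical[of 0 "u 0" x 0] by simp
  finally show ?case by simp
next
  case (Suc K)
  have uvK: "u K \<le> v K" "v K \<le> u (Suc K)" using Suc.prems[of K] by auto
  let ?L = "last_passage x"
  let ?R = "\<Sum>j=u K..<u (Suc K). \<bar>x (K * B, j)\<bar> + \<bar>x (Suc K * B, j)\<bar>"
  have vert: "- (\<Sum>j=a..<b. \<bar>x (i, j)\<bar>) \<le> (\<Sum>j=a..<b. x (i, j))" for i a b
    unfolding sum_negf[symmetric] by (intro sum_mono) auto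
  \<comment> \<open>\<open>?R\<close> charges both borders of the block over the full height from
    \<open>u K\<close> to \<open>u (Suc K)\<close>, so the same cost covers either choice of the
    crossing row.\<close>
  have via: "?L (K * B) (u K) + (\<Sum>i=K * B..<Suc K * B. x (i, r)) - ?R \<le> ?L (Suc K * B) (u (Suc K))"
    if r: "u K \<le> r" "r \<le> u (Suc K)" for r
  proof -
    have "?L (K * B) (u K) + (\<Sum>j=u K..<r. x (K * B, j)) \<le> ?L (K * B) r"
      by (rule last_passage_vertical[OF r(1)])
    moreover have "?L (K * B) r + (\<Sum>i=K * B..<Suc K * B. x (i, r)) \<le> ?L (Suc K * B) r"
      by (rule last_passage_horizontal) simp
    moreover have "?L (Suc K * B) r + (\<Sum>j=r..<u (Suc K). x (Suc K * B, j)) \<le> ?L (Suc K * B) (u (Suc K))"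
      by (rule last_passage_vertical[OF r(2)])
    moreover have "(\<Sum>j=u K..<r. \<bar>x (K * B, j)\<bar>) + (\<Sum>j=r..<u (Suc K). \<bar>x (Suc K * B, j)\<bar>) \<le> ?R"
    proof -
      have "(\<Sum>j=u K..<r. \<bar>x (K * B, j)\<bar>) + (\<Sum>j=r..<u (Suc K). \<bar>x (Suc K * B, j)\<bar>)
         \<le> (\<Sum>j=u K..<r. \<bar>x (K * B, j)\<bar> + \<bar>x (Suc K * B, j)\<bar>)
          + (\<Sum>j=r..<u (Suc K). \<bar>x (K * B, j)\<bar> + \<bar>x (Suc K * B, j)\<bar>)"
        by (intro add_mono sum_mono) auto
      also have "\<dots> = ?R" by (rule sum.atLeastLessThan_concat[OF r])
      finally show ?thesis .
    qed
    ultimately show ?thesis using vert[of "K * B" "u K" r] vert[of "Suc K * B" r "u (Suc K)"] by linarith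
  qed
  have "?L (K * B) (u K) + max (\<Sum>i=K * B..<Suc K * B. x (i, u K)) (\<Sum>i=K * B..<Suc K * B. x (i, v K)) - ?R
      \<le> ?L (Suc K * B) (u (Suc K))"
    using via[of "u K"] via[of "v K"] uvK by (simp add: max_def del: mult_Suc)
  then show ?case using Suc.IH Suc.prems by (simp del: mult_Suc)
qed

lemma abs_last_passage_le: "\<bar>last_passage x n m\<bar> \<le> (\<Sum>z\<in>{..n} \<times> {..m}. \<bar>x z\<bar>)"
proof -
  obtain p where p: "p \<in> lattice_paths n m" "last_passage x n m = (\<Sum>z\<leftarrow>butlast p. x z)"
    by (rule last_passage_attained)
  have "(\<Sum>z\<leftarrow>butlast p. x z) = (\<Sum>z\<in>set (butlast p). x z)"
    by (intro sum_list_distinct_conv_sum_set distinct_butlast lattice_paths_distinct[OF p(1)])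
  also have "\<bar>\<dots>\<bar> \<le> (\<Sum>z\<in>set (butlast p). \<bar>x z\<bar>)" by (rule sum_abs)
  also have "\<dots> \<le> (\<Sum>z\<in>{..n} \<times> {..m}. \<bar>x z\<bar>)"
    using lattice_paths_subset_box[OF p(1)] by (intro sum_mono2) (auto dest: in_set_butlastD)
  finally show ?thesis using p(2) by simp
qed

section \<open>Expected gain of the block strategy for fixed rows\<close>

context row_product
begin

lemma integrable_coord_identity:
  assumes "\<And>j. integrable (w j) (\<lambda>y. y)" "z \<in> box"
  shows "integrable Q (\<lambda>\<omega>. \<omega> z)"
  by (rule integrable_coord[where f = "\<lambda>y. y", OF assms(2) _ assms(1)]) simp

lemma integrable_last_passage:
  assumes "\<And>j. integrable (w j) (\<lambda>y. y)"
  shows "integrable Q (\<lambda>\<omega>. last_passage \<omega> n m)"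
proof (rule Bochner_Integration.integrable_bound)
  show "integrable Q (\<lambda>\<omega>. \<Sum>z\<in>box. \<bar>\<omega> z\<bar>)"
    by (rule Bochner_Integration.integrable_sum)
      (rule integrable_abs[OF integrable_coord_identity[OF assms]])
  show "(\<lambda>\<omega>. last_passage \<omega> n m) \<in> borel_measurable Q"
    by (rule last_passage_measurable) (simp add: coord_measurable box_def)
  show "AE \<omega> in Q. norm (last_passage \<omega> n m) \<le> norm (\<Sum>z\<in>box. \<bar>\<omega> z\<bar>)"
  proof (intro always_eventually allI)
    fix \<omega>
    show "norm (last_passage \<omega> n m) \<le> norm (\<Sum>z\<in>box. \<bar>\<omega> z\<bar>)"
      using abs_last_passage_le[of \<omega> n m] by (simp add: box_def sum_nonneg)
  qed
qed

lemma expectation_abs_sum_le: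
  assumes "\<And>i. i \<in> A \<Longrightarrow> f i \<in> box"
    and "\<And>j. integrable (w j) (\<lambda>y. y)" "\<And>j. (\<integral>y. \<bar>y\<bar> \<partial>w j) \<le> a"
  shows "integrable Q (\<lambda>\<omega>. \<Sum>i\<in>A. \<bar>\<omega> (f i)\<bar>)"
    and "expectation (\<lambda>\<omega>. \<Sum>i\<in>A. \<bar>\<omega> (f i)\<bar>) \<le> real (card A) * a"
proof -
  have int: "integrable Q (\<lambda>\<omega>. \<bar>\<omega> (f i)\<bar>)" if "i \<in> A" for i
    by (rule integrable_abs[OF integrable_coord_identity[OF assms(2) assms(1)[OF that]]])
  then show "integrable Q (\<lambda>\<omega>. \<Sum>i\<in>A. \<bar>\<omega> (f i)\<bar>)"
    by (rule Bochner_Integration.integrable_sum)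
  have "expectation (\<lambda>\<omega>. \<Sum>i\<in>A. \<bar>\<omega> (f i)\<bar>) = (\<Sum>i\<in>A. expectation (\<lambda>\<omega>. \<bar>\<omega> (f i)\<bar>))"
    using int by (intro Bochner_Integration.integral_sum) auto
  also have "\<dots> \<le> (\<Sum>i\<in>A. a)"
  proof (intro sum_mono)
    fix i assume "i \<in> A"
    then show "expectation (\<lambda>\<omega>. \<bar>\<omega> (f i)\<bar>) \<le> a"
      using integral_coord[OF assms(1), of i "\<lambda>y. \<bar>y\<bar>"] assms(3) by simp
  qed
  finally show "expectation (\<lambda>\<omega>. \<Sum>i\<in>A. \<bar>\<omega> (f i)\<bar>) \<le> real (card A) * a" by simp
qed

text \<open>The block path is completed along row \<open>u K\<close> to column \<open>n\<close> and
  then up to row \<open>m\<close>. Each site on a vertical piece or in the leftover columns costs at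
  most \<open>a\<close> in expectation, and the vertical costs telescope over the blocks.\<close>

lemma expectation_last_passage_ge:
  assumes uv: "\<And>b. b < K \<Longrightarrow> u b < v b \<and> v b \<le> u (Suc b)" and uK: "u K \<le> m" and KB: "K * B \<le> n"
    and rows: "\<And>b. b < K \<Longrightarrow> w (u b) = h \<and> w (v b) = h"
    and int: "\<And>j. integrable (w j) (\<lambda>y. y)" and abs: "\<And>j. (\<integral>y. \<bar>y\<bar> \<partial>w j) \<le> a"
    and t: "0 < t"
  shows "real K * (real B * mean h + (1 - ((norm (char h t))\<^sup>2) ^ B) / (2 * t))
      - a * (2 * real m + real (n - K * B)) \<le> expectation (\<lambda>\<omega>. last_passage \<omega> n m)"
proof -
  define S where "S r b \<omega> = (\<Sum>i=b * B..<Suc b * B. \<omega> (i, r))" for r b :: nat and \<omega> :: "nat \<times> nat \<Rightarrow> real"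
  define R0 where "R0 \<omega> = (\<Sum>j<u 0. \<bar>\<omega> (0, j)\<bar>)" for \<omega> :: "nat \<times> nat \<Rightarrow> real"
  define R1 where "R1 b \<omega> = (\<Sum>j=u b..<u (Suc b). \<bar>\<omega> (b * B, j)\<bar>)" for b and \<omega> :: "nat \<times> nat \<Rightarrow> real"
  define R2 where "R2 b \<omega> = (\<Sum>j=u b..<u (Suc b). \<bar>\<omega> (Suc b * B, j)\<bar>)" for b and \<omega> :: "nat \<times> nat \<Rightarrow> real"
  define R3 where "R3 \<omega> = (\<Sum>i=K * B..<n. \<bar>\<omega> (i, u K)\<bar>)" for \<omega> :: "nat \<times> nat \<Rightarrow> real"
  define R4 where "R4 \<omega> = (\<Sum>j=u K..<m. \<bar>\<omega> (n, j)\<bar>)" for \<omega> :: "nat \<times> nat \<Rightarrow> real"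
  define V where "V \<omega> = (\<Sum>b<K. max (S (u b) b \<omega>) (S (v b) b \<omega>)) - R0 \<omega>
      - (\<Sum>b<K. R1 b \<omega> + R2 b \<omega>) - R3 \<omega> - R4 \<omega>" for \<omega>
  have V_le: "V \<omega> \<le> last_passage \<omega> n m" for \<omega>
  proof -
    have "(\<Sum>b<K. max (S (u b) b \<omega>) (S (v b) b \<omega>)) - R0 \<omega> - (\<Sum>b<K. R1 b \<omega> + R2 b \<omega>)
        \<le> last_passage \<omega> (K * B) (u K)"
      using last_passage_ge_blocks[of K u v \<omega> B] uv
      by (simp add: S_def R0_def R1_def R2_def sum.distrib less_imp_le del: mult_Suc)
    moreover have "last_passage \<omega> (K * B) (u K) + (\<Sum>i=K * B..<n. \<omega> (i, u K)) \<le> last_passage \<omega> n (u K)"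
      by (rule last_passage_horizontal[OF KB])
    moreover have "last_passage \<omega> n (u K) + (\<Sum>j=u K..<m. \<omega> (n, j)) \<le> last_passage \<omega> n m"
      by (rule last_passage_vertical[OF uK])
    moreover have "- R3 \<omega> \<le> (\<Sum>i=K * B..<n. \<omega> (i, u K))" "- R4 \<omega> \<le> (\<Sum>j=u K..<m. \<omega> (n, j))"
      unfolding R3_def R4_def sum_negf[symmetric] by (intro sum_mono; simp)+
    ultimately show ?thesis unfolding V_def by linarith
  qed
  have mono: "u b \<le> u c" if "b \<le> c" "c \<le> K" for b c
    using that
  proof (induction c rule: dec_induct)
    case (step c)
    then show ?case using uv[of c] by simp
  qed simp
  have u_le: "u b \<le> m" if "b \<le> K" for b using mono[OF that] uK by simp
  have v_le: "v b \<le> m" if "b < K" for b using uv[OF that] u_le[of "Suc b"] that by simp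
  have col: "b * B \<le> n" if "b \<le> K" for b
    using mult_le_mono1[OF that, of B] KB by (rule order_trans)
  note abs_sum = expectation_abs_sum_le[where a = a, OF _ int abs]
  have I0: "integrable Q R0" "expectation R0 \<le> real (u 0) * a"
    using abs_sum[where A = "{..<u 0}" and f = "\<lambda>j. (0, j)"] u_le[of 0]
    unfolding R0_def[abs_def] by (auto simp: box_def)
  have I1: "integrable Q (R1 b)" "expectation (R1 b) \<le> (real (u (Suc b)) - real (u b)) * a"
    and I2: "integrable Q (R2 b)" "expectation (R2 b) \<le> (real (u (Suc b)) - real (u b)) * a"
    if b: "b < K" for b
  proof -
    have le: "u b \<le> u (Suc b)" "u (Suc b) \<le> m" using mono[of b "Suc b"] u_le[of "Suc b"] b by auto
    show "integrable Q (R1 b)" "expectation (R1 b) \<le> (real (u (Suc b)) - real (u b)) * a"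
      using abs_sum[where A = "{u b..<u (Suc b)}" and f = "\<lambda>j. (b * B, j)"] le col[of b] b
      unfolding R1_def[abs_def] by (auto simp: box_def of_nat_diff)
    show "integrable Q (R2 b)" "expectation (R2 b) \<le> (real (u (Suc b)) - real (u b)) * a"
      using abs_sum[where A = "{u b..<u (Suc b)}" and f = "\<lambda>j. (Suc b * B, j)"] le col[of "Suc b"] b
      unfolding R2_def[abs_def] by (auto simp: box_def of_nat_diff simp del: mult_Suc)
  qed
  have I3: "integrable Q R3" "expectation R3 \<le> real (n - K * B) * a"
    using abs_sum[where A = "{K * B..<n}" and f = "\<lambda>i. (i, u K)"] uK
    unfolding R3_def[abs_def] by (auto simp: box_def)
  have I4: "integrable Q R4" "expectation R4 \<le> (real m - real (u K)) * a"
    using abs_sum[where A = "{u K..<m}" and f = "\<lambda>j. (n, j)"] uK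
    unfolding R4_def[abs_def] by (auto simp: box_def of_nat_diff)
  define G where "G = real B * mean h + (1 - ((norm (char h t))\<^sup>2) ^ B) / (2 * t)"
  have IS: "integrable Q (\<lambda>\<omega>. max (S (u b) b \<omega>) (S (v b) b \<omega>))"
    and ES: "G \<le> expectation (\<lambda>\<omega>. max (S (u b) b \<omega>) (S (v b) b \<omega>))" if b: "b < K" for b
  proof -
    let ?C = "{b * B..<Suc b * B}"
    let ?I = "(\<lambda>i. (i, u b)) ` ?C" and ?J = "(\<lambda>i. (i, v b)) ` ?C"
    have sub: "?I \<union> ?J \<subseteq> box"
      using col[of "Suc b"] u_le[of b] v_le[OF b] b by (auto simp: box_def simp del: mult_Suc)
    have S: "S r b \<omega> = (\<Sum>z\<in>(\<lambda>i. (i, r)) ` ?C. \<omega> z)" for r \<omega>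
      unfolding S_def by (subst sum.reindex) (auto simp: inj_on_def)
    have int_z: "integrable Q (\<lambda>\<omega>. \<omega> z)" if "z \<in> ?I \<union> ?J" for z
      using integrable_coord_identity[OF int, of z] sub that by blast
    show "integrable Q (\<lambda>\<omega>. max (S (u b) b \<omega>) (S (v b) b \<omega>))"
      unfolding S using int_z by (intro integrable_max Bochner_Integration.integrable_sum) auto
    show "G \<le> expectation (\<lambda>\<omega>. max (S (u b) b \<omega>) (S (v b) b \<omega>))"
      unfolding S G_def
    proof (rule expectation_max_sums_ge[OF _ _ _ _ _ _ _ int_z _ t])
      show "indep_vars (\<lambda>_. borel) (\<lambda>z \<omega>. \<omega> z) (?I \<union> ?J)"
        by (rule indep_vars_subset[OF indep_coords sub])
      show "?I \<inter> ?J = {}" using uv[OF b] by auto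
      show "card ?I = B" "card ?J = B" by (subst card_image; simp add: inj_on_def)+
      fix z assume z: "z \<in> ?I \<union> ?J"
      then have zb: "z \<in> box" and wz: "w (snd z) = h" using sub rows[OF b] by auto
      show "distr Q borel (\<lambda>\<omega>. \<omega> z) = h" using distr_coord[OF zb] wz by simp
      show "expectation (\<lambda>\<omega>. \<omega> z) = mean h"
        using integral_coord[OF zb, of "\<lambda>y. y"] wz by (simp add: mean_def)
    qed auto
  qed
  have intA: "integrable Q (\<lambda>\<omega>. \<Sum>b<K. max (S (u b) b \<omega>) (S (v b) b \<omega>))"
    using IS by (intro Bochner_Integration.integrable_sum) auto
  have intC: "integrable Q (\<lambda>\<omega>. \<Sum>b<K. R1 b \<omega> + R2 b \<omega>)"
    using I1(1) I2(1) by (intro Bochner_Integration.integrable_sum Bochner_Integration.integrable_add) auto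
  have tele: "(\<Sum>b<K. real (u (Suc b)) - real (u b)) = real (u K) - real (u 0)"
    by (rule sum_lessThan_telescope)
  have "real K * G - real (u 0) * a - 2 * (real (u K) - real (u 0)) * a - real (n - K * B) * a
      - (real m - real (u K)) * a \<le> expectation V"
  proof -
    have "expectation V = expectation (\<lambda>\<omega>. \<Sum>b<K. max (S (u b) b \<omega>) (S (v b) b \<omega>)) - expectation R0
      - expectation (\<lambda>\<omega>. \<Sum>b<K. R1 b \<omega> + R2 b \<omega>) - expectation R3 - expectation R4"
      unfolding V_def[abs_def] using intA intC I0(1) I3(1) I4(1) by simp
    moreover have "expectation (\<lambda>\<omega>. \<Sum>b<K. max (S (u b) b \<omega>) (S (v b) b \<omega>))
        = (\<Sum>b<K. expectation (\<lambda>\<omega>. max (S (u b) b \<omega>) (S (v b) b \<omega>)))"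
      using IS by (intro Bochner_Integration.integral_sum) auto
    moreover have "expectation (\<lambda>\<omega>. \<Sum>b<K. R1 b \<omega> + R2 b \<omega>) = (\<Sum>b<K. expectation (\<lambda>\<omega>. R1 b \<omega> + R2 b \<omega>))"
      using I1(1) I2(1) by (intro Bochner_Integration.integral_sum Bochner_Integration.integrable_add) auto
    moreover have "(\<Sum>b<K. expectation (\<lambda>\<omega>. R1 b \<omega> + R2 b \<omega>)) = (\<Sum>b<K. expectation (R1 b) + expectation (R2 b))"
      using I1(1) I2(1) by (intro sum.cong Bochner_Integration.integral_add) auto
    moreover have "real K * G \<le> (\<Sum>b<K. expectation (\<lambda>\<omega>. max (S (u b) b \<omega>) (S (v b) b \<omega>)))"
      using sum_mono[of "{..<K}" "\<lambda>_. G"] ES by simp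
    moreover have "(\<Sum>b<K. expectation (R1 b) + expectation (R2 b)) \<le> 2 * (real (u K) - real (u 0)) * a"
    proof -
      have "(\<Sum>b<K. expectation (R1 b) + expectation (R2 b)) \<le> (\<Sum>b<K. (real (u (Suc b)) - real (u b)) * (2 * a))"
      proof (intro sum_mono)
        fix b assume "b \<in> {..<K}"
        then show "expectation (R1 b) + expectation (R2 b) \<le> (real (u (Suc b)) - real (u b)) * (2 * a)"
          using add_mono[OF I1(2) I2(2), of b b] by (simp add: algebra_simps)
      qed
      also have "\<dots> = 2 * (real (u K) - real (u 0)) * a"
        unfolding sum_distrib_right[symmetric] tele by simp
      finally show ?thesis .
    qed
    ultimately show ?thesis using I0(2) I3(2) I4(2) by linarith
  qed
  also have "expectation V \<le> expectation (\<lambda>\<omega>. last_passage \<omega> n m)"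
  proof (rule integral_mono[OF _ integrable_last_passage[OF int] V_le])
    show "integrable Q V" unfolding V_def[abs_def]
      using intA intC I0(1) I3(1) I4(1) by (intro Bochner_Integration.integrable_diff)
  qed
  finally have fin: "real K * G - real (u 0) * a - 2 * (real (u K) - real (u 0)) * a - real (n - K * B) * a
      - (real m - real (u K)) * a \<le> expectation (\<lambda>\<omega>. last_passage \<omega> n m)" .
  have a0: "0 \<le> a" by (rule order_trans[OF _ abs[of 0]]) simp
  \<comment> \<open>The vertical cost counts \<open>u 0\<close> sites, twice
    \<open>u K - u 0\<close>, and \<open>m - u K\<close>, together
    \<open>m + u K - u 0\<close>.\<close>
  have "(real m + real (u K) - real (u 0)) * a \<le> (2 * real m) * a"
    using uK a0 by (intro mult_right_mono) auto
  then show ?thesis using fin unfolding G_def by (simp add: algebra_simps)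
qed

end

section \<open>Conditioning on the environment\<close>

text \<open>By right continuity, countably many values of the cdf determine the distribution. This
  makes the set containing one given state measurable in the space of distributions.\<close>

lemma real_distribution_eqI_rational:
  assumes M: "real_distribution M" and N: "real_distribution N"
    and eq: "\<And>q. q \<in> \<rat> \<Longrightarrow> measure M {..q} = measure N {..q}"
  shows "M = N"
proof -
  interpret M: real_distribution M by fact
  interpret N: real_distribution N by fact
  have "cdf M x = cdf N x" for x
  proof -
    have "\<exists>q\<in>\<rat>. x < q \<and> q < x + inverse (real (Suc k))" for k
      using Rats_dense_in_real[of x "x + inverse (real (Suc k))"] by auto
    then obtain q where q: "\<And>k. q k \<in> \<rat>" "\<And>k. x < q k" "\<And>k. q k < x + inverse (real (Suc k))"
      by metis
    have "q \<longlonglongrightarrow> x"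
    proof (rule tendsto_sandwich[of "\<lambda>_. x" _ _ "\<lambda>k. x + inverse (real (Suc k))"])
      show "(\<lambda>k. x + inverse (real (Suc k))) \<longlonglongrightarrow> x"
        using tendsto_add[OF tendsto_const[of x] LIMSEQ_inverse_real_of_nat] by simp
    qed (auto intro!: always_eventually less_imp_le q simp del: of_nat_Suc)
    then have lim: "filterlim q (at_right x) sequentially"
      using q(2) by (auto simp: filterlim_at intro!: always_eventually less_imp_neq[symmetric])
    have "(\<lambda>k. cdf M (q k)) \<longlonglongrightarrow> cdf M x" "(\<lambda>k. cdf N (q k)) \<longlonglongrightarrow> cdf N x"
      using M.cdf_is_right_cont[of x] N.cdf_is_right_cont[of x] lim
      by (auto simp: continuous_within intro: filterlim_compose)
    moreover have "cdf M (q k) = cdf N (q k)" for k using eq[OF q(1)] by (simp add: cdf_def)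
    ultimately show ?thesis using LIMSEQ_unique by simp
  qed
  then show ?thesis using cdf_unique[OF M N] by auto
qed

lemma real_distribution_in_prob_algebra:
  "N \<in> space (prob_algebra borel) \<Longrightarrow> real_distribution N"
  by (simp add: space_prob_algebra real_distribution_def real_distribution_axioms_def)

lemma sets_prob_algebra_singleton:
  assumes "real_distribution h"
  shows "{N \<in> space (prob_algebra borel). N = h} \<in> sets (prob_algebra borel)"
proof -
  have "{N \<in> space (prob_algebra borel). N = h}
      = {N \<in> space (prob_algebra borel). \<forall>q. measure N {..real_of_rat q} = measure h {..real_of_rat q}}"
    using real_distribution_eqI_rational[OF real_distribution_in_prob_algebra assms] by (auto simp: Rats_def)
  also have "\<dots> \<in> sets (prob_algebra borel)"
  proof (rule sets.sets_Collect_countable_All)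
    fix q :: rat
    have [measurable]: "(\<lambda>N. measure N {..real_of_rat q}) \<in> borel_measurable (prob_algebra borel)"
      unfolding prob_algebra_def by (intro measurable_restrict_space1 measurable_measure_subprob_algebra) simp
    show "{N \<in> space (prob_algebra borel). measure N {..real_of_rat q} = measure h {..real_of_rat q}}
        \<in> sets (prob_algebra borel)"
      by measurable
  qed
  finally show ?thesis .
qed

text \<open>\<open>h0\<close> is later instantiated by a nondegenerate state of maximal
  mean.\<close>

locale random_environment = prob_space M
  for M :: "'w measure" +
  fixes F :: "nat \<Rightarrow> 'w \<Rightarrow> real measure" and X :: "nat \<times> nat \<Rightarrow> 'w \<Rightarrow> real"
    and HH :: "real measure set" and h0 :: "real measure"
  assumes F_measurable: "\<And>j. F j \<in> M \<rightarrow>\<^sub>M prob_algebra borel"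
    and stationary: "stationary_env (env_law M F)"
    and weights: "weights_given_env M F X"
    and finite_states: "finite HH"
    and state_distribution: "\<And>h. h \<in> HH \<Longrightarrow> real_distribution h"
    and AE_states: "AE \<omega> in M. \<forall>j. F j \<omega> \<in> HH"
    and h0: "h0 \<in> HH"
    and charged: "0 < measure M {\<omega> \<in> space M. F 0 \<omega> = h0}"
begin

lemma env_map_measurable: "env_map F \<in> M \<rightarrow>\<^sub>M env_space"
  unfolding env_map_def env_space_def
  using F_measurable by (intro measurable_PiM_single') (auto intro: measurable_space)

lemma X_measurable: "X z \<in> borel_measurable M"
  using weights unfolding weights_given_env_def by blast

definition pattern_event :: "nat \<Rightarrow> (nat \<Rightarrow> real measure) \<Rightarrow> 'w set" where
  "pattern_event m w = {\<omega> \<in> space M. \<forall>j\<le>m. F j \<omega> = w j}"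

lemma env_coord_event:
  assumes "h \<in> HH"
  shows "{e \<in> space env_space. e j = h} \<in> sets env_space"
proof -
  have j: "(\<lambda>e. e j) \<in> env_space \<rightarrow>\<^sub>M prob_algebra borel"
    unfolding env_space_def by (rule measurable_component_singleton) simp
  have "(\<lambda>e. e j) -` {N \<in> space (prob_algebra borel). N = h} \<inter> space env_space \<in> sets env_space"
    using j sets_prob_algebra_singleton[OF state_distribution[OF assms]] by (rule measurable_sets)
  also have "(\<lambda>e. e j) -` {N \<in> space (prob_algebra borel). N = h} \<inter> space env_space
     = {e \<in> space env_space. e j = h}"
    using measurable_space[OF j] by auto
  finally show ?thesis .
qed

lemma state_event: "h \<in> HH \<Longrightarrow> {\<omega> \<in> space M. F j \<omega> = h} \<in> events"
proof -
  assume "h \<in> HH"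
  then have "env_map F -` {e \<in> space env_space. e j = h} \<inter> space M \<in> events"
    by (intro measurable_sets[OF env_map_measurable] env_coord_event)
  also have "env_map F -` {e \<in> space env_space. e j = h} \<inter> space M = {\<omega> \<in> space M. F j \<omega> = h}"
    using measurable_space[OF env_map_measurable] by (auto simp: env_map_def)
  finally show ?thesis .
qed

lemma pattern_event_env_sigma:
  assumes "\<And>j. w j \<in> HH"
  shows "pattern_event m w \<in> sets (env_sigma M F)"
proof -
  have "{e \<in> space env_space. \<forall>j\<in>{..m}. e j = w j} \<in> sets env_space"
    using assms by (intro sets.sets_Collect_finite_All' env_coord_event) auto
  then have "env_map F -` {e \<in> space env_space. \<forall>j\<in>{..m}. e j = w j} \<inter> space M \<in> sets (env_sigma M F)"
    unfolding env_sigma_def by (rule in_vimage_algebra)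
  also have "env_map F -` {e \<in> space env_space. \<forall>j\<in>{..m}. e j = w j} \<inter> space M = pattern_event m w"
    using measurable_space[OF env_map_measurable] by (auto simp: env_map_def pattern_event_def)
  finally show ?thesis .
qed

lemma env_sigma_subalgebra: "subalgebra M (env_sigma M F)"
  unfolding subalgebra_def
proof
  show "space (env_sigma M F) = space M" by (simp add: env_sigma_def)
  have "env_map F \<in> space M \<rightarrow> space env_space"
    using measurable_space[OF env_map_measurable] by auto
  then show "sets (env_sigma M F) \<subseteq> events"
    unfolding env_sigma_def using measurable_sets[OF env_map_measurable]
    by (auto simp: sets_vimage_algebra2)
qed

lemma pattern_event_events: "(\<And>j. w j \<in> HH) \<Longrightarrow> pattern_event m w \<in> events"
  using pattern_event_env_sigma[of w m] env_sigma_subalgebra by (auto simp: subalgebra_def)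

text \<open>The pattern event belongs to the \<sigma>-algebra of the environment, so the conditional
  probability can be integrated over it; on the event the rows met by the box are fixed and that
  probability is constant.\<close>

lemma prob_pattern_weights:
  assumes w: "\<And>j. w j \<in> HH" and B: "\<And>z. z \<in> {..n} \<times> {..m} \<Longrightarrow> B z \<in> sets borel"
  shows "prob (pattern_event m w \<inter> {\<omega> \<in> space M. \<forall>z\<in>{..n} \<times> {..m}. X z \<omega> \<in> B z})
    = prob (pattern_event m w) * (\<Prod>z\<in>{..n} \<times> {..m}. measure (w (snd z)) (B z))"
proof -
  interpret sub: finite_measure_subalgebra M "env_sigma M F"
    by standard (rule env_sigma_subalgebra)
  let ?I = "{..n} \<times> {..m}" and ?E = "pattern_event m w"
  let ?A = "{\<omega> \<in> space M. \<forall>z\<in>?I. X z \<omega> \<in> B z}"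
  let ?c = "\<Prod>z\<in>?I. measure (w (snd z)) (B z)"
  have E: "?E \<in> sets (env_sigma M F)" "?E \<in> events"
    using pattern_event_env_sigma pattern_event_events w by auto
  have A: "?A \<in> events"
  proof (intro sets.sets_Collect_finite_All')
    fix z assume "z \<in> ?I"
    then have "X z -` B z \<inter> space M \<in> events" by (intro measurable_sets[OF X_measurable] B)
    also have "X z -` B z \<inter> space M = {\<omega> \<in> space M. X z \<omega> \<in> B z}" by auto
    finally show "{\<omega> \<in> space M. X z \<omega> \<in> B z} \<in> events" .
  qed auto
  have ce: "AE \<omega> in M. real_cond_exp M (env_sigma M F) (indicator ?A) \<omega>
      = (\<Prod>z\<in>?I. measure (F (snd z) \<omega>) (B z))"
    by (rule weights[unfolded weights_given_env_def, THEN conjunct2, rule_format]) (use B in auto)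
  have "prob (?E \<inter> ?A) = (\<integral>\<omega>\<in>?E. indicator ?A \<omega> \<partial>M)"
    using A E by (simp add: set_lebesgue_integral_def flip: indicator_inter_arith)
  also have "\<dots> = (\<integral>\<omega>\<in>?E. real_cond_exp M (env_sigma M F) (indicator ?A) \<omega> \<partial>M)"
    using A E by (intro sub.real_cond_exp_intA) (auto simp: less_top[symmetric])
  also have "\<dots> = (\<integral>\<omega>\<in>?E. ?c \<partial>M)"
    unfolding set_lebesgue_integral_def
  proof (rule integral_cong_AE)
    show "AE \<omega> in M. indicator ?E \<omega> *\<^sub>R real_cond_exp M (env_sigma M F) (indicator ?A) \<omega> = indicator ?E \<omega> *\<^sub>R ?c"
      using ce
    proof eventually_elim
      case (elim \<omega>)
      then show ?case
        by (auto simp: indicator_def pattern_event_def intro!: prod.cong)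
    qed
  qed (use E in measurable)
  also have "\<dots> = prob ?E * ?c" using E by (simp add: set_lebesgue_integral_def)
  finally show ?thesis .
qed

lemma row_product_pattern:
  assumes "\<And>j. w j \<in> HH"
  shows "row_product w"
  unfolding row_product_def using assms state_distribution by blast

text \<open>Given the pattern, the weights of the box have law \<open>Q\<close>: rectangles are
  handled by \<open>prob_pattern_weights\<close> and determine a finite product measure. The form
  with a product instead of a quotient also covers patterns of probability 0.\<close>

lemma nn_integral_pattern:
  assumes w: "\<And>j. w j \<in> HH" and f: "f \<in> borel_measurable (row_product.Q w n m)"
  shows "(\<integral>\<^sup>+\<omega>. f (\<lambda>z\<in>{..n} \<times> {..m}. X z \<omega>) * indicator (pattern_event m w) \<omega> \<partial>M)
    = emeasure M (pattern_event m w) * (\<integral>\<^sup>+x. f x \<partial>row_product.Q w n m)"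
proof -
  interpret row: row_product w n m by (rule row_product_pattern[OF w])
  let ?E = "pattern_event m w" and ?I = "{..n} \<times> {..m}"
  let ?X = "\<lambda>\<omega>. \<lambda>z\<in>?I. X z \<omega>"
  have E: "?E \<in> events" using pattern_event_events w .
  have setsQ: "sets row.Q = sets (Pi\<^sub>M ?I (\<lambda>_. borel))"
    unfolding row.Q_def row.box_def by (intro sets_PiM_cong) auto
  have Xm: "?X \<in> M \<rightarrow>\<^sub>M row.Q"
    unfolding measurable_cong_sets[OF refl setsQ] using X_measurable by (intro measurable_restrict)
  show ?thesis
  proof (cases "emeasure M ?E = 0")
    case True
    then have "(\<integral>\<^sup>+\<omega>. f (?X \<omega>) * indicator ?E \<omega> \<partial>M) = 0"
      using E by (intro nn_integral_null_set) auto
    then show ?thesis using True by simp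
  next
    case False
    have pos: "0 < prob ?E" using False E by (simp add: emeasure_eq_measure zero_less_measure_iff)
    let ?U = "uniform_measure M ?E"
    interpret prod: product_sigma_finite "\<lambda>z. w (snd z)"
      unfolding product_sigma_finite_def using row.prob_space_row prob_space_imp_sigma_finite by blast
    have "distr ?U row.Q ?X = Pi\<^sub>M ?I (\<lambda>z. w (snd z))"
    proof (rule prod.PiM_eqI)
      show "sets (distr ?U row.Q ?X) = sets (Pi\<^sub>M ?I (\<lambda>z. w (snd z)))"
        by (simp add: row.Q_def row.box_def)
      fix B assume "\<And>z. z \<in> ?I \<Longrightarrow> B z \<in> sets (w (snd z))"
      then have B: "\<And>z. z \<in> ?I \<Longrightarrow> B z \<in> sets borel" by simp
      have PiE: "Pi\<^sub>E ?I B \<in> sets row.Q"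
        unfolding setsQ using B by (intro sets_PiM_I_finite) auto
      have vim: "?X -` Pi\<^sub>E ?I B \<inter> space M = {\<omega> \<in> space M. \<forall>z\<in>?I. X z \<omega> \<in> B z}"
        by (auto simp: PiE_def Pi_def)
      have "emeasure (distr ?U row.Q ?X) (Pi\<^sub>E ?I B) = emeasure ?U (?X -` Pi\<^sub>E ?I B \<inter> space M)"
        using Xm PiE by (subst emeasure_distr) auto
      also have "\<dots> = emeasure M (?E \<inter> (?X -` Pi\<^sub>E ?I B \<inter> space M)) / emeasure M ?E"
        using E measurable_sets[OF Xm PiE] by (rule emeasure_uniform_measure)
      also have "\<dots> = ennreal (prob (?E \<inter> {\<omega> \<in> space M. \<forall>z\<in>?I. X z \<omega> \<in> B z}) / prob ?E)"
        unfolding vim using pos by (simp add: emeasure_eq_measure divide_ennreal)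
      also have "\<dots> = ennreal (\<Prod>z\<in>?I. measure (w (snd z)) (B z))"
        using pos by (subst prob_pattern_weights[OF w B]) auto
      also have "\<dots> = (\<Prod>z\<in>?I. emeasure (w (snd z)) (B z))"
        by (simp add: prod_ennreal finite_measure.emeasure_eq_measure[OF prob_space.finite_measure[OF row.prob_space_row]])
      finally show "emeasure (distr ?U row.Q ?X) (Pi\<^sub>E ?I B) = (\<Prod>z\<in>?I. emeasure (w (snd z)) (B z))" .
    qed simp
    then have "(\<integral>\<^sup>+x. f x \<partial>row.Q) = (\<integral>\<^sup>+x. f x \<partial>distr ?U row.Q ?X)"
      by (simp add: row.Q_def row.box_def)
    also have "\<dots> = (\<integral>\<^sup>+\<omega>. f (?X \<omega>) \<partial>?U)"
      using Xm f by (intro nn_integral_distr) auto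
    also have "\<dots> = (\<integral>\<^sup>+\<omega>. f (?X \<omega>) * indicator ?E \<omega> \<partial>M) / emeasure M ?E"
      using E measurable_compose[OF Xm f] by (intro nn_integral_uniform_measure) auto
    finally have eq: "(\<integral>\<^sup>+x. f x \<partial>row.Q) = (\<integral>\<^sup>+\<omega>. f (?X \<omega>) * indicator ?E \<omega> \<partial>M) / emeasure M ?E" .
    have "emeasure M ?E * (J / emeasure M ?E) = J" for J
      using ennreal_mult_divide_eq[OF False emeasure_finite, of J]
      by (simp add: ennreal_times_divide mult.commute[of _ J])
    then show ?thesis unfolding eq by simp
  qed
qed

lemma prob_state: "prob {\<omega> \<in> space M. F j \<omega> = h0} = prob {\<omega> \<in> space M. F 0 \<omega> = h0}"
proof (induction j)
  case (Suc j)
  let ?A = "\<lambda>j. {e \<in> space env_space. e j = h0}"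
  have law: "measure (env_law M F) (?A j) = prob {\<omega> \<in> space M. F j \<omega> = h0}" for j
  proof -
    have "measure (env_law M F) (?A j) = prob (env_map F -` ?A j \<inter> space M)"
      unfolding env_law_def by (rule measure_distr[OF env_map_measurable env_coord_event[OF h0]])
    also have "env_map F -` ?A j \<inter> space M = {\<omega> \<in> space M. F j \<omega> = h0}"
      using measurable_space[OF env_map_measurable] by (auto simp: env_map_def)
    finally show ?thesis .
  qed
  have shift: "env_shift \<in> env_space \<rightarrow>\<^sub>M env_space"
    unfolding env_shift_def env_space_def
    by (intro measurable_PiM_single' measurable_component_singleton) (auto simp: space_PiM PiE_iff)
  have shift': "env_shift \<in> env_law M F \<rightarrow>\<^sub>M env_space"
    using shift by (simp add: env_law_def)
  have "measure (env_law M F) (?A j) = measure (distr (env_law M F) env_space env_shift) (?A j)"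
    using stationary by (simp add: stationary_env_def)
  also have "\<dots> = measure (env_law M F) (env_shift -` ?A j \<inter> space (env_law M F))"
    by (rule measure_distr[OF shift' env_coord_event[OF h0]])
  also have "env_shift -` ?A j \<inter> space (env_law M F) = ?A (Suc j)"
    using measurable_space[OF shift] by (auto simp: env_shift_def env_law_def)
  finally show ?case using Suc law by simp
qed simp

definition p0 :: real where "p0 = prob {\<omega> \<in> space M. F 0 \<omega> = h0}"

text \<open>A reverse Markov inequality: the number of rows in state \<open>h0\<close> has mean
  \<open>p0 * Suc m\<close> by stationarity and never exceeds \<open>Suc m\<close>. The bound is
  uniform in \<open>m\<close>.\<close>

lemma prob_many_states_ge:
  "p0 / 2 \<le> prob {\<omega> \<in> space M. p0 / 2 * real (Suc m) \<le> real (card {j. j \<le> m \<and> F j \<omega> = h0})}"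
proof -
  define N where "N \<omega> = real (card {j. j \<le> m \<and> F j \<omega> = h0})" for \<omega>
  have N_sum: "N \<omega> = (\<Sum>j\<le>m. indicator {\<omega> \<in> space M. F j \<omega> = h0} \<omega>)" if "\<omega> \<in> space M" for \<omega>
  proof -
    have "(\<Sum>j\<le>m. indicator {\<omega> \<in> space M. F j \<omega> = h0} \<omega>) = (\<Sum>j\<in>{..m}. if F j \<omega> = h0 then 1 else 0 :: real)"
      using that by (intro sum.cong) (auto simp: indicator_def)
    also have "\<dots> = real (card {j \<in> {..m}. F j \<omega> = h0})" by (simp add: sum.If_cases Int_def)
    finally show ?thesis by (simp add: N_def)
  qed
  define A where "A = {\<omega> \<in> space M. p0 / 2 * real (Suc m) \<le> N \<omega>}"
  have ind_m: "(\<lambda>\<omega>. indicator {\<omega> \<in> space M. F j \<omega> = h0} \<omega> :: real) \<in> borel_measurable M" for j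
    using state_event[OF h0, of j] by (rule borel_measurable_indicator)
  have N_m [measurable]: "N \<in> borel_measurable M"
  proof -
    have "(\<lambda>\<omega>. \<Sum>j\<le>m. indicator {\<omega> \<in> space M. F j \<omega> = h0} \<omega> :: real) \<in> borel_measurable M"
      using ind_m by (rule borel_measurable_sum)
    then show ?thesis by (subst measurable_cong[OF N_sum])
  qed
  have A: "A \<in> events" unfolding A_def by measurable
  have N_Suc: "N \<omega> \<le> real (Suc m)" for \<omega>
  proof -
    have "card {j. j \<le> m \<and> F j \<omega> = h0} \<le> card {..m}" by (intro card_mono) auto
    then show ?thesis unfolding N_def by (simp only: of_nat_le_iff card_atMost)
  qed
  have N_le: "N \<omega> \<le> real (Suc m) * indicator A \<omega> + p0 / 2 * real (Suc m)" if "\<omega> \<in> space M" for \<omega>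
  proof -
    have "0 \<le> p0 / 2 * real (Suc m)" by (simp add: p0_def)
    then show ?thesis using that N_Suc[of \<omega>] by (auto simp: indicator_def A_def)
  qed
  have "real (Suc m) * p0 = (\<Sum>j\<le>m. prob {\<omega> \<in> space M. F j \<omega> = h0})"
    unfolding prob_state[folded p0_def] by simp
  also have "\<dots> = (\<Sum>j\<le>m. expectation (indicator {\<omega> \<in> space M. F j \<omega> = h0}))"
    using state_event[OF h0] by simp
  also have "\<dots> = expectation (\<lambda>\<omega>. \<Sum>j\<le>m. indicator {\<omega> \<in> space M. F j \<omega> = h0} \<omega>)"
    using state_event[OF h0]
    by (intro Bochner_Integration.integral_sum[symmetric] integrable_real_indicator) (auto simp: less_top[symmetric])
  also have "\<dots> = expectation N" using N_sum by (intro Bochner_Integration.integral_cong) auto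
  also have "\<dots> \<le> expectation (\<lambda>\<omega>. real (Suc m) * indicator A \<omega> + p0 / 2 * real (Suc m))"
  proof (rule integral_mono_AE)
    show "integrable M N" using N_Suc by (intro integrable_const_bound[where B = "real (Suc m)"]) (auto simp: N_def)
    show "integrable M (\<lambda>\<omega>. real (Suc m) * indicator A \<omega> + p0 / 2 * real (Suc m))"
      using A by (intro Bochner_Integration.integrable_add integrable_mult_right integrable_real_indicator integrable_const)
        (auto simp: less_top[symmetric])
  qed (use N_le in auto)
  also have "\<dots> = real (Suc m) * prob A + p0 / 2 * real (Suc m)"
  proof -
    have "integrable M (indicator A :: _ \<Rightarrow> real)"
      using A by (intro integrable_real_indicator) (auto simp: less_top[symmetric])
    then show ?thesis using A prob_space by (subst Bochner_Integration.integral_add) auto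
  qed
  finally have "real (Suc m) * (p0 / 2) \<le> real (Suc m) * prob A"
    by (simp add: field_simps del: of_nat_Suc)
  then have "p0 / 2 \<le> prob A" by (rule mult_left_le_imp_le) simp
  then show ?thesis by (simp add: N_def A_def)
qed

text \<open>The integral over \<open>M\<close> is a weighted average over the finitely many patterns of the first
  \<open>m + 1\<close> rows; hence some pattern rich in \<open>h0\<close> does not do worse than \<open>2 / p0\<close> times the average.\<close>

lemma good_pattern:
  assumes f: "\<And>w. (\<And>j. w j \<in> HH) \<Longrightarrow> f \<in> borel_measurable (row_product.Q w n m)"
  obtains w where "\<And>j. w j \<in> HH" "p0 / 2 * real (Suc m) \<le> real (card {j. j \<le> m \<and> w j = h0})"
    "ennreal (p0 / 2) * (\<integral>\<^sup>+x. f x \<partial>row_product.Q w n m) \<le> (\<integral>\<^sup>+\<omega>. f (\<lambda>z\<in>{..n} \<times> {..m}. X z \<omega>) \<partial>M)"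
proof -
  define good where "good w \<longleftrightarrow> p0 / 2 * real (Suc m) \<le> real (card {j. j \<le> m \<and> w j = h0})" for w :: "nat \<Rightarrow> real measure"
  \<comment> \<open>Rows above \<open>m\<close> are filled with \<open>h0\<close>: a pattern is then
    determined by its first rows, so there are finitely many, and different ones have disjoint
    events.\<close>
  define ext where "ext w j = (if j \<le> m then w j else h0)" for w :: "nat \<Rightarrow> real measure" and j
  define W where "W = ext ` {w \<in> {..m} \<rightarrow>\<^sub>E HH. good w}"
  have good_cong: "good w \<longleftrightarrow> good v" if "\<And>j. j \<le> m \<Longrightarrow> w j = v j" for w v
  proof -
    have "{j. j \<le> m \<and> w j = h0} = {j. j \<le> m \<and> v j = h0}" using that by auto
    then show ?thesis by (simp add: good_def)
  qed
  have finW: "finite W"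
    unfolding W_def by (intro finite_imageI finite_subset[OF _ finite_PiE[of "{..m}" "\<lambda>_. HH"]]) (auto simp: finite_states)
  have W: "w j \<in> HH" "good w" if "w \<in> W" for w j
  proof -
    obtain v where v: "v \<in> {..m} \<rightarrow>\<^sub>E HH" "good v" "w = ext v" using \<open>w \<in> W\<close> by (auto simp: W_def)
    show "w j \<in> HH" using v h0 by (auto simp: ext_def)
    show "good w" using v good_cong[of w v] by (auto simp: ext_def)
  qed
  have disj: "disjoint_family_on (pattern_event m) W"
  proof -
    have "w = v" if "w \<in> W" "v \<in> W" "\<omega> \<in> pattern_event m w" "\<omega> \<in> pattern_event m v" for w v \<omega>
    proof
      fix j
      show "w j = v j"
        using that by (cases "j \<le> m") (auto simp: W_def ext_def pattern_event_def)
    qed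
    then show ?thesis by (auto simp: disjoint_family_on_def)
  qed
  let ?U = "\<Union>w\<in>W. pattern_event m w"
  have U: "?U \<in> events" using finW W pattern_event_events by (intro sets.finite_UN) auto
  have "p0 / 2 \<le> prob {\<omega> \<in> space M. good (\<lambda>j. F j \<omega>)}"
    using prob_many_states_ge[of m] by (simp add: good_def)
  also have "\<dots> \<le> prob ?U"
  proof (rule finite_measure_mono_AE[OF _ U])
    show "AE \<omega> in M. \<omega> \<in> {\<omega> \<in> space M. good (\<lambda>j. F j \<omega>)} \<longrightarrow> \<omega> \<in> ?U"
      using AE_states
    proof eventually_elim
      case (elim \<omega>)
      show ?case
      proof
        assume \<omega>: "\<omega> \<in> {\<omega> \<in> space M. good (\<lambda>j. F j \<omega>)}"
        define v where "v = restrict (\<lambda>j. F j \<omega>) {..m}"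
        have "good v" using \<omega> good_cong[of v "\<lambda>j. F j \<omega>"] by (auto simp: v_def)
        then have "ext v \<in> W" using elim by (auto simp: W_def v_def)
        moreover have "\<omega> \<in> pattern_event m (ext v)"
          using \<omega> by (auto simp: pattern_event_def ext_def v_def)
        ultimately show "\<omega> \<in> ?U" by auto
      qed
    qed
  qed
  finally have U_ge: "p0 / 2 \<le> prob ?U" .
  have "0 < p0" using charged by (simp add: p0_def)
  then have "W \<noteq> {}" using U_ge by auto
  define \<Phi> where "\<Phi> w = (\<integral>\<^sup>+x. f x \<partial>row_product.Q w n m)" for w
  define w where "w = arg_min_on \<Phi> W"
  have w: "w \<in> W" "\<And>v. v \<in> W \<Longrightarrow> \<Phi> w \<le> \<Phi> v"
    unfolding w_def using arg_min_if_finite(1)[OF finW \<open>W \<noteq> {}\<close>] arg_min_least[OF finW \<open>W \<noteq> {}\<close>] by auto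
  let ?X = "\<lambda>\<omega>. \<lambda>z\<in>{..n} \<times> {..m}. X z \<omega>"
  have Xm: "(\<lambda>\<omega>. f (?X \<omega>)) \<in> borel_measurable M"
  proof -
    interpret row: row_product w n m by (rule row_product_pattern[OF W(1)[OF w(1)]])
    have "?X \<in> M \<rightarrow>\<^sub>M Pi\<^sub>M ({..n} \<times> {..m}) (\<lambda>_. borel)"
      using X_measurable by (intro measurable_restrict)
    moreover have "sets row.Q = sets (Pi\<^sub>M ({..n} \<times> {..m}) (\<lambda>_. borel))"
      unfolding row.Q_def row.box_def by (intro sets_PiM_cong) auto
    ultimately have "?X \<in> M \<rightarrow>\<^sub>M row.Q" by (simp cong: measurable_cong_sets)
    then show ?thesis using f[OF W(1)[OF w(1)]] by (rule measurable_compose)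
  qed
  have "ennreal (p0 / 2) * \<Phi> w \<le> emeasure M ?U * \<Phi> w"
    using U_ge by (intro mult_right_mono) (auto simp: emeasure_eq_measure ennreal_leI)
  also have "emeasure M ?U = (\<Sum>v\<in>W. emeasure M (pattern_event m v))"
    using finW W disj pattern_event_events by (intro sum_emeasure[symmetric]) auto
  also have "\<dots> * \<Phi> w = (\<Sum>v\<in>W. emeasure M (pattern_event m v) * \<Phi> w)"
    by (rule sum_distrib_right)
  also have "\<dots> \<le> (\<Sum>v\<in>W. emeasure M (pattern_event m v) * \<Phi> v)"
    using w by (intro sum_mono mult_left_mono) auto
  also have "\<dots> = (\<Sum>v\<in>W. \<integral>\<^sup>+\<omega>. f (?X \<omega>) * indicator (pattern_event m v) \<omega> \<partial>M)"
    unfolding \<Phi>_def using W f by (intro sum.cong refl nn_integral_pattern[symmetric]) auto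
  also have "\<dots> = (\<integral>\<^sup>+\<omega>. (\<Sum>v\<in>W. f (?X \<omega>) * indicator (pattern_event m v) \<omega>) \<partial>M)"
    by (intro nn_integral_sum[symmetric] borel_measurable_times_ennreal Xm borel_measurable_indicator
      pattern_event_events W)
  also have "\<dots> \<le> (\<integral>\<^sup>+\<omega>. f (?X \<omega>) \<partial>M)"
  proof (intro nn_integral_mono)
    fix \<omega>
    have "(\<Sum>v\<in>W. indicator (pattern_event m v) \<omega> :: ennreal) = indicator ?U \<omega>"
    proof -
      have "(\<Sum>v\<in>W. indicator (pattern_event m v) \<omega> :: ennreal)
          = ennreal (\<Sum>v\<in>W. indicator (pattern_event m v) \<omega>)"
        by (subst sum_ennreal[symmetric]) (auto simp: ennreal_indicator)
      also have "(\<Sum>v\<in>W. indicator (pattern_event m v) \<omega> :: real) = indicator ?U \<omega>"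
        using indicator_UN_disjoint[OF finW disj, of \<omega>] by (rule sym)
      finally show ?thesis by (simp add: ennreal_indicator)
    qed
    then show "(\<Sum>v\<in>W. f (?X \<omega>) * indicator (pattern_event m v) \<omega>) \<le> f (?X \<omega>)"
      unfolding sum_distrib_left[symmetric] by (simp add: indicator_def)
  qed
  finally show ?thesis using that[of w] W w(1) by (auto simp: \<Phi>_def good_def)
qed

end

section \<open>Bounds on the limit shape\<close>

lemma tendsto_floor_multiple:
  assumes "0 \<le> (\<alpha> :: real)"
  shows "(\<lambda>n. real (nat \<lfloor>real n * \<alpha>\<rfloor>) / real n) \<longlonglongrightarrow> \<alpha>"
proof (rule tendsto_sandwich[of "\<lambda>n. \<alpha> - 1 / real n" _ _ "\<lambda>_. \<alpha>"])
  have fl: "real (nat \<lfloor>real n * \<alpha>\<rfloor>) = of_int \<lfloor>real n * \<alpha>\<rfloor>" for n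
    using assms by (intro of_nat_nat) simp
  show "\<forall>\<^sub>F n in sequentially. \<alpha> - 1 / real n \<le> real (nat \<lfloor>real n * \<alpha>\<rfloor>) / real n"
  proof (intro eventually_sequentiallyI[of 1])
    fix n :: nat assume n: "1 \<le> n"
    have "\<alpha> - 1 / real n = (real n * \<alpha> - 1) / real n" using n by (simp add: field_simps)
    also have "\<dots> \<le> real (nat \<lfloor>real n * \<alpha>\<rfloor>) / real n"
      unfolding fl by (intro divide_right_mono) linarith+
    finally show "\<alpha> - 1 / real n \<le> real (nat \<lfloor>real n * \<alpha>\<rfloor>) / real n" .
  qed
  show "\<forall>\<^sub>F n in sequentially. real (nat \<lfloor>real n * \<alpha>\<rfloor>) / real n \<le> \<alpha>"
  proof (intro eventually_sequentiallyI[of 1])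
    fix n :: nat assume n: "1 \<le> n"
    have "real (nat \<lfloor>real n * \<alpha>\<rfloor>) \<le> real n * \<alpha>" unfolding fl by linarith
    then show "real (nat \<lfloor>real n * \<alpha>\<rfloor>) / real n \<le> \<alpha>" using n by (simp add: field_simps)
  qed
  show "(\<lambda>n. \<alpha> - 1 / real n) \<longlonglongrightarrow> \<alpha>"
    using tendsto_diff[OF tendsto_const[of \<alpha>] lim_1_over_n] by simp
qed simp

lemma tendsto_div_multiple:
  assumes "0 < B"
  shows "(\<lambda>n. real (n div B) / real n) \<longlonglongrightarrow> 1 / real B"
proof -
  have "nat \<lfloor>real n * (1 / real B)\<rfloor> = n div B" for n
    using floor_divide_of_nat_eq[of n B, where 'a = real] by simp
  then show ?thesis using tendsto_floor_multiple[of "1 / real B"] by simp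
qed

context random_environment
begin

lemma p0_bounds: "0 < p0" "p0 \<le> 1"
  using charged by (auto simp: p0_def)

context
  fixes \<Psi> :: "real \<Rightarrow> real \<Rightarrow> real" and \<mu> :: real
  assumes limit: "is_limit_shape M X \<Psi>"
    and tails: "\<And>h. h \<in> HH \<Longrightarrow> sqrt_tails_finite h"
    and mean_le: "\<And>h. h \<in> HH \<Longrightarrow> mean h \<le> \<mu>"
    and mean_h0: "mean h0 = \<mu>"
begin

lemma integrable_state: "h \<in> HH \<Longrightarrow> integrable h (\<lambda>y. y)"
  by (rule real_distribution.integrable_identity[OF state_distribution tails])

text \<open>The L1 distance of the scaled passage time to \<Psi> is itself a nonnegative function of
  the weights in the box, so \<open>good_pattern\<close> applies to it. The limit thus becomes a
  statement on product measures with fixed rows.\<close>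

lemma eventually_good_pattern:
  fixes \<alpha> \<delta> :: real
  assumes \<alpha>: "0 < \<alpha>" and \<delta>: "0 < \<delta>"
  defines "l \<equiv> \<lambda>n. nat \<lfloor>real n * \<alpha>\<rfloor>"
  shows "\<forall>\<^sub>F n in sequentially. \<exists>w. (\<forall>j. w j \<in> HH) \<and>
    p0 / 2 * real (Suc (l n)) \<le> real (card {j. j \<le> l n \<and> w j = h0}) \<and>
    \<bar>(\<integral>x. last_passage x n (l n) \<partial>row_product.Q w n (l n)) / real n - \<Psi> 1 \<alpha>\<bar> \<le> \<delta>"
proof -
  have lim: "(\<lambda>n. \<integral>\<^sup>+\<omega>. ennreal \<bar>scaled_passage X 1 \<alpha> n \<omega> - \<Psi> 1 \<alpha>\<bar> \<partial>M) \<longlonglongrightarrow> 0"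
    using limit \<alpha> by (simp add: is_limit_shape_def)
  \<comment> \<open>The factor \<open>p0 / 2\<close> anticipates the loss in
    \<open>good_pattern\<close>, independent of \<open>n\<close>.\<close>
  have "0 < ennreal (p0 / 2 * \<delta>)" using p0_bounds \<delta> by simp
  from order_tendstoD(2)[OF lim this] show ?thesis
  proof eventually_elim
    case (elim n)
    define f where "f = (\<lambda>x. ennreal \<bar>last_passage x n (l n) / real n - \<Psi> 1 \<alpha>\<bar>)"
    have T_m: "(\<lambda>x. last_passage x n (l n)) \<in> borel_measurable (row_product.Q w n (l n))"
      if "\<And>j. w j \<in> HH" for w
    proof -
      interpret row: row_product w n "l n" by (rule row_product_pattern[OF that])
      show ?thesis by (rule last_passage_measurable) (simp add: row.coord_measurable row.box_def)
    qed
    then have f_m: "f \<in> borel_measurable (row_product.Q w n (l n))" if "\<And>j. w j \<in> HH" for w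
      unfolding f_def using that
      by (intro measurable_compose[OF _ measurable_ennreal] borel_measurable_abs borel_measurable_diff
        borel_measurable_divide borel_measurable_const) auto
    obtain w where w: "\<And>j. w j \<in> HH" "p0 / 2 * real (Suc (l n)) \<le> real (card {j. j \<le> l n \<and> w j = h0})"
      "ennreal (p0 / 2) * (\<integral>\<^sup>+x. f x \<partial>row_product.Q w n (l n))
        \<le> (\<integral>\<^sup>+\<omega>. f (\<lambda>z\<in>{..n} \<times> {..l n}. X z \<omega>) \<partial>M)"
      using good_pattern[OF f_m] by blast
    interpret row: row_product w n "l n" by (rule row_product_pattern[OF w(1)])
    let ?T = "\<lambda>x. last_passage x n (l n)"
    have "f (\<lambda>z\<in>{..n} \<times> {..l n}. X z \<omega>) = ennreal \<bar>scaled_passage X 1 \<alpha> n \<omega> - \<Psi> 1 \<alpha>\<bar>" for \<omega>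
    proof -
      have "last_passage (\<lambda>z\<in>{..n} \<times> {..l n}. X z \<omega>) n (l n) = last_passage (\<lambda>z. X z \<omega>) n (l n)"
        by (rule last_passage_cong) simp
      then show ?thesis by (simp add: f_def scaled_passage_def l_def)
    qed
    then have "ennreal (p0 / 2) * (\<integral>\<^sup>+x. f x \<partial>row.Q) \<le> ennreal (p0 / 2 * \<delta>)"
      using w(3) elim by simp
    then have "ennreal (p0 / 2) * (\<integral>\<^sup>+x. f x \<partial>row.Q) \<le> ennreal (p0 / 2) * ennreal \<delta>"
      using p0_bounds \<delta> by (subst (asm) ennreal_mult) auto
    then have I_le: "(\<integral>\<^sup>+x. f x \<partial>row.Q) \<le> ennreal \<delta>"
      using p0_bounds by (subst (asm) ennreal_mult_le_mult_iff) auto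
    have T_int: "integrable row.Q ?T"
      by (rule row.integrable_last_passage[OF integrable_state[OF w(1)]])
    have "\<bar>(\<integral>x. ?T x \<partial>row.Q) / real n - \<Psi> 1 \<alpha>\<bar> = \<bar>\<integral>x. ?T x / real n - \<Psi> 1 \<alpha> \<partial>row.Q\<bar>"
      using T_int row.prob_space by simp
    also have "\<dots> \<le> (\<integral>x. \<bar>?T x / real n - \<Psi> 1 \<alpha>\<bar> \<partial>row.Q)"
      by (rule integral_abs_bound)
    also have "\<dots> = enn2real (\<integral>\<^sup>+x. f x \<partial>row.Q)"
      unfolding f_def using T_int by (intro integral_eq_nn_integral) auto
    also have "\<dots> \<le> \<delta>" using I_le \<delta> by (intro enn2real_leI) auto
    finally show ?case using w by blast
  qed
qed

lemma upper_bound: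
  obtains J where "0 \<le> J" "\<And>\<alpha>. 0 < \<alpha> \<Longrightarrow> \<alpha> < 1 \<Longrightarrow> \<Psi> 1 \<alpha> \<le> (1 + \<alpha>) * \<mu> + J * sqrt \<alpha>"
proof -
  \<comment> \<open>The level function is \<open>p x = (s x)^2\<close>: it dominates the tails of
    all states at once, and its square root \<open>s\<close> is integrable as a finite sum.\<close>
  define s where "s x = (\<Sum>h\<in>HH. sqrt (tail h x))" for x
  define J0 where "J0 = enn2real (\<integral>\<^sup>+x. ennreal (s x) \<partial>lborel)"
  have tail_m [measurable]: "tail h \<in> borel_measurable borel" if "h \<in> HH" for h
    using real_distribution.tail_measurable[OF state_distribution[OF that]] .
  have sqrt_m: "(\<lambda>x. sqrt (tail h x)) \<in> borel_measurable borel" if "h \<in> HH" for h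
    using tail_m[OF that] by measurable
  have tail_0: "0 \<le> tail h x" if "h \<in> HH" for h x
    using real_distribution.tail_bounds[OF state_distribution[OF that]] by auto
  have s_m: "s \<in> borel_measurable borel"
    unfolding s_def[abs_def] by (intro borel_measurable_sum sqrt_m)
  have s0: "0 \<le> s x" for x unfolding s_def using tail_0 by (intro sum_nonneg) auto
  have "(\<integral>\<^sup>+x. ennreal (s x) \<partial>lborel) = (\<integral>\<^sup>+x. (\<Sum>h\<in>HH. ennreal (sqrt (tail h x))) \<partial>lborel)"
    unfolding s_def using tail_0 by (intro nn_integral_cong sum_ennreal[symmetric]) auto
  also have "\<dots> = (\<Sum>h\<in>HH. \<integral>\<^sup>+x. ennreal (sqrt (tail h x)) \<partial>lborel)"
    by (intro nn_integral_sum measurable_compose[OF _ measurable_ennreal]) (simp add: sqrt_m)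
  also have "\<dots> < \<infinity>"
    using finite_states real_distribution.nn_integral_sqrt_tail_finite[OF state_distribution tails]
    by (auto simp: less_top)
  finally have J0: "(\<integral>\<^sup>+x. ennreal (s x) \<partial>lborel) = ennreal J0"
    by (simp add: J0_def)
  have tail_le: "tail h x \<le> (s x)\<^sup>2" if "h \<in> HH" for h x
  proof -
    have "sqrt (tail h x) \<le> s x"
      unfolding s_def using finite_states tail_0 that by (intro member_le_sum) auto
    then have "(sqrt (tail h x))\<^sup>2 \<le> (s x)\<^sup>2" using tail_0[OF that] by (intro power_mono) auto
    then show ?thesis using tail_0[OF that, of x] by simp
  qed
  show ?thesis
  proof (rule that)
    show "0 \<le> 36 * J0" by (simp add: J0_def)
    fix \<alpha> :: real assume \<alpha>: "0 < \<alpha>" "\<alpha> < 1"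
    define l where "l n = nat \<lfloor>real n * \<alpha>\<rfloor>" for n
    have l_le: "l n \<le> n" for n
    proof -
      have "real n * \<alpha> \<le> real n" using \<alpha> by (simp add: mult_left_le)
      then have "\<lfloor>real n * \<alpha>\<rfloor> \<le> int n" by linarith
      then show ?thesis by (simp add: l_def)
    qed
    have l_lim: "(\<lambda>n. real (l n) / real n) \<longlonglongrightarrow> \<alpha>"
      unfolding l_def using \<alpha> by (intro tendsto_floor_multiple) auto
    define R where "R n = (1 + real (l n) / real n) * \<mu>
       + 36 * J0 * sqrt ((1 + 1 / real n) * (real (l n) / real n + 1 / real n))" for n
    have R_lim: "R \<longlonglongrightarrow> (1 + \<alpha>) * \<mu> + 36 * J0 * sqrt ((1 + 0) * (\<alpha> + 0))"
      unfolding R_def by (intro tendsto_intros l_lim lim_1_over_n)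
    have "\<Psi> 1 \<alpha> \<le> (1 + \<alpha>) * \<mu> + 36 * J0 * sqrt ((1 + 0) * (\<alpha> + 0)) + \<delta>" if \<delta>: "0 < \<delta>" for \<delta>
    proof (rule tendsto_lowerbound[OF tendsto_add[OF R_lim tendsto_const]])
      show "\<forall>\<^sub>F n in sequentially. \<Psi> 1 \<alpha> \<le> R n + \<delta>"
        using eventually_good_pattern[OF \<alpha>(1) \<delta>] eventually_gt_at_top[of 0]
      proof eventually_elim
        case (elim n)
        then obtain w where w: "\<And>j. w j \<in> HH"
          "\<bar>(\<integral>x. last_passage x n (l n) \<partial>row_product.Q w n (l n)) / real n - \<Psi> 1 \<alpha>\<bar> \<le> \<delta>"
          unfolding l_def by blast
        interpret row: row_product w n "l n" by (rule row_product_pattern[OF w(1)])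
        let ?T = "\<lambda>x. last_passage x n (l n)"
        let ?q = "sqrt (real (Suc n) * real (Suc (l n)))"
        have T_int: "integrable row.Q ?T"
          by (rule row.integrable_last_passage[OF integrable_state[OF w(1)]])
        have "(\<integral>\<^sup>+x. ennreal (?T x - real (n + l n) * \<mu>) \<partial>row.Q)
          \<le> (\<integral>\<^sup>+x. ennreal (sqrt ((s x)\<^sup>2)) \<partial>lborel) * ennreal (36 * ?q)"
          using w(1) tails mean_le tail_le l_le s_m
          by (intro row.nn_integral_passage_excess_le) auto
        also have "\<dots> = ennreal (J0 * (36 * ?q))"
          using s0 J0 by (simp add: ennreal_mult J0_def)
        finally have nn: "(\<integral>\<^sup>+x. ennreal (?T x - real (n + l n) * \<mu>) \<partial>row.Q) \<le> ennreal (J0 * (36 * ?q))" .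
        have "(\<integral>x. ?T x \<partial>row.Q) - real (n + l n) * \<mu> = (\<integral>x. ?T x - real (n + l n) * \<mu> \<partial>row.Q)"
          using T_int row.prob_space by simp
        also have "\<dots> \<le> (\<integral>x. max 0 (?T x - real (n + l n) * \<mu>) \<partial>row.Q)"
          using T_int by (intro integral_mono integrable_max) auto
        also have "\<dots> = enn2real (\<integral>\<^sup>+x. ennreal (max 0 (?T x - real (n + l n) * \<mu>)) \<partial>row.Q)"
          using T_int by (intro integral_eq_nn_integral) auto
        also have "(\<integral>\<^sup>+x. ennreal (max 0 (?T x - real (n + l n) * \<mu>)) \<partial>row.Q)
            = (\<integral>\<^sup>+x. ennreal (?T x - real (n + l n) * \<mu>) \<partial>row.Q)"
          by (intro nn_integral_cong) (simp add: max_def ennreal_neg)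
        also have "enn2real \<dots> \<le> J0 * (36 * ?q)"
          using nn by (intro enn2real_leI) (simp_all add: J0_def)
        finally have "(\<integral>x. ?T x \<partial>row.Q) \<le> real (n + l n) * \<mu> + 36 * J0 * ?q" by (simp add: algebra_simps)
        then have "(\<integral>x. ?T x \<partial>row.Q) / real n \<le> (real (n + l n) * \<mu> + 36 * J0 * ?q) / real n"
          by (rule divide_right_mono) simp
        also have "\<dots> = R n"
        proof -
          have "?q / real n = sqrt (real (Suc n) * real (Suc (l n)) / (real n)\<^sup>2)"
            by (simp add: real_sqrt_divide)
          also have "real (Suc n) * real (Suc (l n)) / (real n)\<^sup>2
              = (1 + 1 / real n) * (real (l n) / real n + 1 / real n)"
            using elim(2) by (simp add: field_simps power2_eq_square)
          finally have q_eq: "?q / real n = sqrt ((1 + 1 / real n) * (real (l n) / real n + 1 / real n))" .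
          have "(real (n + l n) * \<mu> + 36 * J0 * y) / real n
              = (1 + real (l n) / real n) * \<mu> + 36 * J0 * (y / real n)" for y
            using elim(2) by (simp add: field_simps)
          then show ?thesis by (simp only: R_def q_eq)
        qed
        finally show ?case using w(2) by linarith
      qed
    qed simp
    then have "\<Psi> 1 \<alpha> \<le> (1 + \<alpha>) * \<mu> + 36 * J0 * sqrt ((1 + 0) * (\<alpha> + 0))"
      by (rule field_le_epsilon)
    then show "\<Psi> 1 \<alpha> \<le> (1 + \<alpha>) * \<mu> + 36 * J0 * sqrt \<alpha>" by simp
  qed
qed

lemma lower_bound_blocks:
  assumes \<alpha>: "0 < \<alpha>" and B: "8 / (p0 * \<alpha>) \<le> real B" and t: "0 < t"
    and a: "\<And>h. h \<in> HH \<Longrightarrow> (\<integral>y. \<bar>y\<bar> \<partial>h) \<le> a"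
  shows "\<mu> + (1 - ((norm (char h0 t))\<^sup>2) ^ B) / (2 * t) / real B - 2 * a * \<alpha> \<le> \<Psi> 1 \<alpha>"
proof -
  define G where "G = real B * \<mu> + (1 - ((norm (char h0 t))\<^sup>2) ^ B) / (2 * t)"
  define l where "l n = nat \<lfloor>real n * \<alpha>\<rfloor>" for n
  have B0: "0 < B" using B p0_bounds \<alpha> by (smt (verit) divide_pos_pos mult_pos_pos of_nat_0 gr0I)
  have a0: "0 \<le> a" by (rule order_trans[OF _ a[OF h0]]) simp
  have l_lim: "(\<lambda>n. real (l n) / real n) \<longlonglongrightarrow> \<alpha>"
    unfolding l_def using \<alpha> by (intro tendsto_floor_multiple) auto
  define R where "R n = real (n div B) / real n * G - a * (2 * (real (l n) / real n) + real B * (1 / real n))" for n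
  have R_lim: "R \<longlonglongrightarrow> 1 / real B * G - a * (2 * \<alpha> + real B * 0)"
    unfolding R_def by (intro tendsto_intros l_lim lim_1_over_n tendsto_div_multiple B0)
  have "1 / real B * G - a * (2 * \<alpha> + real B * 0) \<le> \<Psi> 1 \<alpha> + \<delta>" if \<delta>: "0 < \<delta>" for \<delta>
  proof (rule tendsto_upperbound[OF R_lim])
    show "\<forall>\<^sub>F n in sequentially. R n \<le> \<Psi> 1 \<alpha> + \<delta>"
      using eventually_good_pattern[OF \<alpha> \<delta>] eventually_ge_at_top[of "nat \<lceil>4 / (p0 * \<alpha>)\<rceil>"]
        eventually_gt_at_top[of 0]
    proof eventually_elim
      case (elim n)
      then obtain w where w: "\<And>j. w j \<in> HH"
        "p0 / 2 * real (Suc (l n)) \<le> real (card {j. j \<le> l n \<and> w j = h0})"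
        "\<bar>(\<integral>x. last_passage x n (l n) \<partial>row_product.Q w n (l n)) / real n - \<Psi> 1 \<alpha>\<bar> \<le> \<delta>"
        unfolding l_def by blast
      interpret row: row_product w n "l n" by (rule row_product_pattern[OF w(1)])
      define K where "K = n div B"
      define S where "S = {j. j \<le> l n \<and> w j = h0}"
      have finS: "finite S" by (simp add: S_def)
      \<comment> \<open>Two rows per block and one more for \<open>u K\<close>. The 8 in the bound
        on \<open>B\<close> gives \<open>2 * K \<le> p0 * \<alpha> * n / 4\<close>, the requirement
        \<open>n \<ge> 4 / (p0 * \<alpha>)\<close> gives the same room for the extra row, and the
        supply is at least \<open>p0 * \<alpha> * n / 2\<close>.\<close>
      have "real (2 * K + 1) \<le> real (card S)"
      proof -
        have p\<alpha>: "0 < p0 * \<alpha>" using p0_bounds \<alpha> by simp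
        have "real K \<le> real n / real B" unfolding K_def by (rule of_nat_div_le_of_nat)
        also have "\<dots> \<le> real n / (8 / (p0 * \<alpha>))"
        proof (rule divide_left_mono[OF B])
          show "0 < real B * (8 / (p0 * \<alpha>))"
            using B0 p0_bounds \<alpha> by (intro mult_pos_pos divide_pos_pos) auto
        qed simp
        also have "\<dots> = p0 * \<alpha> * real n / 8" by simp
        finally have "2 * real K \<le> p0 * \<alpha> * real n / 4" by simp
        moreover have "1 \<le> p0 * \<alpha> * real n / 4"
        proof -
          have "4 / (p0 * \<alpha>) \<le> real n" using elim(2) by linarith
          then show ?thesis using p\<alpha> by (simp add: field_simps)
        qed
        moreover have "p0 / 2 * (real n * \<alpha>) \<le> p0 / 2 * real (Suc (l n))"
        proof (rule mult_left_mono)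
          have "real n * \<alpha> \<le> of_int \<lfloor>real n * \<alpha>\<rfloor> + 1" by linarith
          also have "\<dots> = real (Suc (l n))" using \<alpha> by (simp add: l_def)
          finally show "real n * \<alpha> \<le> real (Suc (l n))" .
        qed (use p0_bounds in auto)
        ultimately show ?thesis using w(2) unfolding S_def[symmetric] by (simp add: algebra_simps)
      qed
      then have cardS: "2 * K + 1 \<le> card S" by linarith
      define xs where "xs = sorted_list_of_set S"
      have xs: "length xs = card S" "sorted_wrt (<) xs" "set xs = S"
        using finS by (auto simp: xs_def)
      have nth_S: "xs ! i \<in> S" if "i \<le> 2 * K" for i
        using xs that cardS nth_mem[of i xs] by auto
      have less: "xs ! i < xs ! j" if "i < j" "j \<le> 2 * K" for i j
        using xs that cardS by (auto intro: sorted_wrt_nth_less)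
      have KB: "K * B \<le> n" "real (n - K * B) \<le> real B"
      proof -
        show "K * B \<le> n" unfolding K_def by simp
        have "n - K * B = n mod B" unfolding K_def by (simp add: minus_div_mult_eq_mod)
        then show "real (n - K * B) \<le> real B" using mod_less_divisor[OF B0, of n] by simp
      qed
      have "real K * (real B * mean h0 + (1 - ((norm (char h0 t))\<^sup>2) ^ B) / (2 * t))
          - a * (2 * real (l n) + real (n - K * B)) \<le> (\<integral>x. last_passage x n (l n) \<partial>row.Q)"
      proof (rule row.expectation_last_passage_ge[where u = "\<lambda>b. xs ! (2 * b)" and v = "\<lambda>b. xs ! (2 * b + 1)"])
        show "xs ! (2 * b) < xs ! (2 * b + 1) \<and> xs ! (2 * b + 1) \<le> xs ! (2 * Suc b)" if "b < K" for b
          using less[of "2 * b" "2 * b + 1"] less[of "2 * b + 1" "2 * Suc b"] that by simp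
        show "xs ! (2 * K) \<le> l n" using nth_S[of "2 * K"] by (simp add: S_def)
        show "w (xs ! (2 * b)) = h0 \<and> w (xs ! (2 * b + 1)) = h0" if "b < K" for b
          using nth_S[of "2 * b"] nth_S[of "2 * b + 1"] that by (simp add: S_def)
      qed (use KB w(1) integrable_state a t in auto)
      then have "real K * G - a * (2 * real (l n) + real (n - K * B)) \<le> (\<integral>x. last_passage x n (l n) \<partial>row.Q)"
        by (simp add: G_def mean_h0)
      moreover have "a * (2 * real (l n) + real (n - K * B)) \<le> a * (2 * real (l n) + real B)"
        using a0 KB by (intro mult_left_mono) auto
      ultimately have "real K * G - a * (2 * real (l n) + real B) \<le> (\<integral>x. last_passage x n (l n) \<partial>row.Q)"
        by linarith
      then have "(real K * G - a * (2 * real (l n) + real B)) / real n \<le> (\<integral>x. last_passage x n (l n) \<partial>row.Q) / real n"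
        by (rule divide_right_mono) simp
      moreover have "R n = (real K * G - a * (2 * real (l n) + real B)) / real n"
        using elim(3) by (simp add: R_def K_def field_simps)
      ultimately show ?case using w(3) by linarith
    qed
  qed simp
  then have "1 / real B * G - a * (2 * \<alpha> + real B * 0) \<le> \<Psi> 1 \<alpha>"
    by (rule field_le_epsilon)
  moreover have "1 / real B * (real B * \<mu> + g) = \<mu> + g / real B" for g
    using B0 by (simp add: field_simps)
  moreover have "a * (2 * \<alpha> + real B * 0) = 2 * a * \<alpha>" by simp
  ultimately show ?thesis by (simp only: G_def)
qed

lemma lower_bound:
  assumes "\<not> degenerate h0"
  shows "\<exists>c>0. \<exists>\<alpha>0>0. \<exists>C. \<forall>\<alpha>. 0 < \<alpha> \<longrightarrow> \<alpha> < \<alpha>0 \<longrightarrow> \<mu> + c * sqrt \<alpha> - C * \<alpha> \<le> \<Psi> 1 \<alpha>"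
proof -
  obtain c0 t0 where c0: "0 < c0" and t0: "0 < t0"
    and char: "\<And>t. 0 < t \<Longrightarrow> t \<le> t0 \<Longrightarrow> (norm (char h0 t))\<^sup>2 \<le> 1 - c0 * t\<^sup>2"
    by (rule real_distribution.norm_char_square_le[OF state_distribution[OF h0] assms]) (blast intro: that)
  define a where "a = (\<Sum>h\<in>HH. \<integral>y. \<bar>y\<bar> \<partial>h)"
  have a: "(\<integral>y. \<bar>y\<bar> \<partial>h) \<le> a" if "h \<in> HH" for h
    unfolding a_def using that finite_states by (intro member_le_sum) auto
  \<comment> \<open>The factor \<open>sqrt p0 / 3\<close> comes from
    \<open>B \<le> 9 / (p0 * \<alpha>)\<close>, that is
    \<open>t \<ge> sqrt (p0 * \<alpha>) / 3\<close>; the rest is the gain per column divided by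
    \<open>t\<close>.\<close>
  define c where "c = (1 - exp (- c0)) / 2 * (sqrt p0 / 3)"
  show ?thesis
  proof (intro exI conjI allI impI)
    show "0 < c" using c0 p0_bounds by (simp add: c_def)
    show "0 < min 1 (t0\<^sup>2)" using t0 by simp
    fix \<alpha> :: real assume \<alpha>: "0 < \<alpha>" "\<alpha> < min 1 (t0\<^sup>2)"
    have p\<alpha>: "0 < p0 * \<alpha>" "p0 * \<alpha> \<le> 1" "p0 * \<alpha> \<le> \<alpha>"
      using p0_bounds \<alpha> by (auto intro: mult_le_one)
    define B where "B = nat \<lceil>8 / (p0 * \<alpha>)\<rceil>"
    have ge8: "8 \<le> 8 / (p0 * \<alpha>)" using p\<alpha> by (simp add: field_simps)
    then have "0 \<le> \<lceil>8 / (p0 * \<alpha>)\<rceil>" by linarith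
    then have "real B = of_int \<lceil>8 / (p0 * \<alpha>)\<rceil>" unfolding B_def by (rule of_nat_nat)
    then have B: "8 / (p0 * \<alpha>) \<le> real B" "real B \<le> 8 / (p0 * \<alpha>) + 1" by linarith+
    have B0: "0 < real B" using B ge8 by linarith
    have B9: "real B \<le> 9 / (p0 * \<alpha>)"
    proof -
      have "1 \<le> 1 / (p0 * \<alpha>)" using p\<alpha> by (simp add: field_simps)
      then have "8 / (p0 * \<alpha>) + 1 \<le> 8 / (p0 * \<alpha>) + 1 / (p0 * \<alpha>)" by (rule add_left_mono)
      also have "\<dots> = 9 / (p0 * \<alpha>)" by (simp flip: add_divide_distrib)
      finally show ?thesis using B(2) by (rule order_trans[rotated])
    qed
    \<comment> \<open>The scale at which the characteristic function of a block of length
      \<open>B\<close> has decayed: its modulus satisfies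
      \<open>(1 - c0 / B) ^ B \<le> exp (- c0)\<close>. The condition \<open>\<alpha> < t0^2\<close>
      guarantees \<open>t \<le> t0\<close>.\<close>
    define t where "t = 1 / sqrt (real B)"
    have t: "0 < t" "t\<^sup>2 = 1 / real B" using B0 by (auto simp: t_def power_divide)
    have "t \<le> t0"
    proof (rule power2_le_imp_le)
      have "1 / real B \<le> 1 / (8 / (p0 * \<alpha>))"
        using B(1) by (rule divide_left_mono) (use p0_bounds \<alpha> B0 in auto)
      also have "\<dots> = p0 * \<alpha> / 8" by simp
      also have "\<dots> \<le> p0 * \<alpha>" using p\<alpha>(1) by linarith
      also have "\<dots> \<le> t0\<^sup>2" using p\<alpha>(3) \<alpha>(2) by linarith
      finally show "t\<^sup>2 \<le> t0\<^sup>2" unfolding t(2) .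
    qed (use t0 in simp)
    with t(1) have "(norm (char h0 t))\<^sup>2 \<le> 1 - c0 * t\<^sup>2" by (rule char)
    also have "\<dots> \<le> exp (- (c0 * t\<^sup>2))" using exp_ge_add_one_self[of "- (c0 * t\<^sup>2)"] by simp
    finally have "((norm (char h0 t))\<^sup>2) ^ B \<le> exp (- (c0 * t\<^sup>2)) ^ B"
      by (rule power_mono) simp
    also have "\<dots> = exp (- c0)"
      using B0 t(2) by (simp flip: exp_of_nat_mult)
    finally have "(1 - exp (- c0)) / (2 * t) / real B \<le> (1 - ((norm (char h0 t))\<^sup>2) ^ B) / (2 * t) / real B"
      using t B0 by (intro divide_right_mono) auto
    moreover have "(1 - exp (- c0)) / (2 * t) / real B = (1 - exp (- c0)) / 2 * t"
    proof -
      have "1 / real B = t * t" using t(2) by (simp add: power2_eq_square)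
      have "(1 - exp (- c0)) / (2 * t) / real B = (1 - exp (- c0)) / (2 * t) * (1 / real B)" by simp
      also have "\<dots> = (1 - exp (- c0)) / (2 * t) * (t * t)" by (simp only: \<open>1 / real B = t * t\<close>)
      finally show ?thesis using t(1) by simp
    qed
    moreover have "sqrt p0 / 3 * sqrt \<alpha> \<le> t"
    proof (rule power2_le_imp_le)
      have "p0 * \<alpha> / 9 = 1 / (9 / (p0 * \<alpha>))" by simp
      also have "\<dots> \<le> 1 / real B"
        using B9 by (rule divide_left_mono) (use p0_bounds \<alpha> B0 in auto)
      finally show "(sqrt p0 / 3 * sqrt \<alpha>)\<^sup>2 \<le> t\<^sup>2"
        using t(2) p0_bounds \<alpha> by (simp add: power_mult_distrib power_divide)
    qed (use t in simp)
    then have "c * sqrt \<alpha> \<le> (1 - exp (- c0)) / 2 * t"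
      unfolding c_def using c0 mult_left_mono[of "sqrt p0 / 3 * sqrt \<alpha>" t "(1 - exp (- c0)) / 2"] by simp
    ultimately show "\<mu> + c * sqrt \<alpha> - 2 * a * \<alpha> \<le> \<Psi> 1 \<alpha>"
      using lower_bound_blocks[OF \<alpha>(1) B(1) t(1) a] by linarith
  qed
qed

end

end

text \<open>Serves for the linear errors of both bounds: the cost of vertical moves below and the
  mean weight of the additional \<open>\<alpha> * n\<close> sites above.\<close>

lemma linear_smallo_sqrt: "(\<lambda>\<alpha>. C * \<alpha>) \<in> o[at_right 0](\<lambda>\<alpha>. sqrt \<alpha> :: real)"
proof (rule smalloI_tendsto)
  have "((\<lambda>\<alpha>. C * sqrt \<alpha>) \<longlongrightarrow> C * sqrt 0) (at_right 0)"
    by (intro tendsto_intros)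
  then have "((\<lambda>\<alpha>. C * sqrt \<alpha>) \<longlongrightarrow> 0) (at_right 0)" by simp
  moreover have "\<forall>\<^sub>F \<alpha> in at_right 0. C * sqrt \<alpha> = C * \<alpha> / sqrt \<alpha>"
    using eventually_at_right_less[of "0::real"]
    by eventually_elim (simp add: real_div_sqrt flip: times_divide_eq_right)
  ultimately show "((\<lambda>\<alpha>. C * \<alpha> / sqrt \<alpha>) \<longlongrightarrow> 0) (at_right 0)"
    by (rule Lim_transform_eventually)
  show "\<forall>\<^sub>F \<alpha> in at_right 0. sqrt \<alpha> \<noteq> (0 :: real)"
    using eventually_at_right_less[of "0::real"] by eventually_elim simp
qed

theorem theorem4p2p3:
  fixes M :: "'w measure"
    and F :: "nat \<Rightarrow> 'w \<Rightarrow> real measure"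
    and X :: "nat \<times> nat \<Rightarrow> 'w \<Rightarrow> real"
    and \<Psi> :: "real \<Rightarrow> real \<Rightarrow> real"
    and L :: nat
    and H :: "nat \<Rightarrow> real measure"
    and \<mu>max :: real
  assumes "prob_space M"
    and "\<And>j. F j \<in> M \<rightarrow>\<^sub>M prob_algebra borel"
    and "stationary_env (env_law M F)"
    and "ergodic_env (env_law M F)"
    and "L \<ge> 1"
    and "\<And>l. l \<in> {1..L} \<Longrightarrow> real_distribution (H l)"
    and "has_state_space M F L H"
    and "\<And>l. l \<in> {1..L} \<Longrightarrow> sqrt_tails_finite (H l)"
    and "weights_given_env M F X"
    and "is_limit_shape M X \<Psi>"
    and "\<mu>max = Max ((\<lambda>l. mean (H l)) ` {1..L})"
    and "\<exists>l\<in>{1..L}. mean (H l) = \<mu>max \<and> \<not> degenerate (H l)"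
  shows "\<exists>c1 c2 :: real. 0 < c1 \<and> c1 < c2 \<and>
    (\<exists>e1 e2 :: real \<Rightarrow> real.
       e1 \<in> o[at_right 0](\<lambda>\<alpha>. sqrt \<alpha>) \<and> e2 \<in> o[at_right 0](\<lambda>\<alpha>. sqrt \<alpha>) \<and>
       (\<forall>\<^sub>F \<alpha> in at_right 0.
          \<mu>max + c1 * sqrt \<alpha> + e1 \<alpha> \<le> \<Psi> 1 \<alpha> \<and>
          \<Psi> 1 \<alpha> \<le> \<mu>max + c2 * sqrt \<alpha> + e2 \<alpha>))"
proof -
  define HH where "HH = H ` {1..L}"
  obtain l0 where l0: "l0 \<in> {1..L}" "mean (H l0) = \<mu>max" "\<not> degenerate (H l0)"
    using assms(12) by blast
  interpret random_environment M F X HH "H l0"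
    unfolding random_environment_def random_environment_axioms_def HH_def
    using assms(1-3,6,7,9) l0(1) by (auto simp: has_state_space_def)
  have mean_le: "mean h \<le> \<mu>max" if "h \<in> HH" for h
    using that assms(11) by (auto simp: HH_def intro!: Max_ge)
  have tails: "sqrt_tails_finite h" if "h \<in> HH" for h
    using that assms(8) by (auto simp: HH_def)
  obtain J where J: "0 \<le> J"
    "\<And>\<alpha>. 0 < \<alpha> \<Longrightarrow> \<alpha> < 1 \<Longrightarrow> \<Psi> 1 \<alpha> \<le> (1 + \<alpha>) * \<mu>max + J * sqrt \<alpha>"
    by (rule upper_bound[OF assms(10) tails mean_le l0(2)]) (simp_all add: that)
  obtain c C \<alpha>0 where c: "0 < c" "0 < \<alpha>0"
    "\<forall>\<alpha>. 0 < \<alpha> \<longrightarrow> \<alpha> < \<alpha>0 \<longrightarrow> \<mu>max + c * sqrt \<alpha> - C * \<alpha> \<le> \<Psi> 1 \<alpha>"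
    using lower_bound[OF assms(10) tails mean_le l0(2,3)] by auto
  \<comment> \<open>The 1 in \<open>J + c + 1\<close> makes the upper constant strictly larger than
    the lower constant \<open>c\<close>, since \<open>J\<close> is only known to be nonnegative. The
    error functions are \<open>- C * \<alpha>\<close> and
    \<open>\<mu>max * \<alpha>\<close>.\<close>
  have ev: "\<forall>\<^sub>F \<alpha> in at_right 0. \<mu>max + c * sqrt \<alpha> + (- C) * \<alpha> \<le> \<Psi> 1 \<alpha> \<and>
      \<Psi> 1 \<alpha> \<le> \<mu>max + (J + c + 1) * sqrt \<alpha> + \<mu>max * \<alpha>"
  proof -
    have "0 < min 1 \<alpha>0" using c(2) by simp
    then have "\<forall>\<^sub>F \<alpha> in at_right 0. \<alpha> < min 1 \<alpha>0"
      by (rule eventually_at_right_real[THEN eventually_mono]) auto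
    then show ?thesis
      using eventually_at_right_less[of "0::real"]
    proof eventually_elim
      case (elim \<alpha>)
      have "J * sqrt \<alpha> \<le> (J + c + 1) * sqrt \<alpha>" using c(1) elim(2) by (intro mult_right_mono) auto
      then show ?case using c(3)[rule_format, of \<alpha>] J(2)[of \<alpha>] elim by (simp add: algebra_simps)
    qed
  qed
  have "c < J + c + 1" using J(1) by simp
  with c(1) ev linear_smallo_sqrt[of "- C"] linear_smallo_sqrt[of \<mu>max] show ?thesis by blast
qed

end
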